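(* Let $\mathbb{F}$ be a field. The coinvariant algebra $\mathbb{F}[\Lambda]/(a_1,\dots,a_r)$ of the Weyl group $W$, with the $H_W(0)$-action $T_i\mapsto\overline\pi_i$, has an $\mathbb{F}$-basis $\{\overline\pi_w e^{\lambda_{D(w)}}: w\in W\}$ and decomposes as \[ \mathbb{F}[\Lambda]/(a_1,\dots,a_r)=\bigoplus_{\alpha\models r+1}H_W(0)\cdot\overline\pi_{w_0(\alpha)}z_\alpha, \] where each summand $H_W(0)\cdot\overline\pi_{w_0(\alpha)}z_\alpha$ has $\mathbb{F}$-basis $\{\overline\pi_w z_\alpha: w\in[w_0(\alpha),w_1(\alpha)]\}$ and is isomorphic to the projective indecomposable $H_W(0)$-module $\mathbf P_\alpha$. Consequently $\mathbb{F}[\Lambda]/(a_1,\dots,a_r)$ is isomorphic to the regular representation of $H_W(0)$.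
   Context: $W$ is the Weyl group of a (crystallographic) root system of rank $r$ with simple roots $\gamma_1,\dots,\gamma_r$, simple reflections $s_1,\dots,s_r$, fundamental weights $\lambda_1,\dots,\lambda_r$ and weight lattice $\Lambda$. $\mathbb{F}[\Lambda]$ is the group algebra of $\Lambda$ with basis $\{e^\lambda:\lambda\in\Lambda\}$, i.e. $\mathbb{F}[z_1^{\pm1},\dots,z_r^{\pm1}]$ with $z_i=e^{\lambda_i}$; $W$ acts by $w e^\lambda=e^{w\lambda}$. Demazure operators: $\pi_i f=\frac{f-e^{-\gamma_i}s_i(f)}{1-e^{-\gamma_i}}$, $\overline\pi_i=\pi_i-1$. The $0$-Hecke algebra $H_W(0)$ is generated by $T_1,\dots,T_r$ with $T_i^2=-T_i$ and the braid relations of $W$; $T_w,T'_w$ ($T'_i=T_i+1$) and $\overline\pi_w$ are defined via reduced words; $H_W(0)$ acts on $\mathbb{F}[\Lambda]$ by $T_i\mapsto\overline\pi_i$, $\mathbb{F}[\Lambda]^W$-linearly. $a_i=\sum_{w\in W/W_{i^c}}e^{w\lambda_i}$, where $W_{i^c}$ is generated by $\{s_j:j\ne i\}$. $D(w)=\{i:\ell(ws_i)<\ell(w)\}\subseteq[r]$. Compositions $\alpha$ of $r+1$ correspond bijectively to subsets $D(\alpha)\subseteq[r]$ (partial sums), and $\alpha^c$ has $D(\alpha^c)=[r]\setminus D(\alpha)$. For $I\subseteq[r]$, $\lambda_I=\sum_{i\in I}\lambda_i$; $\lambda_\alpha=\lambda_{D(\alpha)}$, $z_\alpha=e^{\lambda_\alpha}$.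 $w_0(\alpha)$ is the longest element of the parabolic subgroup generated by $\{s_i:i\in D(\alpha)\}$, and $\{w\in W: D(w)=D(\alpha)\}$ is an interval $[w_0(\alpha),w_1(\alpha)]$ in left weak order. $\mathbf P_\alpha:=H_W(0)\,T_{w_0(\alpha)}T'_{w_0(\alpha^c)}$. *)

theory Defs
  imports Main "HOL-Library.Poly_Mapping" "HOL-Library.Function_Algebras"
begin

(* Weights are written in the basis of fundamental weights: a weight is a function 'n => int,
   lambda = sum_i lambda(i) lambda_i.  The Cartan matrix entry C i j = <gamma_i^vee, gamma_j>,
   so the simple root gamma_j has fundamental-weight coordinates (\<lambda>i. C i j). *)

type_synonym 'n weight = "'n \<Rightarrow> int"
type_synonym 'n weyl_elt = "'n weight \<Rightarrow> 'n weight"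

definition gen_cartan :: "('n \<Rightarrow> 'n \<Rightarrow> int) \<Rightarrow> bool" where
  "gen_cartan C \<longleftrightarrow> (\<forall>i. C i i = 2) \<and> (\<forall>i j. i \<noteq> j \<longrightarrow> C i j \<le> 0)
     \<and> (\<forall>i j. C i j = 0 \<longleftrightarrow> C j i = 0)"

definition simple_root :: "('n \<Rightarrow> 'n \<Rightarrow> int) \<Rightarrow> 'n \<Rightarrow> 'n weight" where
  "simple_root C j = (\<lambda>i. C i j)"

definition fund_weight :: "'n \<Rightarrow> 'n weight" where
  "fund_weight i = (\<lambda>j. if j = i then 1 else 0)"

definition weight_of_set :: "'n set \<Rightarrow> 'n weight" where
  "weight_of_set I = (\<lambda>j. if j \<in> I then 1 else 0)"

(* simple reflection s_j(lambda) = lambda - <gamma_j^vee, lambda> gamma_j *)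
definition sref :: "('n \<Rightarrow> 'n \<Rightarrow> int) \<Rightarrow> 'n \<Rightarrow> 'n weyl_elt" where
  "sref C j = (\<lambda>x. (\<lambda>i. x i - x j * C i j))"

inductive_set weyl :: "('n \<Rightarrow> 'n \<Rightarrow> int) \<Rightarrow> 'n set \<Rightarrow> 'n weyl_elt set"
  for C :: "'n \<Rightarrow> 'n \<Rightarrow> int" and J :: "'n set" where
  weyl_id: "id \<in> weyl C J"
| weyl_step: "w \<in> weyl C J \<Longrightarrow> j \<in> J \<Longrightarrow> w \<circ> sref C j \<in> weyl C J"

definition word_elt :: "('n \<Rightarrow> 'n \<Rightarrow> int) \<Rightarrow> 'n list \<Rightarrow> 'n weyl_elt" where
  "word_elt C is = foldr (\<lambda>i f. sref C i \<circ> f) is id"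

definition wlen :: "('n \<Rightarrow> 'n \<Rightarrow> int) \<Rightarrow> 'n weyl_elt \<Rightarrow> nat" where
  "wlen C w = (LEAST k. \<exists>is. length is = k \<and> word_elt C is = w)"

definition reduced_word_of :: "('n \<Rightarrow> 'n \<Rightarrow> int) \<Rightarrow> 'n weyl_elt \<Rightarrow> 'n list" where
  "reduced_word_of C w = (SOME is. word_elt C is = w \<and> length is = wlen C w)"

definition descent :: "('n \<Rightarrow> 'n \<Rightarrow> int) \<Rightarrow> 'n weyl_elt \<Rightarrow> 'n set" where
  "descent C w = {i. wlen C (w \<circ> sref C i) < wlen C w}"

definition longest :: "('n \<Rightarrow> 'n \<Rightarrow> int) \<Rightarrow> 'n set \<Rightarrow> 'n weyl_elt" where
  "longest C J = (THE w. w \<in> weyl C J \<and> (\<forall>v \<in> weyl C J. wlen C v \<le> wlen C w))"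

definition op_word :: "('n \<Rightarrow> 'x \<Rightarrow> 'x) \<Rightarrow> 'n list \<Rightarrow> 'x \<Rightarrow> 'x" where
  "op_word f is = foldr (\<lambda>i g. f i \<circ> g) is id"

type_synonym ('n, 'a) laurent = "'n weight \<Rightarrow>\<^sub>0 'a"

definition expw :: "'n weight \<Rightarrow> ('n, 'a::field) laurent" where
  "expw \<mu> = Poly_Mapping.single \<mu> 1"

definition smult :: "'a::field \<Rightarrow> ('n, 'a) laurent \<Rightarrow> ('n, 'a) laurent" where
  "smult c f = Poly_Mapping.map (\<lambda>x. c * x) f"

definition wact :: "'n weyl_elt \<Rightarrow> ('n, 'a::field) laurent \<Rightarrow> ('n, 'a) laurent" where
  "wact w f = (\<Sum>\<mu>\<in>Poly_Mapping.keys f. Poly_Mapping.single (w \<mu>) (Poly_Mapping.lookup f \<mu>))"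

(* Demazure operator: pi_i f = (f - e^{-gamma_i} s_i f) / (1 - e^{-gamma_i}) *)
definition demazure :: "('n \<Rightarrow> 'n \<Rightarrow> int) \<Rightarrow> 'n \<Rightarrow> ('n, 'a::field) laurent \<Rightarrow> ('n, 'a) laurent" where
  "demazure C i f = (THE g. (1 - expw (- simple_root C i)) * g
                              = f - expw (- simple_root C i) * wact (sref C i) f)"

definition demazure_bar :: "('n \<Rightarrow> 'n \<Rightarrow> int) \<Rightarrow> 'n \<Rightarrow> ('n, 'a::field) laurent \<Rightarrow> ('n, 'a) laurent" where
  "demazure_bar C i f = demazure C i f - f"

definition demazure_bar_w :: "('n \<Rightarrow> 'n \<Rightarrow> int) \<Rightarrow> 'n weyl_elt \<Rightarrow> ('n, 'a::field) laurent \<Rightarrow> ('n, 'a) laurent" where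
  "demazure_bar_w C w = op_word (demazure_bar C) (reduced_word_of C w)"

definition left_cosets_par :: "('n \<Rightarrow> 'n \<Rightarrow> int) \<Rightarrow> 'n set \<Rightarrow> 'n weyl_elt set set" where
  "left_cosets_par C J = {(\<lambda>v. w \<circ> v) ` weyl C J | w. w \<in> weyl C UNIV}"

definition a_gen :: "('n \<Rightarrow> 'n \<Rightarrow> int) \<Rightarrow> 'n \<Rightarrow> ('n, 'a::field) laurent" where
  "a_gen C i = (\<Sum>c\<in>left_cosets_par C (- {i}). expw ((SOME w. w \<in> c) (fund_weight i)))"

definition coinv_ideal :: "('n::finite \<Rightarrow> 'n \<Rightarrow> int) \<Rightarrow> ('n, 'a::field) laurent set" where
  "coinv_ideal C = {f. \<exists>g. f = (\<Sum>i\<in>UNIV. g i * a_gen C i)}"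

definition lincomb :: "'w set \<Rightarrow> ('w \<Rightarrow> 'a::field) \<Rightarrow> ('w \<Rightarrow> ('n, 'a) laurent) \<Rightarrow> ('n, 'a) laurent" where
  "lincomb S c b = (\<Sum>w\<in>S. smult (c w) (b w))"

definition lin_indep_mod :: "('n, 'a::field) laurent set \<Rightarrow> 'w set \<Rightarrow> ('w \<Rightarrow> ('n, 'a) laurent) \<Rightarrow> bool" where
  "lin_indep_mod J S b \<longleftrightarrow> (\<forall>c. lincomb S c b \<in> J \<longrightarrow> (\<forall>w\<in>S. c w = 0))"

definition spans_mod :: "('n, 'a::field) laurent set \<Rightarrow> 'w set \<Rightarrow> ('w \<Rightarrow> ('n, 'a) laurent)
    \<Rightarrow> ('n, 'a) laurent set \<Rightarrow> bool" where
  "spans_mod J S b M \<longleftrightarrow> (\<forall>m\<in>M. \<exists>c. m - lincomb S c b \<in> J)"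

(* {b w mod J : w in S} is an F-basis of the subspace (M + J)/J; M is given as a preimage *)
definition basis_mod :: "('n, 'a::field) laurent set \<Rightarrow> 'w set \<Rightarrow> ('w \<Rightarrow> ('n, 'a) laurent)
    \<Rightarrow> ('n, 'a) laurent set \<Rightarrow> bool" where
  "basis_mod J S b M \<longleftrightarrow> (\<forall>w\<in>S. b w \<in> M) \<and> lin_indep_mod J S b \<and> spans_mod J S b M"

(* preimage in F[Lambda] of the cyclic H_W(0)-submodule H_W(0).v of F[Lambda]/J,
   where H_W(0) has basis T_w acting by pibar_w:  span{pibar_w v : w in W} + J *)
definition cyclic_mod :: "('n::finite \<Rightarrow> 'n \<Rightarrow> int) \<Rightarrow> ('n, 'a::field) laurent \<Rightarrow> ('n, 'a) laurent set" where
  "cyclic_mod C v = {f. \<exists>c. f - lincomb (weyl C UNIV) c (\<lambda>w. demazure_bar_w C w v) \<in> coinv_ideal C}"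

(* elements of H_W(0) are coefficient functions W => F (zero outside W) *)
type_synonym ('n, 'a) hecke = "'n weyl_elt \<Rightarrow> 'a"

definition hecke_alg :: "('n \<Rightarrow> 'n \<Rightarrow> int) \<Rightarrow> ('n, 'a::field) hecke set" where
  "hecke_alg C = {h. \<forall>w. w \<notin> weyl C UNIV \<longrightarrow> h w = 0}"

definition hbasis :: "'n weyl_elt \<Rightarrow> ('n, 'a::field) hecke" where
  "hbasis w = (\<lambda>v. if v = w then 1 else 0)"

(* T_i T_w = T_{s_i w} if l(s_i w) > l(w), and = T_i^2 T_{s_i w} = - T_w otherwise *)
definition hgen_times_basis :: "('n \<Rightarrow> 'n \<Rightarrow> int) \<Rightarrow> 'n \<Rightarrow> 'n weyl_elt \<Rightarrow> ('n, 'a::field) hecke" where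
  "hgen_times_basis C i w =
     (if wlen C w < wlen C (sref C i \<circ> w) then hbasis (sref C i \<circ> w) else - hbasis w)"

definition hgen :: "('n \<Rightarrow> 'n \<Rightarrow> int) \<Rightarrow> 'n \<Rightarrow> ('n, 'a::field) hecke \<Rightarrow> ('n, 'a) hecke" where
  "hgen C i h = (\<Sum>w\<in>weyl C UNIV. (\<lambda>v. h w * hgen_times_basis C i w v))"

definition hgen' :: "('n \<Rightarrow> 'n \<Rightarrow> int) \<Rightarrow> 'n \<Rightarrow> ('n, 'a::field) hecke \<Rightarrow> ('n, 'a) hecke" where
  "hgen' C i h = hgen C i h + h"

definition hT :: "('n \<Rightarrow> 'n \<Rightarrow> int) \<Rightarrow> 'n weyl_elt \<Rightarrow> ('n, 'a::field) hecke \<Rightarrow> ('n, 'a) hecke" where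
  "hT C w = op_word (hgen C) (reduced_word_of C w)"

definition hT' :: "('n \<Rightarrow> 'n \<Rightarrow> int) \<Rightarrow> 'n weyl_elt \<Rightarrow> ('n, 'a::field) hecke \<Rightarrow> ('n, 'a) hecke" where
  "hT' C w = op_word (hgen' C) (reduced_word_of C w)"

(* P_I = H_W(0) T_{w_0(I)} T'_{w_0(I^c)} = span{T_w T_{w_0(I)} T'_{w_0(I^c)} : w in W} *)
definition proj_mod :: "('n \<Rightarrow> 'n \<Rightarrow> int) \<Rightarrow> 'n set \<Rightarrow> ('n, 'a::field) hecke set" where
  "proj_mod C I =
     (let x = hT C (longest C I) (hT' C (longest C (- I)) (hbasis id)) in
      {h. \<exists>c. h = (\<Sum>w\<in>weyl C UNIV. (\<lambda>v. c w * hT C w x v))})"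

(* phi induces an isomorphism of H_W(0)-modules from the submodule P of H_W(0)
   (acting by left multiplication, T_i -> hgen i) onto the submodule (M+J)/J of F[Lambda]/J
   (T_i -> pibar_i); i.e. an F-linear bijection commuting with every generator T_i. *)
definition hmod_iso_mod :: "('n \<Rightarrow> 'n \<Rightarrow> int) \<Rightarrow> ('n, 'a::field) laurent set
    \<Rightarrow> ('n, 'a) hecke set \<Rightarrow> ('n, 'a) laurent set \<Rightarrow> (('n, 'a) hecke \<Rightarrow> ('n, 'a) laurent) \<Rightarrow> bool" where
  "hmod_iso_mod C J P M \<phi> \<longleftrightarrow>
     (\<forall>p\<in>P. \<phi> p \<in> M) \<and>
     (\<forall>p\<in>P. \<forall>q\<in>P. \<phi> (p + q) - (\<phi> p + \<phi> q) \<in> J) \<and>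
     (\<forall>p\<in>P. \<forall>c. \<phi> (\<lambda>v. c * p v) - smult c (\<phi> p) \<in> J) \<and>
     (\<forall>p\<in>P. \<forall>i. \<phi> (hgen C i p) - demazure_bar C i (\<phi> p) \<in> J) \<and>
     (\<forall>p\<in>P. \<phi> p \<in> J \<longrightarrow> p = 0) \<and>
     (\<forall>m\<in>M. \<exists>p\<in>P. m - \<phi> p \<in> J)"

end

(* Every weight is w \<lambda> with \<lambda> dominant and w of minimal length, and then \<lambda> - \<lambda>_D(w) is
   dominant. Order the weights by the height of \<lambda>, and inside an orbit by decreasing length of w.
   Multiplication by the orbit sum a_i shifts the leading exponent w \<lambda> to w (\<lambda> + \<lambda>_i), and
   pibar_w e^{\<lambda>_D(w)} has leading exponent w \<lambda>_D(w). So the products of monomials in the a_i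
   with the elements pibar_w e^{\<lambda>_D(w)} are unitriangular with respect to the basis e^\<mu>, hence
   themselves a basis of the group algebra; those with a nonconstant monomial span the ideal.
   This replaces the freeness of the group algebra over its invariants.

   Over a rank two parabolic the same argument reduces the braid relations of the pibar_i to
   generators of the group algebra over the dihedral invariants. Matsumoto's theorem then makes
   pibar_w, T_w and T'_w independent of the reduced word, and the elements T_w T'_{w_0(D(w)^c)},
   which are unitriangular with respect to the T_w, are permuted up to sign or killed by the T_i
   in exactly the same way as the elements pibar_w e^{\<lambda>_D(w)} are by the pibar_i. *)

theory Submission
  imports Defs
begin

text \<open>Nothing is given about roots: the hypotheses are a generalized Cartan matrix and a
  finite group. Positivity, the sign dichotomy for roots and the exchange property are therefore
  extracted from the invariant form obtained by summing the standard form over the group. All of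
  this stays over the integers, where the argument about signs rests on a divisibility that
  expresses the integrality of coroots. The field is arbitrary, so averaging over the group inside
  the group algebra is excluded; unitriangularity with leading coefficient 1 takes its place and
  works in every characteristic. The order on weights and the leading terms are developed for an
  arbitrary parabolic index set \<open>I\<close>, because they are used twice: for two indices,
  while pibar_w may still depend on the chosen reduced word, and then for the full index
  set.\<close>

lemma op_word_Nil [simp]: "op_word f [] = id"
  by (simp add: op_word_def)

lemma op_word_Cons [simp]: "op_word f (i # is) = f i \<circ> op_word f is"
  by (simp add: op_word_def)

lemma op_word_append [simp]: "op_word f (is @ js) = op_word f is \<circ> op_word f js"
  by (induction "is") (auto simp: comp_assoc)

section \<open>Words in the simple reflections and linearity of the action\<close>

lemma word_elt_Nil [simp]: "word_elt C [] = id"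
  by (simp add: word_elt_def)

lemma word_elt_Cons [simp]: "word_elt C (i # is) = sref C i \<circ> word_elt C is"
  by (simp add: word_elt_def)

lemma word_elt_append [simp]: "word_elt C (is @ js) = word_elt C is \<circ> word_elt C js"
  by (induction "is") (auto simp: comp_assoc)

lemma weyl_iff_word: "w \<in> weyl C I \<longleftrightarrow> (\<exists>is. set is \<subseteq> I \<and> w = word_elt C is)"
proof
  assume "w \<in> weyl C I"
  then show "\<exists>is. set is \<subseteq> I \<and> w = word_elt C is"
  proof induction
    case weyl_id
    then show ?case by (intro exI[of _ "[]"]) simp
  next
    case (weyl_step w j)
    then obtain "is" where "set is \<subseteq> I" "w = word_elt C is" by blast
    with weyl_step show ?case by (intro exI[of _ "is @ [j]"]) simp
  qed
next
  have "set is \<subseteq> I \<Longrightarrow> word_elt C is \<in> weyl C I" for "is"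
  proof (induction "is" rule: rev_induct)
    case Nil
    then show ?case using weyl_id[of C I] by (simp add: id_def)
  next
    case (snoc x xs)
    then show ?case using weyl_step[of "word_elt C xs" C I x] by (simp add: comp_def)
  qed
  then show "\<exists>is. set is \<subseteq> I \<and> w = word_elt C is \<Longrightarrow> w \<in> weyl C I" by blast
qed

lemma weyl_comp: "v \<in> weyl C I \<Longrightarrow> w \<in> weyl C I \<Longrightarrow> v \<circ> w \<in> weyl C I"
proof -
  assume "v \<in> weyl C I" "w \<in> weyl C I"
  then obtain a b where "set a \<subseteq> I" "v = word_elt C a" "set b \<subseteq> I" "w = word_elt C b"
    by (auto simp: weyl_iff_word)
  then show ?thesis
    unfolding weyl_iff_word by (intro exI[of _ "a @ b"]) simp
qed

lemma weyl_mono: "I \<subseteq> K \<Longrightarrow> weyl C I \<subseteq> weyl C K"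
  by (fastforce simp: weyl_iff_word)

lemma sref_in_weyl: "i \<in> I \<Longrightarrow> sref C i \<in> weyl C I"
  by (auto simp: weyl_iff_word intro!: exI[of _ "[i]"])

lemma sref_lin: "sref C k (\<lambda>i. \<Sum>j\<in>A. c j * f j i) = (\<lambda>i. \<Sum>j\<in>A. c j * sref C k (f j) i)"
  by (simp add: sref_def right_diff_distrib sum_subtractf sum_distrib_right mult.assoc)

lemma word_elt_lin:
  "word_elt C is (\<lambda>i. \<Sum>j\<in>A. c j * f j i) = (\<lambda>i. \<Sum>j\<in>A. c j * word_elt C is (f j) i)"
  by (induction "is") (simp_all add: sref_lin)

lemma weyl_lin:
  "w \<in> weyl C I \<Longrightarrow> w (\<lambda>i. \<Sum>j\<in>A. c j * f j i) = (\<lambda>i. \<Sum>j\<in>A. c j * w (f j) i)"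
  by (auto simp: weyl_iff_word word_elt_lin)

lemma sref_add: "sref C k (x + y) = sref C k x + sref C k y"
  by (auto simp: sref_def algebra_simps)

lemma word_elt_add: "word_elt C is (x + y) = word_elt C is x + word_elt C is y"
  by (induction "is") (simp_all only: word_elt_Nil word_elt_Cons id_apply comp_apply sref_add)

lemma weyl_add: "w \<in> weyl C I \<Longrightarrow> w (x + y) = w x + w y"
  by (auto simp: weyl_iff_word word_elt_add)

lemma weyl_zero: "w \<in> weyl C I \<Longrightarrow> w 0 = 0"
  using weyl_add[of w C I 0 0] by simp

lemma weyl_minus: "w \<in> weyl C I \<Longrightarrow> w (- x) = - w x"
  using weyl_add[of w C I x "- x"] weyl_zero[of w C I] by (simp add: eq_neg_iff_add_eq_0 add.commute)

lemma weyl_diff: "w \<in> weyl C I \<Longrightarrow> w (x - y) = w x - w y"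
  using weyl_add[of w C I x "- y"] weyl_minus[of w C I y] by simp

lemma weyl_scale: "w \<in> weyl C I \<Longrightarrow> w (\<lambda>i. c * x i) = (\<lambda>i. c * w x i)"
  using weyl_lin[where A = "{()}" and c = "\<lambda>_. c" and f = "\<lambda>_. x"] by fastforce

lemma sref_eq: "sref C j x = x - (\<lambda>i. x j * simple_root C j i)"
  by (auto simp: sref_def simple_root_def)

lemma weyl_sref: "w \<in> weyl C I \<Longrightarrow> w (sref C j x) = w x - (\<lambda>i. x j * w (simple_root C j) i)"
  by (simp only: sref_eq weyl_diff weyl_scale)

text \<open>Root-lattice vector with simple-root coordinates \<open>c\<close>, stored like every
  weight in fundamental-weight coordinates. Linear independence of the simple roots is a consequence
  of finiteness and appears as \<open>rt_eq_0\<close>.\<close>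

definition rt :: "('n::finite \<Rightarrow> 'n \<Rightarrow> int) \<Rightarrow> ('n \<Rightarrow> int) \<Rightarrow> 'n weight" where
  "rt C c = (\<lambda>i. \<Sum>j\<in>UNIV. c j * simple_root C j i)"

lemma weyl_rt: "w \<in> weyl C I \<Longrightarrow> w (rt C c) = (\<lambda>i. \<Sum>j\<in>UNIV. c j * w (simple_root C j) i)"
  unfolding rt_def by (rule weyl_lin)

lemma rt_add: "rt C (\<lambda>j. c j + d j) = rt C c + rt C d"
  by (auto simp: rt_def algebra_simps sum.distrib)

lemma rt_diff: "rt C (\<lambda>j. c j - d j) = rt C c - rt C d"
  by (auto simp: rt_def algebra_simps sum_subtractf)

lemma rt_minus: "rt C (\<lambda>j. - c j) = - rt C c"
  by (auto simp: rt_def sum_negf)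

lemma rt_scale: "rt C (\<lambda>j. n * c j) = (\<lambda>i. n * rt C c i)"
  by (auto simp: rt_def sum_distrib_left mult.assoc)

lemma rt_single: "rt C (\<lambda>j. if j = k then n else 0) = (\<lambda>i. n * simple_root C k i)"
  by (simp add: rt_def if_distrib[of "\<lambda>x. x * _"] cong: if_cong)

lemma sref_rt:
  "sref C k (rt C c) = rt C (\<lambda>j. c j - (if j = k then rt C c k else 0))"
  by (simp only: rt_diff rt_single sref_eq)

lemma even_double_sum:
  fixes t :: "'b \<Rightarrow> 'b \<Rightarrow> int"
  assumes "finite A" and sym: "\<And>x y. t x y = t y x" and diag: "\<And>x. 2 * L dvd t x x"
    and off: "\<And>x y. L dvd t x y"
  shows "2 * L dvd (\<Sum>x\<in>A. \<Sum>y\<in>A. t x y)"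
  using assms(1)
proof (induction A rule: finite_induct)
  case empty
  then show ?case by simp
next
  case (insert a A)
  have "(\<Sum>x\<in>insert a A. \<Sum>y\<in>insert a A. t x y)
      = t a a + 2 * (\<Sum>y\<in>A. t a y) + (\<Sum>x\<in>A. \<Sum>y\<in>A. t x y)"
  proof -
    have "(\<Sum>x\<in>A. t x a) = (\<Sum>y\<in>A. t a y)" by (intro sum.cong refl sym)
    then show ?thesis using insert.hyps by (simp add: sum.distrib)
  qed
  moreover have "2 * L dvd 2 * (\<Sum>y\<in>A. t a y)"
    by (intro mult_dvd_mono dvd_refl dvd_sum off)
  ultimately show ?case
    using insert.IH diag by (auto intro!: dvd_add)
qed

section \<open>The finite Weyl group as a group of bijections\<close>

locale fin_cartan =
  fixes C :: "'n::finite \<Rightarrow> 'n \<Rightarrow> int"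
  assumes cartan: "gen_cartan C"
    and finite_W: "finite (weyl C UNIV)"
begin

abbreviation W :: "'n set \<Rightarrow> 'n weyl_elt set" where "W \<equiv> weyl C"
abbreviation s :: "'n \<Rightarrow> 'n weyl_elt" where "s \<equiv> sref C"
abbreviation root :: "'n \<Rightarrow> 'n weight" where "root \<equiv> simple_root C"
abbreviation wd :: "'n list \<Rightarrow> 'n weyl_elt" where "wd \<equiv> word_elt C"
abbreviation len :: "'n weyl_elt \<Rightarrow> nat" where "len \<equiv> wlen C"

lemma C_diag: "C i i = 2" and C_neg: "i \<noteq> j \<Longrightarrow> C i j \<le> 0" and C_zero: "C i j = 0 \<longleftrightarrow> C j i = 0"
  using cartan by (auto simp: gen_cartan_def)

lemma W_sub: "w \<in> W I \<Longrightarrow> w \<in> W UNIV"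
  using weyl_mono[of I UNIV C] by auto

lemma finite_W_sub: "finite (W I)"
  using finite_W weyl_mono[of I UNIV C] finite_subset by auto

lemma s_invol [simp]: "s i (s i x) = x"
  by (auto simp: sref_def C_diag)

lemma s_comp_s [simp]: "s i \<circ> s i = id"
  by (rule ext) simp

lemma s_comp_s2 [simp]: "w \<circ> s i \<circ> s i = w"
  by (rule ext) simp

lemma s_comp_s3 [simp]: "s i \<circ> (s i \<circ> w) = w"
  by (rule ext) simp

lemma root_self: "root i i = 2"
  by (simp add: simple_root_def C_diag)

lemma root_nz: "root i \<noteq> 0"
  using root_self[of i] by (metis zero_fun_apply zero_neq_numeral)

lemma s_root [simp]: "s i (root i) = - root i"
  by (auto simp: sref_def simple_root_def C_diag)

lemma wd_rev_apply: "wd (rev is) (wd is x) = x" "wd is (wd (rev is) x) = x"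
  by (induction "is" arbitrary: x) simp_all

lemma wd_rev: "wd (rev is) \<circ> wd is = id" "wd is \<circ> wd (rev is) = id"
  by (rule ext, simp add: wd_rev_apply)+

lemma W_bij: "w \<in> W I \<Longrightarrow> bij w"
  unfolding weyl_iff_word using wd_rev o_bij by metis

lemma W_inv: "w \<in> W I \<Longrightarrow> inv w \<in> W I"
proof -
  assume "w \<in> W I"
  then obtain a where a: "set a \<subseteq> I" "w = wd a" by (auto simp: weyl_iff_word)
  have "inv w = wd (rev a)"
    using wd_rev[of a] a by (metis inv_unique_comp)
  with a show ?thesis unfolding weyl_iff_word by (intro exI[of _ "rev a"]) simp
qed

lemma inv_wd: "inv (wd a) = wd (rev a)"
  by (metis wd_rev inv_unique_comp)

lemma W_inv_apply [simp]: "w \<in> W I \<Longrightarrow> inv w (w x) = x" "w \<in> W I \<Longrightarrow> w (inv w x) = x"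
  using W_bij by (auto simp: bij_is_inj bij_is_surj surj_f_inv_f)

lemma W_inv_comp: "w \<in> W I \<Longrightarrow> inv w \<circ> w = id" "w \<in> W I \<Longrightarrow> w \<circ> inv w = id"
  by (rule ext, simp)+

lemma W_inv_inv: "w \<in> W I \<Longrightarrow> inv (inv w) = w"
  using W_bij inv_inv_eq by blast

lemma W_apply_eq_iff: "w \<in> W I \<Longrightarrow> w x = w y \<longleftrightarrow> x = y"
  using W_inv_apply by metis

lemma bij_betw_W_comp: "u \<in> W I \<Longrightarrow> bij_betw (\<lambda>w. w \<circ> u) (W I) (W I)"
  by (rule bij_betw_byWitness[of _ "\<lambda>w. w \<circ> inv u"])
     (auto simp: comp_assoc W_inv_comp intro: weyl_comp W_inv)

lemma W_comp_s: "w \<in> W I \<Longrightarrow> i \<in> I \<Longrightarrow> w \<circ> s i \<in> W I"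
  by (rule weyl_comp[OF _ sref_in_weyl])

lemma W_s_comp: "w \<in> W I \<Longrightarrow> i \<in> I \<Longrightarrow> s i \<circ> w \<in> W I"
  by (rule weyl_comp[OF sref_in_weyl])

section \<open>The invariant form and the signs of the roots\<close>

text \<open>The standard form summed over the group: reindexing the sum gives invariance, and the
  absence of a division keeps the values integral. The identity already contributes a sum of
  squares, so the form is positive definite on the whole weight lattice.\<close>

definition bil :: "'n weight \<Rightarrow> 'n weight \<Rightarrow> int" where
  "bil x y = (\<Sum>w\<in>W UNIV. \<Sum>i\<in>UNIV. w x i * w y i)"

definition q :: "'n \<Rightarrow> int" where "q i = bil (root i) (root i)"

lemma bil_sym: "bil x y = bil y x"
  by (simp add: bil_def mult.commute)

lemma bil_add: "bil x (y + z) = bil x y + bil x z" "bil (y + z) x = bil y x + bil z x"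
  by (simp_all add: bil_def weyl_add[of _ C UNIV] algebra_simps sum.distrib)

lemma bil_diff: "bil x (y - z) = bil x y - bil x z" "bil (y - z) x = bil y x - bil z x"
  by (simp_all add: bil_def weyl_diff[of _ C UNIV] algebra_simps sum_subtractf)

lemma bil_minus: "bil x (- y) = - bil x y" "bil (- y) x = - bil y x"
  by (simp_all add: bil_def weyl_minus[of _ C UNIV] sum_negf)

lemma bil_zero [simp]: "bil x 0 = 0" "bil 0 x = 0"
  by (simp_all add: bil_def weyl_zero[of _ C UNIV])

lemma bil_scale: "bil x (\<lambda>i. c * y i) = c * bil x y"
  by (simp add: bil_def weyl_scale[of _ C UNIV] sum_distrib_left mult.left_commute)

lemma bil_scale2: "bil (\<lambda>i. c * y i) x = c * bil y x"
  using bil_scale[of x c y] by (simp only: bil_sym[of _ x])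

lemma bil_sum: "bil x (\<lambda>i. \<Sum>j\<in>A. c j * f j i) = (\<Sum>j\<in>A. c j * bil x (f j))"
proof -
  have "bil x (\<lambda>i. \<Sum>j\<in>A. c j * f j i) = (\<Sum>w\<in>W UNIV. \<Sum>i\<in>UNIV. \<Sum>j\<in>A. c j * (w x i * w (f j) i))"
    by (simp add: bil_def weyl_lin[of _ C UNIV] sum_distrib_left mult.left_commute)
  also have "\<dots> = (\<Sum>w\<in>W UNIV. \<Sum>j\<in>A. \<Sum>i\<in>UNIV. c j * (w x i * w (f j) i))"
    by (intro sum.cong refl sum.swap)
  also have "\<dots> = (\<Sum>j\<in>A. \<Sum>w\<in>W UNIV. \<Sum>i\<in>UNIV. c j * (w x i * w (f j) i))"
    by (rule sum.swap)
  finally show ?thesis by (simp add: bil_def sum_distrib_left)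
qed

lemma bil_inv: "u \<in> W I \<Longrightarrow> bil (u x) (u y) = bil x y"
  unfolding bil_def
  using sum.reindex_bij_betw[OF bij_betw_W_comp[OF W_sub], of u I "\<lambda>w. \<Sum>i\<in>UNIV. w x i * w y i"]
  by simp

lemma bil_pos: "x \<noteq> 0 \<Longrightarrow> bil x x > 0"
proof -
  assume "x \<noteq> 0"
  then obtain i where "x i \<noteq> 0" by (auto simp: fun_eq_iff)
  then have "0 < (\<Sum>i\<in>UNIV. x i * x i)"
    by (intro sum_pos2[of _ i]) (auto simp: zero_less_mult_iff linorder_neq_iff)
  then show ?thesis unfolding bil_def
    using weyl_id[of C UNIV] finite_W
    by (intro sum_pos2[of _ id]) (auto intro: sum_nonneg)
qed

lemma q_pos: "q i > 0"
  by (simp add: q_def bil_pos root_nz)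

text \<open>Invariance under \<open>s j\<close>, which negates \<open>root j\<close>, identifies the
  pairing with \<open>root j\<close> as half of \<open>x j * q j\<close>. Applied to two simple
  roots this shows that the norms \<open>q i\<close> symmetrize the Cartan matrix.\<close>

lemma bil_root: "2 * bil x (root j) = x j * q j"
proof -
  have "bil x (root j) = bil (s j x) (- root j)"
    using bil_inv[of "s j" UNIV x "root j"] sref_in_weyl[of j UNIV C] by simp
  also have "\<dots> = - bil x (root j) + x j * q j"
    by (simp add: sref_eq bil_minus bil_diff bil_scale2 q_def)
  finally show ?thesis by simp
qed

lemma bil_rt: "2 * bil x (rt C c) = (\<Sum>j\<in>UNIV. c j * x j * q j)"
  by (simp add: rt_def bil_sum sum_distrib_left bil_root[symmetric] mult.assoc mult.left_commute)

lemma C_sym: "C i j * q i = C j i * q j"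
  using bil_root[of "root j" i] bil_root[of "root i" j] bil_sym[of "root i" "root j"]
  by (simp add: simple_root_def)

text \<open>The quotients of \<open>c j * q j\<close> by \<open>q k\<close> are the coordinates of
  the coroot of \<open>wd is (root k)\<close> in the simple coroots, so the divisibility says that
  coroots are integral. A reflection at \<open>i\<close> alters only the coordinate at
  \<open>i\<close>; hence outside \<open>I\<close> the coordinates are still those of
  \<open>root k\<close>.\<close>

lemma root_coeffs0:
  assumes "set is \<subseteq> I"
  shows "\<exists>c. wd is (root k) = rt C c \<and> (\<forall>j. q k dvd c j * q j) \<and>
             (\<forall>j. j \<notin> I \<longrightarrow> c j = (if j = k then 1 else 0))"
  using assms
proof (induction "is")
  case Nil
  show ?case
    by (rule exI[of _ "\<lambda>j. if j = k then 1 else 0"]) (auto simp: rt_single)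
next
  case (Cons i "is")
  then obtain c where c: "wd is (root k) = rt C c" "\<And>j. q k dvd c j * q j"
    "\<And>j. j \<notin> I \<Longrightarrow> c j = (if j = k then 1 else 0)" by auto
  have "rt C c i * q i = (\<Sum>j\<in>UNIV. c j * q j * C j i)"
    by (simp add: rt_def simple_root_def sum_distrib_right mult.assoc C_sym mult.commute[of "q _"])
  then have "q k dvd rt C c i * q i"
    using c(2) by (auto intro!: dvd_sum)
  then show ?case using c Cons.prems
    by (intro exI[of _ "\<lambda>j. c j - (if j = i then rt C c i else 0)"])
       (auto simp: sref_rt left_diff_distrib)
qed

text \<open>Twice the norm is a symmetric double sum whose diagonal terms carry an additional factor
  2, because the diagonal Cartan entries are 2. Halving therefore preserves divisibility by
  \<open>L\<close>.\<close>

lemma norm_dvd: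
  assumes "\<And>j. L dvd c j * q j"
  shows "L dvd bil (rt C c) (rt C c)"
proof -
  let ?t = "\<lambda>j l. c j * q j * (c l * C j l)"
  have "2 * bil (rt C c) (rt C c) = (\<Sum>j\<in>UNIV. \<Sum>l\<in>UNIV. ?t j l)"
    by (subst bil_rt) (simp add: rt_def simple_root_def sum_distrib_left sum_distrib_right ac_simps)
  moreover have "2 * L dvd (\<Sum>j\<in>UNIV. \<Sum>l\<in>UNIV. ?t j l)"
  proof (rule even_double_sum)
    show "?t x y = ?t y x" for x y
      using C_sym[of x y] by (simp add: mult.commute mult.left_commute)
    show "2 * L dvd ?t x x" for x
    proof -
      have "?t x x = 2 * (c x * q x) * c x" by (simp add: C_diag)
      then show ?thesis using mult_dvd_mono[OF dvd_refl[of 2] assms[of x]] by (metis dvd_mult2)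
    qed
    show "L dvd ?t x y" for x y using assms[of x] by auto
  qed simp
  ultimately show ?thesis by (metis dvd_times_left_cancel_iff zero_neq_numeral)
qed

text \<open>Pairing with the sum of the fundamental weights. The factor 2 cancels the one half in
  the pairing with a simple root, so \<open>root j\<close> gets the positive height
  \<open>q j\<close>.\<close>

definition ht :: "'n weight \<Rightarrow> int" where
  "ht x = 2 * bil (\<lambda>_. 1) x"

lemma ht_rt: "ht (rt C c) = (\<Sum>j\<in>UNIV. c j * q j)"
  by (simp add: ht_def bil_rt)

lemma ht_root: "ht (root j) = q j"
  by (simp add: ht_def bil_root)

lemma ht_add: "ht (x + y) = ht x + ht y"
  and ht_diff: "ht (x - y) = ht x - ht y"
  and ht_minus [simp]: "ht (- x) = - ht x"
  and ht_zero [simp]: "ht 0 = 0"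
  by (simp_all add: ht_def bil_add bil_diff bil_minus)

lemma ht_scale: "ht (\<lambda>i. c * x i) = c * ht x"
  by (simp add: ht_def bil_scale)

lemma rt_nonneg_nz:
  assumes "\<And>j. 0 \<le> c j" "c k \<noteq> 0"
  shows "0 < ht (rt C c)"
  unfolding ht_rt using assms q_pos
  by (intro sum_pos2[of _ k]) (auto simp: zero_less_mult_iff less_le intro: mult_nonneg_nonneg)

lemma ht_rt_nonneg: "(\<And>j. 0 \<le> c j) \<Longrightarrow> 0 \<le> ht (rt C c)"
  unfolding ht_rt using q_pos by (intro sum_nonneg mult_nonneg_nonneg) (auto intro: less_imp_le)

text \<open>Disjoint supports leave only off-diagonal Cartan entries, which are nonpositive.\<close>

lemma bil_pos_neg_parts:
  assumes "\<And>j. 0 \<le> p j" "\<And>j. 0 \<le> n j" "\<And>j. n j = 0 \<or> p j = 0"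
  shows "bil (rt C p) (rt C n) \<le> 0"
proof -
  have "n j * rt C p j * q j \<le> 0" for j
  proof (cases "n j = 0")
    case False
    then have "p j = 0" using assms(3) by auto
    then have "rt C p j \<le> 0" unfolding rt_def simple_root_def
      using assms(1) C_neg by (intro sum_nonpos) (metis C_diag mult_eq_0_iff mult_nonneg_nonpos order_refl)
    then show ?thesis using assms(2)[of j] q_pos[of j]
      by (intro mult_nonpos_nonneg mult_nonneg_nonpos) auto
  qed simp
  then have "2 * bil (rt C p) (rt C n) \<le> 0"
    by (subst bil_rt) (rule sum_nonpos)
  then show ?thesis by simp
qed

text \<open>A linear relation makes the vectors of the positive part \<open>p\<close> and the
  negative part \<open>n\<close> equal, so the norm of this vector is a pairing of vectors with
  disjoint supports, hence at most 0. The vector vanishes, and a nonzero coefficient would give it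
  positive height.\<close>

lemma rt_eq_0: assumes "rt C c = 0" shows "c = 0"
proof -
  define p where "p j = max (c j) 0" for j
  define n where "n j = max (- c j) 0" for j
  have c: "c = (\<lambda>j. p j - n j)" by (auto simp: p_def n_def)
  then have eq: "rt C p = rt C n" using assms rt_diff[of C p n] by simp
  then have "bil (rt C p) (rt C p) \<le> 0"
    using bil_pos_neg_parts[of p n] by (simp add: p_def n_def max_def)
  then have "rt C p = 0" using bil_pos[of "rt C p"] by fastforce
  then have "p j = 0" "n j = 0" for j
    using eq rt_nonneg_nz[of p j] rt_nonneg_nz[of n j] by (force simp: p_def n_def)+
  then show ?thesis using c by auto
qed

lemma rt_inj: "rt C c = rt C d \<Longrightarrow> c = d"
  using rt_eq_0[of "\<lambda>j. c j - d j"] by (simp add: rt_diff fun_eq_iff)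

text \<open>A root with coefficients of both signs would have norm at least twice its own, since
  the positive and the negative part each have a norm divisible by that of the root.\<close>

lemma root_coeffs:
  assumes "w \<in> W I"
  obtains c where "w (root k) = rt C c" "\<And>j. q k dvd c j * q j"
    "\<And>j. j \<notin> I \<Longrightarrow> c j = (if j = k then 1 else 0)"
    "(\<forall>j. 0 \<le> c j) \<or> (\<forall>j. c j \<le> 0)"
proof -
  obtain "is" where "set is \<subseteq> I" "w = wd is" using assms by (auto simp: weyl_iff_word)
  then obtain c where c: "w (root k) = rt C c" "\<And>j. q k dvd c j * q j"
    "\<And>j. j \<notin> I \<Longrightarrow> c j = (if j = k then 1 else 0)" using root_coeffs0[of "is" I k] by auto
  define p where "p j = max (c j) 0" for j
  define n where "n j = max (- c j) 0" for j
  have cpn: "c = (\<lambda>j. p j - n j)" by (auto simp: p_def n_def)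
  have nn: "0 \<le> p j" "0 \<le> n j" for j by (auto simp: p_def n_def)
  have d: "q k dvd p j * q j" "q k dvd n j * q j" for j
    using c(2)[of j] by (auto simp: p_def n_def max_def)
  have "bil (rt C c) (rt C c) = q k"
    using c(1) bil_inv[OF assms, of "root k" "root k"] by (simp add: q_def)
  moreover have "bil (rt C c) (rt C c)
      = bil (rt C p) (rt C p) + bil (rt C n) (rt C n) - 2 * bil (rt C p) (rt C n)"
    by (subst (1 2) cpn) (simp add: rt_diff bil_diff bil_sym[of "rt C n" "rt C p"])
  moreover have "bil (rt C p) (rt C n) \<le> 0"
    by (rule bil_pos_neg_parts) (auto simp: p_def n_def max_def)
  ultimately have le: "bil (rt C p) (rt C p) + bil (rt C n) (rt C n) \<le> q k"
    by linarith
  have big: "q k \<le> bil (rt C a) (rt C a)" if "\<And>j. 0 \<le> a j" "\<And>j. q k dvd a j * q j" "a i \<noteq> 0" for a i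
  proof -
    have "rt C a \<noteq> 0" using rt_nonneg_nz[of a i] that by auto
    then show ?thesis using norm_dvd[of "q k" a] that bil_pos by (intro zdvd_imp_le) auto
  qed
  have "(\<forall>j. p j = 0) \<or> (\<forall>j. n j = 0)"
  proof (rule ccontr)
    assume "\<not> ?thesis"
    then obtain i j where "p i \<noteq> 0" "n j \<noteq> 0" by auto
    then have "q k \<le> bil (rt C p) (rt C p)" "q k \<le> bil (rt C n) (rt C n)"
      using big[OF nn(1) d(1)] big[OF nn(2) d(2)] by blast+
    then show False using le q_pos[of k] by linarith
  qed
  then have "(\<forall>j. 0 \<le> c j) \<or> (\<forall>j. c j \<le> 0)"
    by (auto simp: p_def n_def max_def split: if_splits)
  with c that show ?thesis by blast
qed

lemma ht_root_nz: assumes "w \<in> W I" shows "ht (w (root k)) \<noteq> 0"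
proof -
  obtain c where c: "w (root k) = rt C c" "(\<forall>j. 0 \<le> c j) \<or> (\<forall>j. c j \<le> 0)"
    using root_coeffs[OF assms] by metis
  have "c \<noteq> 0"
    using c W_apply_eq_iff[OF assms, of "root k" 0] weyl_zero[OF assms] root_nz[of k]
    by (auto simp: rt_def)
  then obtain j where "c j \<noteq> 0" by (auto simp: fun_eq_iff)
  then show ?thesis
    using c rt_nonneg_nz[of c j] rt_nonneg_nz[of "\<lambda>j. - c j" j] by (auto simp: rt_minus)
qed

lemma pos_root_coeffs:
  assumes "w \<in> W I" "0 < ht (w (root k))"
  obtains c where "w (root k) = rt C c" "\<And>j. q k dvd c j * q j" "\<And>j. 0 \<le> c j"
    "\<And>j. j \<notin> I \<Longrightarrow> c j = (if j = k then 1 else 0)"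
proof -
  obtain c where c: "w (root k) = rt C c" "\<And>j. q k dvd c j * q j"
    "\<And>j. j \<notin> I \<Longrightarrow> c j = (if j = k then 1 else 0)"
    "(\<forall>j. 0 \<le> c j) \<or> (\<forall>j. c j \<le> 0)" using root_coeffs[OF assms(1)] by metis
  have "\<not> (\<forall>j. c j \<le> 0)"
    using assms(2) c(1) ht_rt_nonneg[of "\<lambda>j. - c j"] by (auto simp: rt_minus)
  then show ?thesis using that c by blast
qed

text \<open>Reflections at indices in \<open>I\<close> leave the coordinate at \<open>k\<close>
  equal to 1, and this one coordinate decides the sign of the root.\<close>

lemma ht_root_outside: "w \<in> W I \<Longrightarrow> k \<notin> I \<Longrightarrow> 0 < ht (w (root k))"
proof -
  assume w: "w \<in> W I" and k: "k \<notin> I"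
  obtain c where c: "w (root k) = rt C c"
    "\<And>j. j \<notin> I \<Longrightarrow> c j = (if j = k then 1 else 0)"
    "(\<forall>j. 0 \<le> c j) \<or> (\<forall>j. c j \<le> 0)" using root_coeffs[OF w] by metis
  then have "c k = 1" using k by auto
  then have "\<And>j. 0 \<le> c j" using c(3) by (metis zero_le_one not_one_le_zero)
  then show ?thesis using rt_nonneg_nz[of c k] \<open>c k = 1\<close> c(1) by auto
qed

text \<open>Comparing norms gives \<open>q k = m * (m * q j)\<close>, and integrality of the coroot
  gives \<open>q k dvd m * q j\<close>. Hence \<open>m\<close> divides 1: the root system is
  reduced.\<close>

lemma root_multiple:
  assumes "w \<in> W I" "w (root k) = (\<lambda>i. m * root j i)"
  shows "m = 1 \<or> m = -1"
proof -
  have eq: "w (root k) = rt C (\<lambda>i. if i = j then m else 0)" using assms by (simp add: rt_single)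
  obtain c where c: "w (root k) = rt C c" "\<And>j. q k dvd c j * q j" using root_coeffs[OF assms(1)] by metis
  then have "c = (\<lambda>i. if i = j then m else 0)" using eq rt_inj by metis
  then have "q k dvd m * q j" using c(2)[of j] by simp
  moreover have "q k = m * (m * q j)"
    using bil_inv[OF assms(1), of "root k" "root k"] unfolding assms(2)
    by (simp add: q_def bil_scale bil_sym[of "\<lambda>i. m * root j i"])
  moreover have "m \<noteq> 0" using calculation q_pos[of k] by auto
  ultimately have "m dvd 1" using q_pos[of j]
    by (metis dvd_times_left_cancel_iff mult.commute mult.right_neutral mult_cancel_left1 mult_eq_0_iff
        dvd_mult_cancel_left less_irrefl mult.left_commute)
  then show ?thesis by auto
qed

text \<open>The reflection changes only the coordinate at \<open>i\<close>. Every other coordinate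
  is nonnegative before and nonpositive after, so it is 0, and the root is a positive multiple of
  \<open>root i\<close>, hence equal to it.\<close>

lemma simple_of_sign_change:
  assumes w: "w \<in> W UNIV" and pos: "0 < ht (w (root k))" and neg: "ht (s i (w (root k))) < 0"
  shows "w (root k) = root i"
proof -
  obtain c where c: "w (root k) = rt C c" "\<And>j. 0 \<le> c j"
    using pos_root_coeffs[OF w pos] by metis
  have "s i \<circ> w \<in> W UNIV" by (simp add: W_s_comp w)
  then obtain d where d: "s i (w (root k)) = rt C d" "(\<forall>j. 0 \<le> d j) \<or> (\<forall>j. d j \<le> 0)"
    using root_coeffs by (metis comp_apply)
  have "\<forall>j. d j \<le> 0" using d neg ht_rt_nonneg[of d] by auto
  moreover have "d = (\<lambda>j. c j - (if j = i then rt C c i else 0))"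
    using d(1) c(1) sref_rt[of C i c] rt_inj by metis
  ultimately have "c j = 0" if "j \<noteq> i" for j
    using c(2)[of j] that by (auto simp: fun_eq_iff) (metis diff_zero nle_le)
  then have "c = (\<lambda>j. if j = i then c i else 0)" by auto
  then have "w (root k) = (\<lambda>l. c i * root i l)" using c(1) rt_single by metis
  moreover from this have "c i = 1" using root_multiple[OF w, of k "c i" i] c(2)[of i] by auto
  ultimately show ?thesis by simp
qed

text \<open>By \<open>bil_root\<close> the coordinate at a simple root is read off from the form.
  Since \<open>u\<close> preserves the form and matches the two roots, \<open>u x i = x j\<close>,
  and both sides subtract the same multiple of \<open>root i\<close>.\<close>

lemma refl_conj:
  assumes "u \<in> W I" "u (root j) = root i"
  shows "u \<circ> s j = s i \<circ> u"
proof
  fix x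
  have "q i = q j" using bil_inv[OF assms(1), of "root j" "root j"] assms(2) by (simp add: q_def)
  moreover have "u x i * q i = x j * q j"
    using bil_root[of "u x" i] bil_root[of x j] bil_inv[OF assms(1), of x "root j"] assms(2) by simp
  ultimately have "u x i = x j" using q_pos[of j] by auto
  moreover have "(u \<circ> s j) x = u x - (\<lambda>l. x j * root i l)"
    by (simp only: comp_apply weyl_sref[OF assms(1)] assms(2))
  moreover have "(s i \<circ> u) x = u x - (\<lambda>l. u x i * root i l)"
    by (simp only: comp_apply sref_eq)
  ultimately show "(u \<circ> s j) x = (s i \<circ> u) x"
    by simp
qed

section \<open>Length, exchange and descents\<close>

text \<open>Reading the word from the right, \<open>root j\<close> starts positive and ends
  negative. At a letter \<open>i\<close> where the sign turns negative, the part of the word to its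
  right sends \<open>root j\<close> to \<open>root i\<close>, so by \<open>refl_conj\<close> the
  appended \<open>s j\<close> moves across that part and cancels \<open>i\<close>.\<close>

lemma exchange:
  assumes "ht (wd is (root j)) < 0"
  shows "\<exists>xs i ys. is = xs @ i # ys \<and> wd is \<circ> s j = wd (xs @ ys)"
  using assms
proof (induction "is")
  case Nil
  then show ?case using q_pos[of j] by (simp add: ht_root)
next
  case (Cons i "is")
  have W: "wd is \<in> W UNIV" by (auto simp: weyl_iff_word)
  show ?case
  proof (cases "ht (wd is (root j)) < 0")
    case True
    then obtain xs k ys where x: "is = xs @ k # ys" "wd is \<circ> s j = wd (xs @ ys)" using Cons.IH by blast
    have "wd (i # is) \<circ> s j = s i \<circ> wd (xs @ ys)"
      unfolding x(2)[symmetric] by (simp add: comp_assoc)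
    then have "wd (i # is) \<circ> s j = wd ((i # xs) @ ys)" by simp
    with x(1) show ?thesis by (metis append_Cons)
  next
    case False
    then have "0 < ht (wd is (root j))" using ht_root_nz[OF W, of j] by auto
    then have "wd is (root j) = root i"
      using Cons.prems by (intro simple_of_sign_change[OF W]) (simp_all only: word_elt_Cons comp_apply)
    then have "wd is \<circ> s j = s i \<circ> wd is" by (rule refl_conj[OF W])
    then have "wd (i # is) \<circ> s j = wd ([] @ is)"
      by (metis append_Nil comp_assoc s_comp_s3 word_elt_Cons)
    then show ?thesis by (metis append_Nil)
  qed
qed

lemma len_le: "len (wd is) \<le> length is"
  unfolding wlen_def by (rule Least_le) auto

lemma red_exists: "w \<in> W UNIV \<Longrightarrow> \<exists>is. wd is = w \<and> length is = len w"
proof -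
  assume "w \<in> W UNIV"
  then obtain a where "w = wd a" by (auto simp: weyl_iff_word)
  then have "\<exists>k is. length is = k \<and> wd is = w" by blast
  from LeastI_ex[OF this] show ?thesis unfolding wlen_def by blast
qed

lemma red_word: "w \<in> W UNIV \<Longrightarrow> wd (reduced_word_of C w) = w"
  "w \<in> W UNIV \<Longrightarrow> length (reduced_word_of C w) = len w"
  using someI_ex[OF red_exists] unfolding reduced_word_of_def by auto

lemma len_id [simp]: "len id = 0"
  using len_le[of "[]"] by simp

lemma len_0: "w \<in> W UNIV \<Longrightarrow> len w = 0 \<longleftrightarrow> w = id"
  using red_exists[of w] len_id by fastforce

lemma len_comp_s_le: "w \<in> W UNIV \<Longrightarrow> len (w \<circ> s i) \<le> Suc (len w)"
  using red_exists[of w] len_le word_elt_append[of C _ "[i]"]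
  by (metis comp_id length_append_singleton word_elt_Cons word_elt_Nil)

lemma len_comp_le: "v \<in> W UNIV \<Longrightarrow> w \<in> W UNIV \<Longrightarrow> len (v \<circ> w) \<le> len v + len w"
proof -
  assume "v \<in> W UNIV" "w \<in> W UNIV"
  then obtain a b where "wd a = v" "length a = len v" "wd b = w" "length b = len w"
    using red_exists by meson
  then show ?thesis using len_le[of "a @ b"] by simp
qed

lemma len_inv: "w \<in> W I \<Longrightarrow> len (inv w) = len w"
proof -
  have "len (inv v) \<le> len v" if "v \<in> W UNIV" for v
    using red_exists[OF that] len_le inv_wd by (metis length_rev)
  then show "w \<in> W I \<Longrightarrow> len (inv w) = len w"
    using W_sub W_inv W_inv_inv by (metis le_antisym)
qed

lemma len_neg: "w \<in> W UNIV \<Longrightarrow> ht (w (root i)) < 0 \<Longrightarrow> Suc (len (w \<circ> s i)) = len w"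
proof -
  assume w: "w \<in> W UNIV" and n: "ht (w (root i)) < 0"
  obtain a where a: "wd a = w" "length a = len w" using red_exists[OF w] by auto
  then obtain xs j ys where x: "a = xs @ j # ys" "w \<circ> s i = wd (xs @ ys)"
    using exchange[of a i] n by metis
  have "len (w \<circ> s i) \<le> length (xs @ ys)" unfolding x(2) by (rule len_le)
  then have "Suc (len (w \<circ> s i)) \<le> len w" using a x(1) by simp
  moreover have "len w \<le> Suc (len (w \<circ> s i))"
    using len_comp_s_le[of "w \<circ> s i" i] w by (simp add: W_comp_s)
  ultimately show ?thesis by simp
qed

lemma len_pos: "w \<in> W UNIV \<Longrightarrow> ht (w (root i)) > 0 \<Longrightarrow> len (w \<circ> s i) = Suc (len w)"
  using len_neg[of "w \<circ> s i" i] weyl_minus[of w C UNIV "root i"] by (simp add: W_comp_s)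

lemma descent_iff: "w \<in> W I \<Longrightarrow> i \<in> descent C w \<longleftrightarrow> ht (w (root i)) < 0"
  using len_neg[OF W_sub, of w I i] len_pos[OF W_sub, of w I i] ht_root_nz[of w I i]
  by (cases "ht (w (root i)) < 0") (auto simp: descent_def)

lemma not_descent_iff: "w \<in> W I \<Longrightarrow> i \<notin> descent C w \<longleftrightarrow> ht (w (root i)) > 0"
  using descent_iff[of w I i] ht_root_nz[of w I i] by auto

lemma descent_sub: "w \<in> W I \<Longrightarrow> descent C w \<subseteq> I"
  using ht_root_outside descent_iff by fastforce

lemma s_comp_inv: "w \<in> W I \<Longrightarrow> inv (s i \<circ> w) = inv w \<circ> s i"
proof -
  assume "w \<in> W I"
  then show ?thesis
    by (intro inv_unique_comp) (rule ext, simp)+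
qed

lemma len_s_comp:
  assumes "w \<in> W UNIV"
  shows "ht (inv w (root i)) > 0 \<Longrightarrow> len (s i \<circ> w) = Suc (len w)"
    "ht (inv w (root i)) < 0 \<Longrightarrow> Suc (len (s i \<circ> w)) = len w"
  using len_pos[OF W_inv[OF assms], of i] len_neg[OF W_inv[OF assms], of i]
    len_inv[OF W_s_comp[OF assms], of i] len_inv[OF assms] by (auto simp: s_comp_inv[OF assms])

lemma len_s_comp_cases:
  assumes "w \<in> W UNIV"
  obtains "len w < len (s i \<circ> w)" "len (s i \<circ> w) = Suc (len w)" "ht (inv w (root i)) > 0"
    | "len (s i \<circ> w) < len w" "len w = Suc (len (s i \<circ> w))" "ht (inv w (root i)) < 0"
  using len_s_comp[OF assms, of i] ht_root_nz[OF W_inv[OF assms], of i]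
  by (metis lessI linorder_neqE)

text \<open>Strong induction on the word length: when the last letter does not lengthen,
  \<open>exchange\<close> replaces the word by a shorter subword whose letters still lie in
  \<open>I\<close>. So every element of \<open>W I\<close> is built inside \<open>I\<close> by steps
  that each raise the length measured in the full group.\<close>

lemma weyl_induct [consumes 1, case_names id step]:
  assumes "w \<in> W I" and "P id"
    and step: "\<And>w i. w \<in> W I \<Longrightarrow> i \<in> I \<Longrightarrow> 0 < ht (w (root i)) \<Longrightarrow>
      len (w \<circ> s i) = Suc (len w) \<Longrightarrow> P w \<Longrightarrow> P (w \<circ> s i)"
  shows "P w"
proof -
  have "set a \<subseteq> I \<Longrightarrow> P (wd a)" for a
  proof (induction "length a" arbitrary: a rule: less_induct)
    case less
    show ?case
    proof (cases a rule: rev_cases)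
      case Nil
      then show ?thesis using assms(2) by (simp add: id_def)
    next
      case (snoc b i)
      have b: "wd b \<in> W I" using snoc less.prems by (auto simp: weyl_iff_word)
      show ?thesis
      proof (cases "ht (wd b (root i)) < 0")
        case True
        then obtain xs j ys where x: "b = xs @ j # ys" "wd b \<circ> s i = wd (xs @ ys)"
          using exchange by blast
        have "wd a = wd (xs @ ys)" using snoc x(2) by (metis comp_id word_elt_Cons word_elt_Nil word_elt_append)
        moreover have "P (wd (xs @ ys))"
          using snoc less.prems x(1) by (intro less.hyps) auto
        ultimately show ?thesis by metis
      next
        case False
        then have "0 < ht (wd b (root i))" using ht_root_nz[OF b, of i] by simp
        then show ?thesis
          using step[OF b, of i] len_pos[OF W_sub[OF b], of i] snoc less.prems less.hyps[of b] by simp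
      qed
    qed
  qed
  then show ?thesis using assms(1) by (auto simp: weyl_iff_word)
qed

section \<open>Parabolic subgroups\<close>

lemma id_in_W: "id \<in> W I"
  using weyl_id[of C I] by (simp add: id_def)

lemma ht_W_rt: "w \<in> W I \<Longrightarrow> ht (w (rt C c)) = (\<Sum>j\<in>UNIV. c j * ht (w (root j)))"
  unfolding weyl_rt by (simp add: ht_def bil_sum sum_distrib_left mult.left_commute)

text \<open>A positive root of the parabolic subgroup is a nonnegative combination of the simple
  roots in \<open>K\<close>, so a common sign of \<open>w\<close> on these propagates to it. The
  factor \<open>e\<close>, taken as 1 and as -1, lets the additive and the subtractive length
  formula share the argument.\<close>

lemma W_sign_comb:
  assumes w: "w \<in> W UNIV" "\<And>k. k \<in> K \<Longrightarrow> 0 < e * ht (w (root k))"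
    and x: "x \<in> W K" "k \<in> K" "0 < ht (x (root k))"
  shows "0 < e * ht (w (x (root k)))"
proof -
  obtain c where c: "x (root k) = rt C c" "\<And>j. 0 \<le> c j" "\<And>j. j \<notin> K \<Longrightarrow> c j = 0"
    using pos_root_coeffs[OF x(1,3)] x(2) by metis
  have "c \<noteq> 0" using x(3) c(1) by (auto simp: ht_rt)
  then obtain j where j: "c j \<noteq> 0" by (metis ext zero_fun_apply)
  then have "j \<in> K" using c(3) by blast
  have "0 \<le> c l * (e * ht (w (root l)))" for l
    using c(2)[of l] c(3)[of l] w(2)[of l] by (cases "l \<in> K") auto
  moreover have "0 < c j * (e * ht (w (root j)))"
    using j c(2)[of j] w(2)[OF \<open>j \<in> K\<close>] by (simp add: less_le zero_less_mult_iff)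
  ultimately have "0 < (\<Sum>l\<in>UNIV. c l * (e * ht (w (root l))))" by (intro sum_pos2[of _ j]) auto
  then show ?thesis
    unfolding c(1) ht_W_rt[OF w(1)] by (simp add: sum_distrib_left mult.left_commute)
qed

lemma len_par_add:
  assumes w: "w \<in> W UNIV" "\<And>k. k \<in> K \<Longrightarrow> 0 < ht (w (root k))" and x: "x \<in> W K"
  shows "len (w \<circ> x) = len w + len x"
  using x
proof (induction rule: weyl_induct)
  case id
  show ?case by (simp only: comp_id len_id add_0_right)
next
  case (step x i)
  have ih: "len (w \<circ> x) = len w + len x" by (fact step(5))
  have "len (w \<circ> (x \<circ> s i)) = Suc (len (w \<circ> x))"
    using len_pos[OF weyl_comp[OF w(1) W_sub[OF step(1)]], of i] W_sign_comb[where e = 1, OF w(1) _ step(1,2,3)] w(2)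
    by (simp add: comp_assoc)
  then show "len (w \<circ> (x \<circ> s i)) = len w + len (x \<circ> s i)" using ih step(4) by presburger
qed

lemma len_par_sub:
  assumes w: "w \<in> W UNIV" "\<And>k. k \<in> K \<Longrightarrow> ht (w (root k)) < 0" and x: "x \<in> W K"
  shows "len (w \<circ> x) + len x = len w"
  using x
proof (induction rule: weyl_induct)
  case id
  show ?case by (simp only: comp_id len_id add_0_right)
next
  case (step x i)
  have ih: "len (w \<circ> x) + len x = len w" by (fact step(5))
  have "Suc (len (w \<circ> (x \<circ> s i))) = len (w \<circ> x)"
    using len_neg[OF weyl_comp[OF w(1) W_sub[OF step(1)]], of i] W_sign_comb[where e = "-1", OF w(1) _ step(1,2,3)] w(2)
    by (simp add: comp_assoc)
  then show "len (w \<circ> (x \<circ> s i)) + len (x \<circ> s i) = len w" using ih step(4) by presburger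
qed

text \<open>The definite description requires uniqueness. An element of maximal length makes every
  simple root in \<open>K\<close> negative, so by \<open>len_par_sub\<close> a second one differs
  from it by an element of length 0.\<close>

lemma longest_props: "longest C K \<in> W K" "k \<in> K \<Longrightarrow> ht (longest C K (root k)) < 0"
proof -
  let ?P = "\<lambda>w. w \<in> W K \<and> (\<forall>v \<in> W K. len v \<le> len w)"
  have neg: "ht (w (root k)) < 0" if "?P w" "k \<in> K" for w k
  proof (rule ccontr)
    assume "\<not> ?thesis"
    then have "0 < ht (w (root k))" using ht_root_nz[of w K k] that by auto
    then have "len (w \<circ> s k) = Suc (len w)" using len_pos W_sub that by blast
    then show False using that W_comp_s[of w K k] by fastforce
  qed
  have uniq: "v = w" if v: "?P v" and w: "?P w" for v w
  proof -
    let ?x = "inv w \<circ> v"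
    have x: "?x \<in> W K" using v w weyl_comp W_inv by blast
    have "w \<circ> ?x = v" using W_inv_comp(2) w by (metis comp_assoc id_comp)
    then have "len v + len ?x = len w" using len_par_sub[of w K ?x] w x neg[OF w] W_sub by auto
    moreover have "len w \<le> len v" using v w by blast
    ultimately have "len ?x = 0" by simp
    then have "?x = id" using len_0 W_sub x by blast
    then show ?thesis using \<open>w \<circ> ?x = v\<close> by simp
  qed
  have "finite (len ` W K)" "len ` W K \<noteq> {}" using finite_W_sub id_in_W by auto
  then have "Max (len ` W K) \<in> len ` W K" by (rule Max_in)
  then obtain w where "w \<in> W K" "len w = Max (len ` W K)" by auto
  then have "?P w" using finite_W_sub by auto
  then have "\<exists>!w. ?P w" using uniq by blast
  then have "?P (longest C K)" unfolding longest_def by (rule theI')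
  then show "longest C K \<in> W K" "k \<in> K \<Longrightarrow> ht (longest C K (root k)) < 0" using neg by blast+
qed

lemma descent_longest: "descent C (longest C K) = K"
  using longest_props descent_iff descent_sub by (metis subsetI subset_antisym)

section \<open>Dominant weights and their stabilizers\<close>

definition dominant :: "'n set \<Rightarrow> 'n weight \<Rightarrow> bool" where
  "dominant I x \<longleftrightarrow> (\<forall>i\<in>I. 0 \<le> x i)"

lemma s_fix: "x i = 0 \<Longrightarrow> s i x = x"
  by (simp add: sref_def)

lemma dominant_bil_nonneg:
  assumes "dominant I y" "w \<in> W I" "i \<in> I" "0 < ht (w (root i))"
  shows "0 \<le> bil y (w (root i))"
proof -
  obtain c where c: "w (root i) = rt C c" "\<And>j. 0 \<le> c j" "\<And>j. j \<notin> I \<Longrightarrow> c j = 0"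
    using pos_root_coeffs[OF assms(2,4)] assms(3) by metis
  have "0 \<le> c j * y j * q j" for j
    using c(2)[of j] c(3)[of j] assms(1) q_pos[of j]
    by (cases "j \<in> I") (auto simp: dominant_def)
  then have "0 \<le> 2 * bil y (w (root i))" unfolding c(1) bil_rt by (intro sum_nonneg) auto
  then show ?thesis by simp
qed

text \<open>Consider the last letter \<open>s i\<close> and the pairing of \<open>x\<close> with
  \<open>root i\<close>: dominance of \<open>x\<close> makes it nonnegative, dominance of the image
  makes it nonpositive. So the letter fixes \<open>x\<close>. The induction gives at once that
  dominant weights represent orbits uniquely and that stabilizers are generated by simple
  reflections.\<close>

lemma dominant_stab:
  assumes "w \<in> W I" "dominant I x" "dominant I (w x)"
  shows "w x = x \<and> w \<in> W {i \<in> I. x i = 0}"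
  using assms
proof (induction rule: weyl_induct)
  case id
  show "id x = x \<and> id \<in> W {i \<in> I. x i = 0}" by (intro conjI id_in_W) simp
next
  case (step w i)
  have "bil x (root i) = - bil ((w \<circ> s i) x) (w (root i))"
    using bil_inv[OF W_comp_s[OF step(1,2)], of x "root i"] weyl_minus[OF step(1)]
    by (simp add: bil_minus)
  moreover have "0 \<le> bil ((w \<circ> s i) x) (w (root i))"
    using dominant_bil_nonneg step by blast
  ultimately have "x i * q i \<le> 0" using bil_root[of x i] by simp
  then have "x i = 0" using step q_pos[of i] by (simp add: dominant_def mult_le_0_iff) (metis nle_le not_le)
  then have e: "(w \<circ> s i) x = w x" by (simp add: s_fix)
  then have "w x = x" "w \<in> W {i \<in> I. x i = 0}" using step by auto
  then show "(w \<circ> s i) x = x \<and> w \<circ> s i \<in> W {i \<in> I. x i = 0}"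
    using e step(2) \<open>x i = 0\<close> by (intro conjI W_comp_s) auto
qed

lemma dominant_diff:
  assumes "w \<in> W I" "dominant I x"
  shows "\<exists>c. (\<forall>j. 0 \<le> c j) \<and> (\<forall>j. j \<notin> I \<longrightarrow> c j = 0) \<and> x - w x = rt C c"
  using assms
proof (induction rule: weyl_induct)
  case id
  then show ?case by (intro exI[of _ "\<lambda>_. 0"]) (simp add: rt_def zero_fun_def)
next
  case (step w i)
  obtain c where c: "\<And>j. 0 \<le> c j" "\<And>j. j \<notin> I \<Longrightarrow> c j = 0" "x - w x = rt C c" using step by blast
  obtain d where d: "w (root i) = rt C d" "\<And>j. 0 \<le> d j" "\<And>j. j \<notin> I \<Longrightarrow> d j = 0"
    using pos_root_coeffs[OF step(1,3)] step(2) by metis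
  have "x - (w \<circ> s i) x = rt C c + (\<lambda>l. x i * rt C d l)"
    unfolding c(3)[symmetric] d(1)[symmetric] comp_apply weyl_sref[OF step(1)] by (simp add: algebra_simps)
  also have "\<dots> = rt C (\<lambda>j. c j + x i * d j)" by (simp only: rt_add rt_scale)
  finally show ?case using c d step by (intro exI[of _ "\<lambda>j. c j + x i * d j"]) (simp add: dominant_def)
qed

section \<open>Words: Matsumoto's theorem\<close>

text \<open>Alternating words are built from the right, so that the first argument is the last letter.\<close>

fun altr :: "'n \<Rightarrow> 'n \<Rightarrow> nat \<Rightarrow> 'n list" where
  "altr i j 0 = []"
| "altr i j (Suc k) = altr j i k @ [i]"

lemma length_altr [simp]: "length (altr i j k) = k"
  by (induction k arbitrary: i j) auto

lemma set_altr: "set (altr i j k) \<subseteq> {i, j}"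
  by (induction k arbitrary: i j) auto

text \<open>An element of the dihedral parabolic without descents is the identity, by
  \<open>len_par_add\<close> applied to its inverse. Once the last letter \<open>i\<close> is
  removed, \<open>i\<close> is no longer a descent, so either nothing is left or \<open>j\<close> is
  a descent, and the letters alternate.\<close>

lemma altr_word:
  assumes "x \<in> W {i, j}" "ht (x (root i)) < 0"
  shows "x = wd (altr i j (len x))"
  using assms
proof (induction "len x" arbitrary: x i j)
  case 0
  then show ?case using len_neg[of x i] W_sub by fastforce
next
  case (Suc k)
  let ?y = "x \<circ> s i"
  have y: "?y \<in> W {j, i}" using Suc.prems W_comp_s by (metis insertI1 insert_commute)
  have ly: "len ?y = k" using Suc len_neg[of x i] W_sub by fastforce
  have xy: "x = ?y \<circ> s i" by simp
  have "?y = wd (altr j i k)"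
  proof (cases k)
    case 0
    then show ?thesis using ly y len_0 W_sub by fastforce
  next
    case (Suc k')
    have "ht (?y (root j)) < 0"
    proof (rule ccontr)
      assume "\<not> ?thesis"
      then have "0 < ht (?y (root j))" using ht_root_nz[OF y, of j] by simp
      moreover have "0 < ht (?y (root i))" using Suc.prems weyl_minus[OF Suc.prems(1)] by simp
      ultimately have "\<And>l. l \<in> {j, i} \<Longrightarrow> 0 < ht (?y (root l))" by blast
      from len_par_add[OF W_sub[OF y] this W_inv[OF y]]
      have "len (id :: 'n weyl_elt) = len ?y + len (inv ?y)"
        by (simp only: W_inv_comp[OF y])
      then show False using ly \<open>k = Suc k'\<close> by simp
    qed
    then show ?thesis using Suc.hyps(1)[OF ly[symmetric] y] ly by simp
  qed
  then have "x = wd (altr j i k @ [i])" using xy by simp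
  then show ?case using Suc.hyps(2) by (metis altr.simps(2))
qed

text \<open>Induction on the length. If the last letters \<open>i\<close> and \<open>j\<close>
  differ, both are descents of the element, which therefore factors with additive length as
  \<open>v\<close> times the longest element of the dihedral parabolic. A reduced word of
  \<open>v\<close> followed by either alternating word is again reduced and shares its last letter
  with one of the given words; the two are linked by \<open>braid\<close>, which is demanded only
  for equal and reduced alternating words.\<close>

lemma matsumoto:
  fixes f :: "'n \<Rightarrow> 'x \<Rightarrow> 'x"
  assumes braid: "\<And>i j k. i \<noteq> j \<Longrightarrow> wd (altr i j k) = wd (altr j i k) \<Longrightarrow>
      len (wd (altr i j k)) = k \<Longrightarrow> op_word f (altr i j k) = op_word f (altr j i k)"
  shows "length a = len (wd a) \<Longrightarrow> length b = len (wd b) \<Longrightarrow> wd a = wd b \<Longrightarrow> op_word f a = op_word f b"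
proof (induction "length a" arbitrary: a b)
  case 0
  then show ?case by simp
next
  case (Suc n)
  let ?w = "wd a"
  have w: "?w \<in> W UNIV" by (auto simp: weyl_iff_word)
  obtain a' i where a: "a = a' @ [i]" using Suc.hyps(2) by (cases a rule: rev_cases) auto
  have "length b = Suc n" using Suc by simp
  then obtain b' j where b: "b = b' @ [j]" by (cases b rule: rev_cases) auto
  have last: "wd c' = ?w \<circ> s l \<and> length c' = len (wd c') \<and> ht (?w (root l)) < 0"
    if "wd (c' @ [l]) = ?w" "length (c' @ [l]) = Suc n" for c' l
  proof -
    have c': "wd c' \<in> W UNIV" by (auto simp: weyl_iff_word)
    have e: "wd c' \<circ> s l = ?w" using that by simp
    then have e': "wd c' = ?w \<circ> s l" by (metis s_comp_s2)
    have l: "len ?w = Suc (length c')" using Suc that by simp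
    moreover have "len (wd c') \<le> length c'" by (rule len_le)
    moreover have "len ?w \<le> Suc (len (wd c'))" using len_comp_s_le[OF c', of l] e by simp
    ultimately have "len (wd c') = length c'" by simp
    moreover have "ht (?w (root l)) < 0"
      using len_pos[OF w, of l] ht_root_nz[OF w, of l] e' l \<open>len (wd c') \<le> length c'\<close> by force
    ultimately show ?thesis using e' by simp
  qed
  have "wd (a' @ [i]) = ?w" "length (a' @ [i]) = Suc n"
    by (simp_all only: a[symmetric] Suc.hyps(2))
  then have la: "wd a' = ?w \<circ> s i" "length a' = len (wd a')" "ht (?w (root i)) < 0"
    using last by blast+
  have "wd (b' @ [j]) = ?w" "length (b' @ [j]) = Suc n"
    using \<open>length b = Suc n\<close> by (simp_all only: b[symmetric] Suc.prems(3))
  then have lb: "wd b' = ?w \<circ> s j" "length b' = len (wd b')" "ht (?w (root j)) < 0"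
    using last by blast+
  show ?case
  proof (cases "i = j")
    case True
    then have "op_word f a' = op_word f b'"
      using la lb a Suc.hyps(2) by (intro Suc.hyps(1)) auto
    then show ?thesis using a b True by simp
  next
    case False
    let ?K = "{i, j}"
    define x where "x = longest C ?K"
    have x: "x \<in> W ?K" "ht (x (root i)) < 0" "ht (x (root j)) < 0"
      using longest_props(1)[of ?K] longest_props(2)[of _ ?K] by (auto simp: x_def)
    define k where "k = len x"
    have xi: "x = wd (altr i j k)" using altr_word[OF x(1,2)] by (simp add: k_def)
    have xj: "x = wd (altr j i k)" using altr_word[of x j i] x by (simp add: k_def insert_commute)
    obtain k' where k': "k = Suc k'"
      using len_neg[OF W_sub[OF x(1)] x(2)] by (metis k_def)
    define v where "v = ?w \<circ> inv x"
    have ix: "inv x \<in> W ?K" using x W_inv by blast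
    have v: "v \<in> W UNIV" using w ix W_sub weyl_comp v_def by blast
    have vx: "v \<circ> x = ?w" using W_inv_comp[OF x(1)] by (simp add: v_def comp_assoc)
    have lv: "len v + len x = len ?w"
      using len_par_sub[OF w _ ix] la lb len_inv[OF x(1)] by (auto simp: v_def)
    obtain vs where vs: "wd vs = v" "length vs = len v" using red_exists[OF v] by blast
    have wi: "wd (vs @ altr i j k) = ?w" using vs vx xi by simp
    have wj: "wd (vs @ altr j i k) = ?w" using vs vx xj by simp
    have len1: "length (vs @ altr l m k) = Suc n" for l m
      using vs lv k_def Suc by simp
    have vi: "vs @ altr i j k = (vs @ altr j i k') @ [i]" "vs @ altr j i k = (vs @ altr i j k') @ [j]"
      by (simp_all add: k')
    have li: "wd (vs @ altr j i k') = ?w \<circ> s i" "length (vs @ altr j i k') = len (wd (vs @ altr j i k'))"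
      using last[of "vs @ altr j i k'" i] wi len1[of i j] unfolding vi by blast+
    have lj: "wd (vs @ altr i j k') = ?w \<circ> s j" "length (vs @ altr i j k') = len (wd (vs @ altr i j k'))"
      using last[of "vs @ altr i j k'" j] wj len1[of j i] unfolding vi by blast+
    have "op_word f a' = op_word f (vs @ altr j i k')"
      using la li a Suc.hyps(2) by (intro Suc.hyps(1)) simp_all
    then have 1: "op_word f a = op_word f (vs @ altr i j k)" by (simp add: a k' comp_assoc)
    have "op_word f b' = op_word f (vs @ altr i j k')"
      using lb lj b \<open>length b = Suc n\<close> by (intro Suc.hyps(1)) simp_all
    then have 2: "op_word f b = op_word f (vs @ altr j i k)" by (simp add: b k' comp_assoc)
    have "wd (altr i j k) = wd (altr j i k)" "len (wd (altr i j k)) = k"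
      by (simp_all only: xi[symmetric] xj[symmetric] k_def[symmetric])
    from braid[OF False this] show ?thesis using 1 2 by simp
  qed
qed

section \<open>Dominant and minimal representatives\<close>

text \<open>Subtracting the average over the parabolic subgroup makes this height nonnegative on
  dominant weights even when I is not the whole index set.\<close>

definition par_ht :: "'n set \<Rightarrow> 'n weight \<Rightarrow> int" where
  "par_ht I x = (\<Sum>w\<in>W I. ht x - ht (w x))"

lemma par_ht_add: "par_ht I (x + y) = par_ht I x + par_ht I y"
  and par_ht_diff: "par_ht I (x - y) = par_ht I x - par_ht I y"
  and par_ht_zero: "par_ht I 0 = 0"
proof -
  show add: "par_ht I (x + y) = par_ht I x + par_ht I y" for x y
  proof -
    have "ht (x + y) - ht (w (x + y)) = (ht x - ht (w x)) + (ht y - ht (w y))" if "w \<in> W I" for w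
      by (simp only: weyl_add[OF that] ht_add)
    then show ?thesis by (simp only: par_ht_def sum.distrib[symmetric]) (rule sum.cong, auto)
  qed
  show zero: "par_ht I 0 = 0" using add[of 0 0] by simp
  have minus: "par_ht I (- x) = - par_ht I x" for x using add[of x "- x"] zero by simp
  show "par_ht I (x - y) = par_ht I x - par_ht I y" using add[of x "- y"] minus[of y] by simp
qed

lemma par_ht_scale: "par_ht I (\<lambda>i. c * x i) = c * par_ht I x"
  by (simp add: par_ht_def weyl_scale[of _ C I] ht_scale sum_distrib_left right_diff_distrib)

text \<open>Right multiplication by the reflection in \<open>u (root i)\<close> permutes
  \<open>W I\<close> and negates each height in the subtracted sum. That sum is therefore 0, and
  only the multiple by the group order remains.\<close>

lemma par_ht_W_root:
  assumes "u \<in> W I" "i \<in> I"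
  shows "par_ht I (u (root i)) = int (card (W I)) * ht (u (root i))"
proof -
  let ?S = "\<Sum>w\<in>W I. ht (w (u (root i)))"
  have u: "u \<circ> s i \<circ> inv u \<in> W I" using assms by (meson W_comp_s W_inv weyl_comp)
  have "(\<Sum>w\<in>W I. ht ((w \<circ> (u \<circ> s i \<circ> inv u)) (u (root i)))) = ?S"
    using sum.reindex_bij_betw[OF bij_betw_W_comp[OF u], of "\<lambda>w. ht (w (u (root i)))"] by simp
  moreover have "ht ((w \<circ> (u \<circ> s i \<circ> inv u)) (u (root i))) = - ht (w (u (root i)))" if "w \<in> W I" for w
    using assms that by (simp only: comp_apply W_inv_apply s_root weyl_minus ht_minus)
  ultimately have "- ?S = ?S" by (simp add: sum_negf)
  then have "?S = 0" by simp
  then show ?thesis by (simp add: par_ht_def sum_subtractf)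
qed

lemma card_W_pos: "0 < card (W I)"
  using id_in_W finite_W_sub card_gt_0_iff by blast

lemma par_ht_root_pos: "i \<in> I \<Longrightarrow> 0 < par_ht I (root i)"
  using par_ht_W_root[OF id_in_W, of i I] card_W_pos[of I] q_pos[of i] by (simp add: ht_root)

lemma par_ht_rt_nonneg:
  assumes "\<And>j. 0 \<le> c j" "\<And>j. j \<notin> I \<Longrightarrow> c j = 0"
  shows "0 \<le> par_ht I (rt C c)" "c k \<noteq> 0 \<Longrightarrow> 0 < par_ht I (rt C c)"
proof -
  have "par_ht I (rt C c) = (\<Sum>j\<in>UNIV. c j * par_ht I (root j))"
  proof -
    have "par_ht I (\<lambda>i. \<Sum>j\<in>A. c j * root j i) = (\<Sum>j\<in>A. c j * par_ht I (root j))" if "finite A" for A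
      using that
    proof (induction A rule: finite_induct)
      case empty
      then show ?case using par_ht_zero by (simp add: zero_fun_def)
    next
      case (insert a A)
      have "(\<lambda>i. \<Sum>j\<in>insert a A. c j * root j i) = (\<lambda>i. c a * root a i) + (\<lambda>i. \<Sum>j\<in>A. c j * root j i)"
        using insert.hyps by (auto simp: fun_eq_iff)
      then show ?case using insert by (simp only: par_ht_add par_ht_scale) simp
    qed
    then show ?thesis by (simp add: rt_def)
  qed
  moreover have "0 \<le> c j * par_ht I (root j)" for j
    using assms[of j] par_ht_root_pos[of j I] by (cases "j \<in> I") (auto intro: mult_nonneg_nonneg less_imp_le)
  moreover have "0 < c k * par_ht I (root k)" if "c k \<noteq> 0"
    using that assms[of k] par_ht_root_pos[of k I] by (cases "k \<in> I") (auto simp: less_le)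
  ultimately show "0 \<le> par_ht I (rt C c)" "c k \<noteq> 0 \<Longrightarrow> 0 < par_ht I (rt C c)"
    by (auto intro: sum_nonneg sum_pos2[of _ k])
qed

lemma par_ht_dominant:
  assumes "w \<in> W I" "dominant I x"
  shows "par_ht I (w x) \<le> par_ht I x" "w x \<noteq> x \<Longrightarrow> par_ht I (w x) < par_ht I x"
proof -
  obtain c where c: "\<And>j. 0 \<le> c j" "\<And>j. j \<notin> I \<Longrightarrow> c j = 0" "x - w x = rt C c"
    using dominant_diff[OF assms] by blast
  have e: "par_ht I x - par_ht I (w x) = par_ht I (rt C c)" using c(3) par_ht_diff by metis
  then show "par_ht I (w x) \<le> par_ht I x" using par_ht_rt_nonneg(1)[of c I] c by fastforce
  assume "w x \<noteq> x"
  then have "c \<noteq> 0" using c(3) by (auto simp: rt_def zero_fun_def[symmetric])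
  then obtain k where "c k \<noteq> 0" by (metis ext zero_fun_apply)
  then show "par_ht I (w x) < par_ht I x" using e par_ht_rt_nonneg(2)[of c I k] c by fastforce
qed

lemma par_ht_dominant_nonneg: "dominant I x \<Longrightarrow> 0 \<le> par_ht I x"
proof -
  assume d: "dominant I x"
  have "0 \<le> ht x - ht (w x)" if "w \<in> W I" for w
    using dominant_diff[OF that d] ht_rt_nonneg ht_diff by metis
  then show ?thesis unfolding par_ht_def by (intro sum_nonneg) auto
qed

text \<open>A point of the orbit with maximal \<open>par_ht\<close> is dominant, since reflecting at
  a negative coordinate would raise the value.\<close>

lemma dominant_exists: "\<exists>w\<in>W I. dominant I (w x)"
proof -
  let ?S = "(\<lambda>w. par_ht I (w x)) ` W I"
  have "finite ?S" "?S \<noteq> {}" using finite_W_sub id_in_W by auto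
  then have "Max ?S \<in> ?S" by (rule Max_in)
  then obtain w where w: "w \<in> W I" "par_ht I (w x) = Max ?S" by auto
  have "0 \<le> w x i" if i: "i \<in> I" for i
  proof -
    have "par_ht I ((s i \<circ> w) x) \<le> Max ?S"
      using \<open>finite ?S\<close> W_s_comp[OF w(1) i] by (intro Max_ge) blast+
    then have "w x i * par_ht I (root i) \<ge> 0" using w(2) by (simp add: sref_eq par_ht_diff par_ht_scale)
    then show ?thesis using par_ht_root_pos[OF i] by (simp add: zero_le_mult_iff)
  qed
  then show ?thesis using w by (auto simp: dominant_def)
qed

definition dom_rep :: "'n set \<Rightarrow> 'n weight \<Rightarrow> 'n weight" where
  "dom_rep I x = (THE y. dominant I y \<and> (\<exists>w\<in>W I. w y = x))"

lemma dom_rep_eqI: "dominant I y \<Longrightarrow> w \<in> W I \<Longrightarrow> w y = x \<Longrightarrow> dom_rep I x = y"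
proof -
  assume y: "dominant I y" "w \<in> W I" "w y = x"
  have "z = y" if z: "dominant I z" "v \<in> W I" "v z = x" for z v
  proof -
    have "inv v \<circ> w \<in> W I" using y z weyl_comp W_inv by blast
    moreover have "(inv v \<circ> w) y = z" using y z by (metis W_inv_apply(1) comp_apply)
    ultimately show ?thesis using dominant_stab y(1) z(1) by metis
  qed
  then show ?thesis unfolding dom_rep_def using y by (intro the_equality) blast+
qed

lemma dom_rep_props: "dominant I (dom_rep I x)" "\<exists>w\<in>W I. w (dom_rep I x) = x"
proof -
  obtain w where w: "w \<in> W I" "dominant I (w x)" using dominant_exists by blast
  have e: "inv w (w x) = x" using w by simp
  have "dom_rep I x = w x" by (rule dom_rep_eqI[OF w(2) W_inv[OF w(1)] e])
  then show "dominant I (dom_rep I x)" "\<exists>w\<in>W I. w (dom_rep I x) = x" using w e W_inv by metis+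
qed

definition min_elt :: "'n set \<Rightarrow> 'n weight \<Rightarrow> 'n weyl_elt" where
  "min_elt I x = (SOME w. w \<in> W I \<and> w (dom_rep I x) = x \<and> (\<forall>v\<in>W I. v (dom_rep I x) = x \<longrightarrow> len w \<le> len v))"

lemma min_elt_props: "min_elt I x \<in> W I" "min_elt I x (dom_rep I x) = x" "v \<in> W I \<Longrightarrow> v (dom_rep I x) = x \<Longrightarrow> len (min_elt I x) \<le> len v"
proof -
  let ?P = "\<lambda>w. w \<in> W I \<and> w (dom_rep I x) = x"
  obtain w where "?P w" using dom_rep_props(2) by blast
  then obtain w where "?P w" "\<forall>v. ?P v \<longrightarrow> len w \<le> len v"
    using ex_has_least_nat[of ?P w len] by blast
  then have "\<exists>w. w \<in> W I \<and> w (dom_rep I x) = x \<and> (\<forall>v\<in>W I. v (dom_rep I x) = x \<longrightarrow> len w \<le> len v)" by blast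
  from someI_ex[OF this]
  show "min_elt I x \<in> W I" "min_elt I x (dom_rep I x) = x" "v \<in> W I \<Longrightarrow> v (dom_rep I x) = x \<Longrightarrow> len (min_elt I x) \<le> len v"
    unfolding min_elt_def by blast+
qed

lemma min_elt_descent:
  assumes "i \<in> descent C (min_elt I x)"
  shows "0 < dom_rep I x i"
proof (rule ccontr)
  assume "\<not> 0 < dom_rep I x i"
  moreover have i: "i \<in> I" using assms descent_sub min_elt_props(1) by blast
  ultimately have "dom_rep I x i = 0" using dom_rep_props(1)[of I x] by (auto simp: dominant_def)
  then have "(min_elt I x \<circ> s i) (dom_rep I x) = x" by (simp add: s_fix min_elt_props)
  then have "len (min_elt I x) \<le> len (min_elt I x \<circ> s i)" using min_elt_props(3) W_comp_s min_elt_props(1) i by blast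
  then show False using assms by (simp add: descent_def)
qed

text \<open>Two elements with the same image differ by a stabilizer element \<open>?y\<close>, which
  lies in the parabolic subgroup of the zero coordinates. No such index is a descent of
  \<open>w\<close>, so lengths add in \<open>w \<circ> ?y\<close>. Having descents only at positive
  coordinates thus characterizes the unique shortest representative.\<close>

lemma min_rep:
  assumes w: "w \<in> W I" "dominant I x" "\<And>i. i \<in> descent C w \<Longrightarrow> 0 < x i"
    and v: "v \<in> W I" "v x = w x"
  shows "len w \<le> len v" "v \<noteq> w \<Longrightarrow> len w < len v"
proof -
  let ?y = "inv w \<circ> v" and ?K = "{i \<in> I. x i = 0}"
  have "?y \<in> W I" using w v weyl_comp W_inv by blast
  moreover have "?y x = x" using v(2) w(1) by simp
  ultimately have y: "?y \<in> W ?K" using dominant_stab[of ?y I x] w(2) by simp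
  have "len (w \<circ> ?y) = len w + len ?y"
  proof (rule len_par_add[OF W_sub[OF w(1)] _ y])
    fix k assume "k \<in> ?K"
    then have "k \<notin> descent C w" using w(3)[of k] by auto
    then show "0 < ht (w (root k))" using not_descent_iff[OF w(1)] by blast
  qed
  moreover have e: "w \<circ> ?y = v" using w(1) by (simp add: o_assoc W_inv_comp)
  ultimately have l: "len v = len w + len ?y" by simp
  then show "len w \<le> len v" by simp
  assume "v \<noteq> w"
  then have "?y \<noteq> id" using e by auto
  then show "len w < len v" using l len_0[OF W_sub[OF y]] by simp
qed

lemma dom_rep_min_elt_eqI:
  assumes "w \<in> W I" "dominant I x" "\<And>i. i \<in> descent C w \<Longrightarrow> 0 < x i"
  shows "dom_rep I (w x) = x" "min_elt I (w x) = w"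
proof -
  show d: "dom_rep I (w x) = x" by (rule dom_rep_eqI[OF assms(2,1) refl])
  show "min_elt I (w x) = w"
    using min_rep(2)[OF assms min_elt_props(1)] min_elt_props(2)[of I "w x"] min_elt_props(3)[of w I "w x"]
      assms(1) unfolding d by (meson leD)
qed

end

section \<open>The group algebra and Demazure operators\<close>

abbreviation "lookup \<equiv> Poly_Mapping.lookup"
abbreviation "keys \<equiv> Poly_Mapping.keys"

lemma lookup_smult: "lookup (smult c f) k = c * lookup f k"
  by (simp add: smult_def map.rep_eq when_def)

lemma smult_conv: "smult c f = Poly_Mapping.single 0 c * f"
  unfolding smult_def by (rule mult_map_scale_conv_mult)

lemma smult_add: "smult c (f + g) = smult c f + smult c g"
  and smult_diff: "smult c (f - g) = smult c f - smult c g"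
  and smult_zero [simp]: "smult c 0 = 0"
  and smult_0 [simp]: "smult 0 f = 0"
  and smult_1 [simp]: "smult 1 f = f"
  and smult_add_left: "smult (c + d) f = smult c f + smult d f"
  and smult_minus_left: "smult (- c) f = - smult c f"
  and smult_smult: "smult c (smult d f) = smult (c * d) f"
  by (rule poly_mapping_eqI, simp add: lookup_smult lookup_add lookup_minus algebra_simps)+

lemma smult_mult: "smult c f * g = smult c (f * g)" "f * smult c g = smult c (f * g)"
  by (simp_all add: smult_conv ac_simps)

lemma smult_sum: "smult c (sum f A) = (\<Sum>x\<in>A. smult c (f x))"
  by (induction A rule: infinite_finite_induct) (simp_all add: smult_add)

lemma expw_mult: "expw a * expw b = expw (a + b)"
  by (simp add: expw_def mult_single)

lemma expw_0: "expw 0 = 1"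
  by (simp add: expw_def)

lemma lookup_expw: "lookup (expw a) k = (if a = k then 1 else 0)"
  by (simp add: expw_def lookup_single when_def)

lemma keys_expw: "keys (expw a :: ('n, 'a::field) laurent) = {a}"
  by (simp add: expw_def)

lemma laurent_expand: "f = (\<Sum>\<mu>\<in>keys f. smult (lookup f \<mu>) (expw \<mu>))"
proof (rule poly_mapping_eqI)
  fix k
  have "lookup (\<Sum>\<mu>\<in>keys f. smult (lookup f \<mu>) (expw \<mu>)) k
      = (\<Sum>\<mu>\<in>keys f. if \<mu> = k then lookup f \<mu> else 0)"
    by (simp add: lookup_sum lookup_smult lookup_expw if_distrib cong: if_cong)
  also have "\<dots> = lookup f k" by (simp add: sum.delta in_keys_iff)
  finally show "lookup f k = lookup (\<Sum>\<mu>\<in>keys f. smult (lookup f \<mu>) (expw \<mu>)) k" by simp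
qed

definition lin :: "(('n, 'a::field) laurent \<Rightarrow> ('n, 'a) laurent) \<Rightarrow> bool" where
  "lin T \<longleftrightarrow> (\<forall>f g. T (f + g) = T f + T g) \<and> (\<forall>c f. T (smult c f) = smult c (T f))"

lemma linI: "(\<And>f g. T (f + g) = T f + T g) \<Longrightarrow> (\<And>c f. T (smult c f) = smult c (T f)) \<Longrightarrow> lin T"
  by (simp add: lin_def)

lemma lin_add: "lin T \<Longrightarrow> T (f + g) = T f + T g"
  and lin_smult: "lin T \<Longrightarrow> T (smult c f) = smult c (T f)"
  by (simp_all add: lin_def)

lemma lin_zero: "lin T \<Longrightarrow> T 0 = 0"
  using lin_smult[of T 0 0] by simp

lemma lin_minus: "lin T \<Longrightarrow> T (- f) = - T f"
  using lin_smult[of T "- 1" f] by (simp add: smult_minus_left)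

lemma lin_diff: "lin T \<Longrightarrow> T (f - g) = T f - T g"
  using lin_add[of T f "- g"] lin_minus[of T g] by simp

lemma lin_sum: "lin T \<Longrightarrow> T (sum f A) = (\<Sum>x\<in>A. T (f x))"
  by (induction A rule: infinite_finite_induct) (simp_all add: lin_zero lin_add)

lemma lin_expand: "lin T \<Longrightarrow> T f = (\<Sum>\<mu>\<in>keys f. smult (lookup f \<mu>) (T (expw \<mu>)))"
  by (subst laurent_expand) (simp add: lin_sum lin_smult)

lemma lin_eqI:
  assumes "lin S" "lin T" "\<And>\<mu>. S (expw \<mu>) = T (expw \<mu>)"
  shows "S f = T f"
  using lin_expand[OF assms(1), of f] lin_expand[OF assms(2), of f] assms(3) by simp

lemma lin_comp: "lin S \<Longrightarrow> lin T \<Longrightarrow> lin (S \<circ> T)"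
  by (simp add: lin_def)

lemma lin_id: "lin id"
  by (simp add: lin_def)

lemma lin_mult: "lin T \<Longrightarrow> lin (\<lambda>f. g * T f)"
  by (simp add: lin_def distrib_left smult_mult)

lemma lin_mult_left: "lin (\<lambda>f. f * g)"
  by (simp add: lin_def distrib_right smult_mult)

lemma lin_subtract: "lin S \<Longrightarrow> lin T \<Longrightarrow> lin (\<lambda>f. S f - T f)"
  by (simp add: lin_def smult_diff)

lemma lin_op_word: "(\<And>i. lin (F i)) \<Longrightarrow> lin (op_word F is)"
  by (induction "is") (simp_all add: lin_id lin_comp)

lemma lookup_expw_mult: "lookup (expw a * g) k = lookup g (k - a)"
proof -
  have "expw a * g = (\<Sum>\<mu>\<in>keys g. smult (lookup g \<mu>) (expw (a + \<mu>)))"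
    by (subst lin_expand[OF lin_mult[OF lin_id, unfolded id_apply]]) (simp add: expw_mult)
  then have "lookup (expw a * g) k = (\<Sum>\<mu>\<in>keys g. if \<mu> = k - a then lookup g \<mu> else 0)"
    by (simp only: lookup_sum lookup_smult lookup_expw) (intro sum.cong refl, auto simp: algebra_simps)
  also have "\<dots> = lookup g (k - a)" by (simp add: sum.delta in_keys_iff)
  finally show ?thesis .
qed

lemma wact_superset:
  assumes "finite S" "keys f \<subseteq> S"
  shows "wact w f = (\<Sum>\<mu>\<in>S. Poly_Mapping.single (w \<mu>) (lookup f \<mu>))"
  unfolding wact_def using assms by (intro sum.mono_neutral_left) (auto simp: in_keys_iff)

lemma lin_wact: "lin (wact w)"
proof (rule linI)
  fix f g :: "('a, 'b) laurent" and c
  let ?S = "keys f \<union> keys g"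
  have "wact w (f + g) = (\<Sum>\<mu>\<in>?S. Poly_Mapping.single (w \<mu>) (lookup (f + g) \<mu>))"
    by (rule wact_superset) (auto dest: subsetD[OF keys_add])
  also have "\<dots> = wact w f + wact w g"
    using wact_superset[of ?S f w] wact_superset[of ?S g w]
    by (simp add: lookup_add single_add sum.distrib)
  finally show "wact w (f + g) = wact w f + wact w g" .
  have "wact w (smult c f) = (\<Sum>\<mu>\<in>keys f. Poly_Mapping.single (w \<mu>) (lookup (smult c f) \<mu>))"
    by (rule wact_superset) (auto simp: in_keys_iff lookup_smult)
  also have "\<dots> = smult c (wact w f)"
    by (simp add: wact_def smult_conv sum_distrib_left mult_single lookup_smult[unfolded smult_conv])
  finally show "wact w (smult c f) = smult c (wact w f)" .
qed

lemma wact_expw: "wact w (expw \<mu>) = expw (w \<mu>)"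
  by (simp add: wact_def keys_expw lookup_expw) (simp add: expw_def)

lemma wact_mult:
  assumes "\<And>x y. w (x + y) = w x + w y"
  shows "wact w (f * g) = wact w f * wact w g"
proof -
  have 1: "wact w (expw \<mu> * g) = expw (w \<mu>) * wact w g" for \<mu> and g :: "('a, 'b) laurent"
    by (rule lin_eqI[of "\<lambda>g. wact w (expw \<mu> * g)"])
       (auto intro!: lin_mult lin_wact lin_comp[OF lin_wact, unfolded comp_def] lin_id[unfolded id_def]
         simp: expw_mult wact_expw assms)
  show ?thesis
    by (rule lin_eqI[of "\<lambda>f. wact w (f * g)"])
       (auto intro!: lin_mult_left lin_comp[OF lin_wact lin_mult_left, unfolded comp_def]
          lin_comp[OF lin_mult_left lin_wact, unfolded comp_def] simp: 1 wact_expw)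
qed

definition scale :: "int \<Rightarrow> 'n weight \<Rightarrow> 'n weight" where
  "scale k x = (\<lambda>i. k * x i)"

lemma scale_simps: "scale (k + l) x = scale k x + scale l x" "scale 0 x = 0" "scale 1 x = x" "scale (- k) x = - scale k x"
  "scale (k - l) x = scale k x - scale l x"
  by (auto simp: scale_def algebra_simps)

context fin_cartan
begin

lemma s_scale: "s i x = x - scale (x i) (root i)"
  by (simp add: sref_eq scale_def)

text \<open>The coefficients of a counterexample would be invariant under translation by
  \<open>root i\<close>. This contradicts finite support: adding the root raises the coordinate at
  \<open>i\<close> by 2, beyond its maximum. The quotient that defines the Demazure operator is
  therefore unique.\<close>

lemma one_minus_expw_cancel:
  assumes "(1 - expw (- root i)) * g = (0 :: ('n, 'a::field) laurent)"
  shows "g = 0"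
proof (rule ccontr)
  assume "g \<noteq> 0"
  then have ne: "keys g \<noteq> {}" by (metis keys_eq_empty)
  have eq: "lookup g k = lookup g (k + root i)" for k
  proof -
    have "g = expw (- root i) * g" using assms by (simp add: algebra_simps)
    then show ?thesis using lookup_expw_mult[of "- root i" g k] by (metis diff_minus_eq_add)
  qed
  let ?M = "Max ((\<lambda>k. k i) ` keys g)"
  have "?M \<in> (\<lambda>k. k i) ` keys g" using ne by (intro Max_in) auto
  then obtain k where k: "k \<in> keys g" "k i = ?M" by auto
  then have "k + root i \<in> keys g" using eq by (simp add: in_keys_iff)
  then have "(k + root i) i \<le> ?M" by (intro Max_ge finite_imageI finite_keys imageI)
  then show False using k(2) root_self[of i] by simp
qed

lemma demazure_eqI:
  assumes "(1 - expw (- root i)) * g = f - expw (- root i) * wact (s i) f"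
  shows "demazure C i f = g"
  unfolding demazure_def
proof (rule the_equality, rule assms)
  fix h assume "(1 - expw (- root i)) * h = f - expw (- root i) * wact (s i) f"
  then have "(1 - expw (- root i)) * (h - g) = 0" using assms by (simp only: right_diff_distrib diff_self)
  then show "h = g" using one_minus_expw_cancel by fastforce
qed

lemma root_string_pos:
  assumes "0 \<le> \<kappa> i"
  shows "(1 - expw (- root i)) * (\<Sum>k\<le>nat (\<kappa> i). expw (\<kappa> - scale (int k) (root i)))
      = (expw \<kappa> - expw (- root i) * wact (s i) (expw \<kappa>) :: ('n, 'a::field) laurent)"
proof -
  have tel: "(1 - expw (- root i)) * (\<Sum>k<n. expw (\<kappa> - scale (int k) (root i)))
      = (expw \<kappa> - expw (\<kappa> - scale (int n) (root i)) :: ('n, 'a) laurent)" for n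
  proof (induction n)
    case 0
    show ?case by (simp add: scale_simps)
  next
    case (Suc n)
    have "(1 - expw (- root i)) * (\<Sum>k<Suc n. expw (\<kappa> - scale (int k) (root i)))
      = (expw \<kappa> - expw (\<kappa> - scale (int n) (root i))) + (1 - expw (- root i)) * (expw (\<kappa> - scale (int n) (root i)) :: ('n, 'a) laurent)"
      by (simp only: sum.lessThan_Suc distrib_left Suc)
    also have "\<dots> = expw \<kappa> - expw (- root i + (\<kappa> - scale (int n) (root i)))"
      by (simp add: left_diff_distrib expw_mult)
    also have "- root i + (\<kappa> - scale (int n) (root i)) = \<kappa> - scale (int (Suc n)) (root i)"
      by (auto simp: scale_def algebra_simps)
    finally show ?case .
  qed
  have "- root i + s i \<kappa> = \<kappa> - scale (int (Suc (nat (\<kappa> i)))) (root i)"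
    using assms by (auto simp: s_scale scale_def algebra_simps)
  then show ?thesis
    by (simp only: tel lessThan_Suc_atMost[symmetric] wact_expw expw_mult)
qed

text \<open>Here the string consists of the weights strictly between \<open>\<kappa>\<close> and its
  reflection, with a minus sign. It is empty when the coordinate is -1, which is where the bound
  lowered by one comes from.\<close>

lemma root_string_neg:
  assumes "\<kappa> i < 0"
  shows "(1 - expw (- root i)) * - (\<Sum>k<nat (- \<kappa> i) - 1. expw (\<kappa> + scale (int (Suc k)) (root i)))
      = (expw \<kappa> - expw (- root i) * wact (s i) (expw \<kappa>) :: ('n, 'a::field) laurent)"
proof -
  have tel: "(1 - expw (- root i)) * (\<Sum>k<n. expw (\<kappa> + scale (int (Suc k)) (root i)))
      = (expw (\<kappa> + scale (int n) (root i)) - expw \<kappa> :: ('n, 'a) laurent)" for n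
  proof (induction n)
    case 0
    show ?case by (simp add: scale_simps)
  next
    case (Suc n)
    have "(1 - expw (- root i)) * (\<Sum>k<Suc n. expw (\<kappa> + scale (int (Suc k)) (root i)))
      = (expw (\<kappa> + scale (int n) (root i)) - expw \<kappa>) + (1 - expw (- root i)) * (expw (\<kappa> + scale (int (Suc n)) (root i)) :: ('n, 'a) laurent)"
      by (simp only: sum.lessThan_Suc distrib_left Suc)
    also have "\<dots> = expw (\<kappa> + scale (int (Suc n)) (root i)) - expw \<kappa>
        + (expw (\<kappa> + scale (int n) (root i)) - expw (- root i + (\<kappa> + scale (int (Suc n)) (root i))))"
      by (simp only: left_diff_distrib expw_mult) (simp only: diff_conv_add_uminus add.assoc add.commute add.left_commute mult_1)
    also have "- root i + (\<kappa> + scale (int (Suc n)) (root i)) = \<kappa> + scale (int n) (root i)"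
      by (auto simp: scale_def algebra_simps)
    finally show ?case by simp
  qed
  obtain n where n: "nat (- \<kappa> i) = Suc n" using assms by (cases "nat (- \<kappa> i)") auto
  then have ki: "\<kappa> i = - int (Suc n)" by linarith
  have "- root i + s i \<kappa> = \<kappa> + scale (int n) (root i)"
    unfolding sref_eq ki scale_def by (intro ext) (simp add: algebra_simps)
  then show ?thesis
    by (simp only: n diff_Suc_1 mult_minus_right tel wact_expw expw_mult) simp
qed

lemma demazure_spec:
  "(1 - expw (- root i)) * demazure C i f = f - expw (- root i) * wact (s i) (f :: ('n, 'a::field) laurent)"
proof -
  let ?E = "1 - expw (- root i) :: ('n, 'a) laurent"
  let ?T = "\<lambda>f. f - expw (- root i) * wact (s i) f"
  have lin: "lin ?T"
    by (rule lin_subtract[OF lin_id[unfolded id_def] lin_mult[OF lin_wact]])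
  have ex: "\<forall>\<kappa>. \<exists>g. ?E * g = ?T (expw \<kappa>)"
  proof
    fix \<kappa>
    show "\<exists>g. ?E * g = ?T (expw \<kappa>)"
    using root_string_pos[of \<kappa> i, where 'a = 'a] root_string_neg[of \<kappa> i, where 'a = 'a]
    by (cases "0 \<le> \<kappa> i") (blast, simp only: not_le, blast)
  qed
  obtain g where g: "\<And>\<kappa>. ?E * g \<kappa> = ?T (expw \<kappa>)" using choice[OF ex] by blast
  have h: "?E * (\<Sum>\<kappa>\<in>keys f. smult (lookup f \<kappa>) (g \<kappa>)) = ?T f"
    by (subst lin_expand[OF lin]) (simp only: sum_distrib_left smult_mult g)
  show ?thesis unfolding demazure_eqI[OF h] by (rule h)
qed

lemma lin_demazure: "lin (demazure C i)"
proof (rule linI)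
  fix f g :: "('n, 'a::field) laurent" and c :: 'a
  have l: "lin (\<lambda>f :: ('n, 'a) laurent. f - expw (- root i) * wact (s i) f)"
    by (rule lin_subtract[OF lin_id[unfolded id_def] lin_mult[OF lin_wact]])
  show "demazure C i (f + g) = demazure C i f + demazure C i g"
    by (rule demazure_eqI) (simp only: distrib_left demazure_spec lin_add[OF l])
  show "demazure C i (smult c f) = smult c (demazure C i f)"
    by (rule demazure_eqI) (simp only: smult_mult demazure_spec lin_smult[OF l])
qed

abbreviation pib :: "'n \<Rightarrow> ('n, 'a::field) laurent \<Rightarrow> ('n, 'a) laurent" where
  "pib \<equiv> demazure_bar C"

lemma lin_pib: "lin (pib i)"
  unfolding demazure_bar_def using lin_subtract[OF lin_demazure lin_id] by (simp add: id_def)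

lemma wact_s_mult: "wact (s i) (f * g) = wact (s i) f * wact (s i) g"
  by (rule wact_mult) (rule sref_add)

lemma wact_s_invol: "wact (s i) (wact (s i) f) = f"
  by (rule lin_eqI[of "\<lambda>f. wact (s i) (wact (s i) f)" "\<lambda>f. f"])
     (auto intro: lin_comp[OF lin_wact lin_wact, unfolded comp_def] lin_id[unfolded id_def] simp: wact_expw)

lemma pib_invariant_mult:
  assumes "wact (s i) r = r"
  shows "pib i (r * f) = r * pib i f"
proof -
  have "(1 - expw (- root i)) * (r * demazure C i f) = r * f - expw (- root i) * wact (s i) (r * f)"
    using demazure_spec[of i f] by (simp add: mult.left_commute wact_s_mult assms right_diff_distrib)
  then show ?thesis using demazure_eqI by (fastforce simp: demazure_bar_def right_diff_distrib)
qed

lemma demazure_invariant: "wact (s i) f = f \<Longrightarrow> demazure C i f = f"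
  by (rule demazure_eqI) (simp add: left_diff_distrib)

text \<open>Reflecting the defining identity exchanges the exponentials of the root and of its
  negative. Multiplication by the latter turns the result, up to a common sign, back into the
  defining identity, now for the reflected quotient; uniqueness of the quotient finishes the
  proof.\<close>

lemma wact_demazure:
  fixes f :: "('n, 'a::field) laurent"
  shows "wact (s i) (demazure C i f) = demazure C i f"
proof -
  let ?e = "expw (- root i) :: ('n, 'a) laurent" and ?g = "wact (s i) (demazure C i f)"
  have e: "?e * expw (root i) = 1" by (simp add: expw_mult expw_0)
  have w1: "wact (s i) 1 = (1 :: ('n, 'a) laurent)"
    unfolding expw_0[symmetric] wact_expw weyl_zero[OF sref_in_weyl[of i UNIV C, OF UNIV_I]] ..
  have w2: "wact (s i) ?e = expw (root i)"
    using weyl_minus[OF sref_in_weyl[of i UNIV C], of "root i"] by (simp add: wact_expw)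
  have w: "wact (s i) (1 - ?e) = 1 - expw (root i)"
    using w1 w2 by (simp only: lin_diff[OF lin_wact])
  have "wact (s i) ((1 - ?e) * demazure C i f) = wact (s i) (f - ?e * wact (s i) f)"
    by (simp only: demazure_spec)
  then have "(1 - expw (root i)) * ?g = wact (s i) f - expw (root i) * f"
    by (simp only: wact_s_mult w w1 w2 lin_diff[OF lin_wact] wact_s_invol)
  then have "?e * ((1 - expw (root i)) * ?g) = ?e * (wact (s i) f - expw (root i) * f)" by simp
  then have "(?e - ?e * expw (root i)) * ?g = ?e * wact (s i) f - ?e * expw (root i) * f"
    by (simp add: algebra_simps)
  then have "(1 - ?e) * ?g = f - ?e * wact (s i) f"
    by (simp only: e mult_1) (simp add: algebra_simps)
  then show ?thesis using demazure_eqI by metis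
qed

lemma pib_pib: "pib i (pib i f) = - pib i f"
  by (simp add: demazure_bar_def lin_diff[OF lin_demazure] demazure_invariant[OF wact_demazure])

lemma pib_expw_nonneg:
  assumes "0 \<le> \<kappa> i"
  shows "pib i (expw \<kappa> :: ('n, 'a::field) laurent) = (\<Sum>k\<in>{1..nat (\<kappa> i)}. expw (\<kappa> - scale (int k) (root i)))"
proof -
  have "{..nat (\<kappa> i)} = insert 0 {1..nat (\<kappa> i)}" by auto
  then show ?thesis
    using demazure_eqI[OF root_string_pos[where 'a = 'a, of \<kappa> i, OF assms]] unfolding demazure_bar_def
    by (simp add: scale_simps)
qed

text \<open>Subtracting the argument puts the starting weight into the string, which now contains
  \<open>\<kappa>\<close> but not its reflection, opposite to the nonnegative case. For coordinate
  -1 this leaves an eigenvector with eigenvalue -1.\<close>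

lemma pib_expw_neg:
  assumes "\<kappa> i < 0"
  shows "pib i (expw \<kappa> :: ('n, 'a::field) laurent) = - (\<Sum>k<nat (- \<kappa> i). expw (\<kappa> + scale (int k) (root i)))"
proof -
  obtain n where n: "nat (- \<kappa> i) = Suc n" using assms by (cases "nat (- \<kappa> i)") auto
  show ?thesis
    using demazure_eqI[OF root_string_neg[where 'a = 'a, of \<kappa> i, OF assms]]
    by (simp only: demazure_bar_def n sum.lessThan_Suc_shift diff_Suc_1) (simp add: scale_simps)
qed

end

section \<open>Leading terms\<close>

lemma keys_smult: "keys (smult c f) \<subseteq> keys f"
  by (auto simp: in_keys_iff lookup_smult)

lemma keys_sum_sub: "keys (sum f A) \<subseteq> (\<Union>x\<in>A. keys (f x :: ('n, 'a::field) laurent))"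
proof
  fix k assume "k \<in> keys (sum f A)"
  then have "(\<Sum>x\<in>A. lookup (f x) k) \<noteq> 0" by (simp add: in_keys_iff lookup_sum)
  then obtain x where "x \<in> A" "lookup (f x) k \<noteq> 0" by (meson sum.neutral)
  then show "k \<in> (\<Union>x\<in>A. keys (f x))" by (auto simp: in_keys_iff)
qed

lemma keys_sum_expw: "keys (\<Sum>x\<in>A. expw (g x) :: ('n, 'a::field) laurent) \<subseteq> g ` A"
  using keys_sum_sub[of "\<lambda>x. expw (g x)" A] by (auto simp: keys_expw)

section \<open>A well-founded order on weights\<close>

context fin_cartan
begin

text \<open>Constant on orbits; by \<open>par_ht_le_height\<close> and
  \<open>height_attained\<close> it is the maximum of \<open>par_ht\<close> over the orbit.\<close>

definition height :: "'n set \<Rightarrow> 'n weight \<Rightarrow> int" where "height I \<nu> = par_ht I (dom_rep I \<nu>)"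

lemma dom_rep_W: "w \<in> W I \<Longrightarrow> dom_rep I (w \<nu>) = dom_rep I \<nu>"
  using dom_rep_props[of I \<nu>] by (metis comp_apply dom_rep_eqI weyl_comp)

lemma height_W: "w \<in> W I \<Longrightarrow> height I (w \<nu>) = height I \<nu>"
  by (simp add: height_def dom_rep_W)

lemma height_nonneg: "0 \<le> height I \<nu>"
  by (simp add: height_def par_ht_dominant_nonneg dom_rep_props)

lemma par_ht_le_height: "w \<in> W I \<Longrightarrow> par_ht I (w \<nu>) \<le> height I \<nu>"
  using par_ht_dominant(1)[of "w \<circ> min_elt I \<nu>" I "dom_rep I \<nu>"] min_elt_props(1,2)[of I \<nu>] dom_rep_props(1)[of I \<nu>] weyl_comp
  by (metis height_def comp_apply)

lemma height_attained: "\<exists>x\<in>W I. height I \<nu> = par_ht I (x \<nu>)"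
  using min_elt_props(1,2)[of I \<nu>] W_inv by (metis height_def W_inv_apply(1))

text \<open>The maximum for the shifted weight is attained at some \<open>x\<close>. Along the
  string \<open>par_ht\<close> after \<open>x\<close> is affine with nonzero slope, so an interior
  weight has a smaller value than one of the two ends, and both ends lie in the orbit of
  \<open>\<kappa>\<close>.\<close>

lemma height_string:
  assumes "i \<in> I" "0 < k" "k < \<kappa> i"
  shows "height I (\<kappa> - scale k (root i)) < height I \<kappa>"
proof -
  obtain x where x: "x \<in> W I" "height I (\<kappa> - scale k (root i)) = par_ht I (x (\<kappa> - scale k (root i)))"
    using height_attained by blast
  have xk: "par_ht I (x (\<kappa> - scale l (root i))) = par_ht I (x \<kappa>) - l * par_ht I (x (root i))" for l
    unfolding scale_def by (simp only: weyl_diff[OF x(1)] weyl_scale[OF x(1)] par_ht_diff par_ht_scale)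
  have nz: "par_ht I (x (root i)) \<noteq> 0"
    using par_ht_W_root[OF x(1) assms(1)] ht_root_nz[OF x(1)] card_W_pos[of I] by simp
  show ?thesis
  proof (cases "par_ht I (x (root i)) > 0")
    case True
    then have "0 < k * par_ht I (x (root i))" using assms by simp
    then show ?thesis using x(2) xk[of k] par_ht_le_height[OF x(1), of \<kappa>] by linarith
  next
    case False
    then have neg: "(\<kappa> i - k) * par_ht I (x (root i)) < 0" using nz assms by (simp add: mult_pos_neg)
    have "par_ht I (x (s i \<kappa>)) \<le> height I \<kappa>"
      using par_ht_le_height[OF W_comp_s[OF x(1) assms(1)], of \<kappa>] by simp
    then have "par_ht I (x \<kappa>) - \<kappa> i * par_ht I (x (root i)) \<le> height I \<kappa>" using xk[of "\<kappa> i"] by (simp add: s_scale)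
    then show ?thesis using neg x(2) xk[of k] by (simp add: left_diff_distrib)
  qed
qed

lemma height_string': assumes "i \<in> I" "0 < k" "k < - \<kappa> i"
  shows "height I (\<kappa> + scale k (root i)) < height I \<kappa>"
proof -
  have si: "s i \<kappa> i = - \<kappa> i" by (simp add: sref_def C_diag)
  have "s i \<kappa> - scale (- \<kappa> i - k) (root i) = \<kappa> + scale k (root i)"
    by (simp add: s_scale scale_simps)
  moreover have "height I (s i \<kappa> - scale (- \<kappa> i - k) (root i)) < height I (s i \<kappa>)"
    using assms si by (intro height_string) auto
  ultimately show ?thesis using height_W[OF sref_in_weyl[OF assms(1)]] by metis
qed

text \<open>Inside one orbit the order is by decreasing length of the minimal representative, because
  multiplication by an orbit sum produces longer representatives.\<close>

definition prec :: "'n set \<Rightarrow> 'n weight \<Rightarrow> 'n weight \<Rightarrow> bool" where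
  "prec I \<kappa> \<nu> \<longleftrightarrow> height I \<kappa> < height I \<nu> \<or> height I \<kappa> = height I \<nu> \<and> len (min_elt I \<nu>) < len (min_elt I \<kappa>)"

text \<open>Greater length counts as smaller, so the second component is well-founded only because
  the finite group bounds the lengths by \<open>M\<close>.\<close>

lemma wf_prec: "wf {(\<kappa>, \<nu>). prec I \<kappa> \<nu>}"
proof -
  define M where "M = Max (len ` W I)"
  have le: "len (min_elt I \<nu>) \<le> M" for \<nu>
    unfolding M_def using finite_W_sub min_elt_props(1) by (intro Max_ge) auto
  have "nat (height I \<kappa>) < nat (height I \<nu>)" if "height I \<kappa> < height I \<nu>" for \<kappa> \<nu>
    using that height_nonneg[of I \<kappa>] by simp
  then have "{(\<kappa>, \<nu>). prec I \<kappa> \<nu>} \<subseteq>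
      inv_image (less_than <*lex*> less_than) (\<lambda>\<nu>. (nat (height I \<nu>), M - len (min_elt I \<nu>)))"
    by (auto simp: prec_def intro!: diff_less_mono2 intro: order.strict_trans2[OF _ le])
  then show ?thesis by (rule wf_subset[rotated]) auto
qed

lemma prec_trans: "prec I \<kappa> \<nu> \<Longrightarrow> prec I \<nu> \<mu> \<Longrightarrow> prec I \<kappa> \<mu>"
  by (auto simp: prec_def)

lemma prec_irrefl: "\<not> prec I \<kappa> \<kappa>"
  by (simp add: prec_def)

definition lead :: "'n set \<Rightarrow> 'n weight \<Rightarrow> ('n, 'a::field) laurent \<Rightarrow> bool" where
  "lead I \<nu> f \<longleftrightarrow> keys (f - expw \<nu>) \<subseteq> {\<kappa>. prec I \<kappa> \<nu>}"

text \<open>The sum runs over the set of orbit weights and not over the group, so nontrivial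
  stabilizers cause no multiplicities and every coefficient is 1 in any characteristic.\<close>

definition orbit_sum :: "'n set \<Rightarrow> 'n \<Rightarrow> ('n, 'a::field) laurent" where
  "orbit_sum I i = (\<Sum>\<kappa>\<in>(\<lambda>w. w (fund_weight i)) ` W I. expw \<kappa>)"

lemma fund_dominant: "dominant I (fund_weight i)"
  by (simp add: dominant_def fund_weight_def)

text \<open>Adding a dominant weight keeps the coordinates at the descents of the minimal
  representative positive, so by \<open>dom_rep_min_elt_eqI\<close> the same group element remains
  the minimal representative.\<close>

lemma shift_props:
  assumes "dominant I \<mu>"
  shows "dom_rep I (\<nu> + min_elt I \<nu> \<mu>) = dom_rep I \<nu> + \<mu>" "min_elt I (\<nu> + min_elt I \<nu> \<mu>) = min_elt I \<nu>"
proof -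
  have e: "\<nu> + min_elt I \<nu> \<mu> = min_elt I \<nu> (dom_rep I \<nu> + \<mu>)"
    by (simp only: weyl_add[OF min_elt_props(1)] min_elt_props(2))
  have d: "dominant I (dom_rep I \<nu> + \<mu>)" using assms dom_rep_props(1)[of I \<nu>] by (simp add: dominant_def)
  have p: "0 < (dom_rep I \<nu> + \<mu>) i" if "i \<in> descent C (min_elt I \<nu>)" for i
    using min_elt_descent[OF that] assms descent_sub[OF min_elt_props(1)] that by (fastforce simp: dominant_def)
  show "dom_rep I (\<nu> + min_elt I \<nu> \<mu>) = dom_rep I \<nu> + \<mu>" "min_elt I (\<nu> + min_elt I \<nu> \<mu>) = min_elt I \<nu>"
    unfolding e using dom_rep_min_elt_eqI[OF min_elt_props(1) d p] by blast+
qed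

lemma height_shift: "dominant I \<mu> \<Longrightarrow> height I (\<nu> + min_elt I \<nu> \<mu>) = height I \<nu> + par_ht I \<mu>"
  by (simp only: height_def shift_props par_ht_add)

lemma prec_shift: "dominant I \<mu> \<Longrightarrow> prec I \<kappa> \<nu> \<Longrightarrow> prec I (\<kappa> + min_elt I \<kappa> \<mu>) (\<nu> + min_elt I \<nu> \<mu>)"
  by (auto simp: prec_def height_shift shift_props)

text \<open>Moving the sum back to its dominant representative by \<open>?y\<close> splits its
  height into two \<open>par_ht\<close> values, each bounded by the value at \<open>?x\<close> or at
  \<open>\<mu>\<close>. If the height does not drop, both bounds are equalities, so
  \<open>?v\<close> sends \<open>?x\<close> to \<open>\<nu>\<close> and \<open>\<mu>\<close> to
  \<open>u \<mu>\<close>. Then \<open>?v\<close> is either the shortest element over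
  \<open>\<nu>\<close>, which is the expected leading term, or strictly longer, hence smaller in the
  order.\<close>

lemma orbit_term:
  assumes u: "u \<in> W I" and \<mu>: "dominant I \<mu>"
  shows "\<nu> + u \<mu> = \<nu> + min_elt I \<nu> \<mu> \<or> prec I (\<nu> + u \<mu>) (\<nu> + min_elt I \<nu> \<mu>)"
proof -
  let ?w = "min_elt I \<nu>" and ?x = "dom_rep I \<nu>" and ?\<kappa> = "\<nu> + u \<mu>"
  let ?v = "min_elt I ?\<kappa>"
  let ?y = "inv ?v"
  have w: "?w \<in> W I" "?v \<in> W I" "?y \<in> W I" using min_elt_props(1) W_inv by blast+
  have d: "dominant I ?x" by (rule dom_rep_props)
  have yk: "?y ?\<kappa> = dom_rep I ?\<kappa>" using min_elt_props(2)[of I ?\<kappa>] W_inv_apply(1)[OF w(2)] by metis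
  have yw: "?y \<circ> ?w \<in> W I" "?y \<circ> u \<in> W I" using w u weyl_comp by blast+
  have "?y ?\<kappa> = (?y \<circ> ?w) ?x + (?y \<circ> u) \<mu>"
    by (simp only: weyl_add[OF w(3)] comp_apply min_elt_props(2))
  then have eq: "height I ?\<kappa> = par_ht I ((?y \<circ> ?w) ?x) + par_ht I ((?y \<circ> u) \<mu>)"
    unfolding height_def yk[symmetric] by (simp only: par_ht_add)
  have H': "height I (\<nu> + ?w \<mu>) = par_ht I ?x + par_ht I \<mu>" using height_shift[OF \<mu>, of \<nu>] by (simp add: height_def)
  note le = par_ht_dominant(1)[OF yw(1) d] par_ht_dominant(1)[OF yw(2) \<mu>]
  show ?thesis
  proof (cases "height I ?\<kappa> < height I (\<nu> + ?w \<mu>)")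
    case True
    then show ?thesis by (simp add: prec_def)
  next
    case False
    then have e: "par_ht I ((?y \<circ> ?w) ?x) = par_ht I ?x" "par_ht I ((?y \<circ> u) \<mu>) = par_ht I \<mu>"
      using eq H' le by linarith+
    then have f: "(?y \<circ> ?w) ?x = ?x" "(?y \<circ> u) \<mu> = \<mu>"
      using par_ht_dominant(2)[OF yw(1) d] par_ht_dominant(2)[OF yw(2) \<mu>] by fastforce+
    have vx: "?v ?x = ?w ?x" "?v \<mu> = u \<mu>"
      using f W_inv_apply(2)[OF w(2)] by (metis comp_apply)+
    show ?thesis
    proof (cases "?v = ?w")
      case True
      then show ?thesis using vx by simp
    next
      case False
      then have "len ?w < len ?v"
        using min_rep(2)[OF w(1) d min_elt_descent w(2) vx(1)] by blast
      moreover have "height I ?\<kappa> = height I (\<nu> + ?w \<mu>)" using eq H' e by linarith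
      ultimately show ?thesis using shift_props(2)[OF \<mu>, of \<nu>] by (simp add: prec_def)
    qed
  qed
qed

lemma lead_orbit_sum:
  assumes "lead I \<nu> (f :: ('n, 'a::field) laurent)"
  shows "lead I (\<nu> + min_elt I \<nu> (fund_weight i)) (orbit_sum I i * f)"
proof -
  let ?\<mu> = "fund_weight i" and ?O = "(\<lambda>w. w (fund_weight i)) ` W I"
  let ?\<nu>' = "\<nu> + min_elt I \<nu> ?\<mu>"
  have fin: "finite ?O" using finite_W_sub by simp
  have mem: "min_elt I \<nu> ?\<mu> \<in> ?O" using min_elt_props(1) by blast
  have "orbit_sum I i * expw \<nu> - expw ?\<nu>' = (\<Sum>\<kappa>\<in>?O - {min_elt I \<nu> ?\<mu>}. expw (\<nu> + \<kappa>) :: ('n, 'a) laurent)"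
    unfolding orbit_sum_def sum_distrib_right sum.remove[OF fin mem, of "\<lambda>\<kappa>. expw \<kappa> * expw \<nu>"]
    by (simp only: expw_mult add.commute[of _ \<nu>]) simp
  then have k1: "keys (orbit_sum I i * expw \<nu> - expw ?\<nu>' :: ('n, 'a) laurent) \<subseteq> {\<kappa>. prec I \<kappa> ?\<nu>'}"
    using keys_sum_expw[of "\<lambda>\<kappa>. \<nu> + \<kappa>" "?O - {min_elt I \<nu> ?\<mu>}"] orbit_term[OF _ fund_dominant, of _ I \<nu> i]
    by (auto simp del: plus_fun_apply)
  have k2: "keys (orbit_sum I i * (f - expw \<nu>)) \<subseteq> {\<kappa>. prec I \<kappa> ?\<nu>'}"
  proof
    fix k assume "k \<in> keys (orbit_sum I i * (f - expw \<nu>))"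
    then obtain a b where ab: "a \<in> keys (orbit_sum I i :: ('n, 'a) laurent)" "b \<in> keys (f - expw \<nu>)" "k = a + b"
      using keys_mult by blast
    then obtain u where u: "u \<in> W I" "a = u ?\<mu>"
      using keys_sum_expw[of "\<lambda>\<kappa>. \<kappa>" ?O] by (auto simp: orbit_sum_def)
    have "prec I b \<nu>" using ab assms by (auto simp: lead_def)
    then have p: "prec I (b + min_elt I b ?\<mu>) ?\<nu>'" using prec_shift[OF fund_dominant] by blast
    have "k = b + u ?\<mu>" using ab u by (simp only: add.commute)
    then show "k \<in> {\<kappa>. prec I \<kappa> ?\<nu>'}"
      using orbit_term[OF u(1) fund_dominant, of b i] p prec_trans by (metis mem_Collect_eq)
  qed
  have eq: "orbit_sum I i * f - expw ?\<nu>' = (orbit_sum I i * expw \<nu> - expw ?\<nu>') + orbit_sum I i * (f - expw \<nu>)"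
    by (simp only: right_diff_distrib) simp
  show ?thesis unfolding lead_def eq
    by (intro order_trans[OF keys_add] Un_least k1 k2)
qed

lemma lead_orbit_sum_power: "lead I \<nu> f \<Longrightarrow> lead I (\<nu> + min_elt I \<nu> (scale (int n) (fund_weight i))) (orbit_sum I i ^ n * f)"
proof (induction n)
  case 0
  have "\<nu> + min_elt I \<nu> (scale (int 0) (fund_weight i)) = \<nu>"
    by (simp only: of_nat_0 scale_simps weyl_zero[OF min_elt_props(1)] add_0_right)
  then show ?case using 0 by (simp only: power_0 mult_1)
next
  case (Suc n)
  let ?\<mu> = "scale (int n) (fund_weight i)"
  have d: "dominant I ?\<mu>" using fund_dominant[of I i] by (simp add: dominant_def scale_def)
  have "lead I (\<nu> + min_elt I \<nu> ?\<mu> + min_elt I (\<nu> + min_elt I \<nu> ?\<mu>) (fund_weight i)) (orbit_sum I i * (orbit_sum I i ^ n * f))"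
    by (rule lead_orbit_sum) (rule Suc.IH[OF Suc.prems])
  moreover have "\<nu> + min_elt I \<nu> ?\<mu> + min_elt I \<nu> (fund_weight i) = \<nu> + min_elt I \<nu> (scale (int (Suc n)) (fund_weight i))"
    by (simp only: of_nat_Suc scale_simps weyl_add[OF min_elt_props(1)] ac_simps)
  ultimately show ?case by (simp only: shift_props[OF d] power_Suc mult.assoc)
qed

lemma W_fix: "w \<in> W I \<Longrightarrow> (\<And>i. i \<in> I \<Longrightarrow> \<mu> i = 0) \<Longrightarrow> w \<mu> = \<mu>"
proof (induction rule: weyl_induct)
  case id
  show ?case by simp
next
  case (step w i)
  then show ?case by (simp add: s_fix)
qed

lemma lead_expw_fixed:
  assumes "\<And>i. i \<in> I \<Longrightarrow> \<mu> i = 0" "lead I \<nu> f"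
  shows "lead I (\<nu> + min_elt I \<nu> \<mu>) (expw \<mu> * f)"
proof -
  have fx: "min_elt I \<kappa> \<mu> = \<mu>" for \<kappa> using W_fix[OF min_elt_props(1)] assms(1) by blast
  have d: "dominant I \<mu>" using assms(1) by (simp add: dominant_def)
  have "keys (expw \<mu> * (f - expw \<nu>)) \<subseteq> {\<kappa>. prec I \<kappa> (\<nu> + \<mu>)}"
  proof
    fix k assume "k \<in> keys (expw \<mu> * (f - expw \<nu>))"
    then obtain b where "b \<in> keys (f - expw \<nu>)" "k = \<mu> + b"
      using keys_mult[of "expw \<mu>" "f - expw \<nu>"] by (auto simp: keys_expw)
    then have "prec I b \<nu>" "k = b + \<mu>" using assms(2) by (auto simp: lead_def add.commute)
    then show "k \<in> {\<kappa>. prec I \<kappa> (\<nu> + \<mu>)}" using prec_shift[OF d, of b \<nu>] fx by simp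
  qed
  then show ?thesis unfolding lead_def fx
    by (simp only: right_diff_distrib expw_mult add.commute[of \<mu>])
qed

text \<open>For i outside I the weight of index i is invariant, and its exponential, which is
  invertible, takes the place of the orbit sum.\<close>

definition mon :: "'n set \<Rightarrow> 'n weight \<Rightarrow> ('n, 'a::field) laurent" where
  "mon I \<mu> = expw (\<lambda>i. if i \<in> I then 0 else \<mu> i) * (\<Prod>i\<in>I. orbit_sum I i ^ nat (\<mu> i))"

text \<open>The factors are multiplied in one index at a time. By \<open>shift_props\<close> the
  minimal representative never changes on the way, so all the shifts are made by the same group
  element and add up to the shift by \<open>\<mu>\<close>.\<close>

lemma lead_mon:
  assumes "dominant I \<mu>" "lead I \<nu> f"
  shows "lead I (\<nu> + min_elt I \<nu> \<mu>) (mon I \<mu> * f)"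
proof -
  have "lead I (\<nu> + min_elt I \<nu> (\<lambda>i. if i \<in> A then \<mu> i else 0)) ((\<Prod>i\<in>A. orbit_sum I i ^ nat (\<mu> i)) * f)"
    if "finite A" "A \<subseteq> I" for A
    using that
  proof (induction A rule: finite_induct)
    case empty
    have "min_elt I \<nu> (\<lambda>i. 0) = 0" using weyl_zero[OF min_elt_props(1)] by (simp add: zero_fun_def)
    then show ?case using assms(2) by simp
  next
    case (insert a A)
    let ?m = "\<lambda>i. if i \<in> A then \<mu> i else 0" and ?a = "scale (int (nat (\<mu> a))) (fund_weight a)"
    have d: "dominant I ?m" using assms(1) by (simp add: dominant_def)
    have a: "0 \<le> \<mu> a" using assms(1) insert.prems by (simp add: dominant_def)
    have "A \<subseteq> I" using insert.prems by simp
    from lead_orbit_sum_power[OF insert.IH[OF this], of "nat (\<mu> a)" a]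
    have "lead I (\<nu> + min_elt I \<nu> ?m + min_elt I (\<nu> + min_elt I \<nu> ?m) ?a)
        (orbit_sum I a ^ nat (\<mu> a) * ((\<Prod>i\<in>A. orbit_sum I i ^ nat (\<mu> i)) * f))" .
    moreover have "(\<lambda>i. if i \<in> insert a A then \<mu> i else 0) = ?m + ?a"
      using a insert.hyps by (auto simp: scale_def fund_weight_def fun_eq_iff)
    then have "\<nu> + min_elt I \<nu> ?m + min_elt I \<nu> ?a = \<nu> + min_elt I \<nu> (\<lambda>i. if i \<in> insert a A then \<mu> i else 0)"
      by (simp only: weyl_add[OF min_elt_props(1)] add.assoc)
    ultimately show ?case
      by (simp only: shift_props[OF d] prod.insert[OF insert.hyps] mult.assoc)
  qed
  from this[of I] have l: "lead I (\<nu> + min_elt I \<nu> (\<lambda>i. if i \<in> I then \<mu> i else 0)) ((\<Prod>i\<in>I. orbit_sum I i ^ nat (\<mu> i)) * f)"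
    by simp
  let ?m = "\<lambda>i. if i \<in> I then \<mu> i else 0" and ?r = "\<lambda>i. if i \<in> I then 0 else \<mu> i"
  have d: "dominant I ?m" using assms(1) by (simp add: dominant_def)
  have "\<nu> + min_elt I \<nu> ?m + min_elt I (\<nu> + min_elt I \<nu> ?m) ?r = \<nu> + (min_elt I \<nu> ?m + min_elt I \<nu> ?r)"
    by (simp only: shift_props[OF d] add.assoc)
  also have "min_elt I \<nu> ?m + min_elt I \<nu> ?r = min_elt I \<nu> (?m + ?r)" by (simp only: weyl_add[OF min_elt_props(1)])
  also have "?m + ?r = \<mu>" by (auto simp: fun_eq_iff)
  finally have e: "\<nu> + min_elt I \<nu> ?m + min_elt I (\<nu> + min_elt I \<nu> ?m) ?r = \<nu> + min_elt I \<nu> \<mu>" .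
  have "lead I (\<nu> + min_elt I \<nu> ?m + min_elt I (\<nu> + min_elt I \<nu> ?m) ?r) (expw ?r * ((\<Prod>i\<in>I. orbit_sum I i ^ nat (\<mu> i)) * f))"
    by (rule lead_expw_fixed[OF _ l]) simp
  then show ?thesis unfolding e mon_def by (simp only: mult.assoc)
qed

lemma wact_one: "wact (s i) 1 = (1 :: ('n, 'a::field) laurent)"
  unfolding expw_0[symmetric] wact_expw weyl_zero[OF sref_in_weyl[of i UNIV C, OF UNIV_I]] ..

lemma wact_power: "wact (s i) (f ^ n) = wact (s i) f ^ n"
  by (induction n) (simp_all add: wact_one wact_s_mult)

lemma wact_prod: "wact (s i) (prod f A) = (\<Prod>x\<in>A. wact (s i) (f x))"
  by (induction A rule: infinite_finite_induct) (simp_all add: wact_one wact_s_mult)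

lemma wact_orbit_sum:
  assumes "i \<in> I"
  shows "wact (s i) (orbit_sum I j) = (orbit_sum I j :: ('n, 'a::field) laurent)"
proof -
  let ?O = "(\<lambda>w. w (fund_weight j)) ` W I"
  have "bij_betw (s i) ?O ?O"
    using W_s_comp[OF _ assms]
    by (intro bij_betw_byWitness[of _ "s i"]) (auto simp: image_iff, (metis comp_apply)+)
  then have "(\<Sum>\<kappa>\<in>?O. expw (s i \<kappa>)) = (\<Sum>\<kappa>\<in>?O. expw \<kappa> :: ('n, 'a) laurent)"
    by (rule sum.reindex_bij_betw)
  then show ?thesis by (simp only: orbit_sum_def lin_sum[OF lin_wact] wact_expw)
qed

lemma wact_mon: "i \<in> I \<Longrightarrow> wact (s i) (mon I \<mu>) = mon I \<mu>"
  by (simp add: mon_def wact_s_mult wact_prod wact_power wact_orbit_sum wact_expw s_fix)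

text \<open>The excess of the dominant representative over the weight of the descent set becomes the
  exponent of the monomial, which makes \<open>\<nu>\<close> the leading exponent. The family
  \<open>b\<close> is a parameter because the construction serves both the rank two argument and the
  coinvariant basis.\<close>

definition lead_family :: "('n weyl_elt \<Rightarrow> ('n, 'a::field) laurent) \<Rightarrow> 'n set \<Rightarrow> 'n weight \<Rightarrow> ('n, 'a) laurent" where
  "lead_family b I \<nu> = mon I (dom_rep I \<nu> - weight_of_set (descent C (min_elt I \<nu>))) * b (min_elt I \<nu>)"

lemma descent_weight:
  assumes "w \<in> W I"
  shows "dom_rep I (w (weight_of_set (descent C w))) = weight_of_set (descent C w)"
    "min_elt I (w (weight_of_set (descent C w))) = w"
  using dom_rep_min_elt_eqI[OF assms, of "weight_of_set (descent C w)"]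
  by (auto simp: weight_of_set_def dominant_def)

lemma lead_lead_family:
  assumes b: "\<And>w. w \<in> W I \<Longrightarrow> lead I (w (weight_of_set (descent C w))) (b w)"
  shows "lead I \<nu> (lead_family b I \<nu>)"
proof -
  let ?w = "min_elt I \<nu>"
  let ?d = "weight_of_set (descent C ?w)"
  let ?\<mu> = "dom_rep I \<nu> - ?d"
  have w: "?w \<in> W I" by (rule min_elt_props)
  have "dominant I ?\<mu>"
    using dom_rep_props(1)[of I \<nu>] min_elt_descent[of _ I \<nu>] by (force simp: dominant_def weight_of_set_def)
  from lead_mon[OF this b[OF w]] have "lead I (?w ?d + ?w ?\<mu>) (mon I ?\<mu> * b ?w)"
    by (simp only: descent_weight[OF w])
  moreover have "?w ?d + ?w ?\<mu> = \<nu>"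
    by (simp only: weyl_add[OF w, symmetric]) (simp add: min_elt_props(2))
  ultimately show ?thesis by (simp add: lead_family_def)
qed

text \<open>Well-founded induction on the order: the exponential of \<open>\<nu>\<close> is
  \<open>B \<nu>\<close> minus a combination of exponentials of smaller weights. The span is
  expressed through a predicate \<open>P\<close> closed under linear combinations, so that each use
  can choose its own property.\<close>

lemma lead_span:
  assumes lead: "\<And>\<nu>. lead I \<nu> (B \<nu>)" and B: "\<And>\<nu>. P (B \<nu>)"
    and add: "\<And>f g. P f \<Longrightarrow> P g \<Longrightarrow> P (f + g)" and smult: "\<And>c f. P f \<Longrightarrow> P (smult c f)"
  shows "P (f :: ('n, 'a::field) laurent)"
proof -
  have zero: "P 0" using smult[OF B, of 0] by simp
  have sum: "(\<And>x. x \<in> A \<Longrightarrow> P (g x)) \<Longrightarrow> P (sum g A)" for g :: "'n weight \<Rightarrow> ('n, 'a) laurent" and A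
    by (induction A rule: infinite_finite_induct) (auto intro: zero add)
  have "P (expw \<nu>)" for \<nu>
  proof (induction \<nu> rule: wf_induct[OF wf_prec[of I]])
    case (1 \<nu>)
    have "P (B \<nu> - expw \<nu>)"
    proof (subst laurent_expand, rule sum, rule smult)
      fix k assume "k \<in> keys (B \<nu> - expw \<nu>)"
      then show "P (expw k)" using 1 lead[of \<nu>] by (auto simp: lead_def)
    qed
    then have "P (B \<nu> + smult (- 1) (B \<nu> - expw \<nu>))" by (intro add smult B)
    then show ?case by (simp add: smult_minus_left)
  qed
  then show ?thesis by (subst laurent_expand) (intro sum smult)
qed

section \<open>Leading terms of the operators pibar along reduced words\<close>

lemma keys_pib_expw:
  assumes "i \<in> I"
  shows "keys (pib i (expw \<kappa> :: ('n, 'a::field) laurent)) \<subseteq> {\<kappa>'. height I \<kappa>' \<le> height I \<kappa>}"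
proof (cases "0 \<le> \<kappa> i")
  case nn: True
  have "height I (\<kappa> - scale (int k) (root i)) \<le> height I \<kappa>" if "k \<in> {1..nat (\<kappa> i)}" for k
  proof (cases "int k = \<kappa> i")
    case True
    then show ?thesis using height_W[OF sref_in_weyl[OF assms], of \<kappa>] by (simp add: s_scale)
  next
    case False
    then have "int k < \<kappa> i" using that nn by (auto simp: le_nat_iff)
    then show ?thesis using height_string[OF assms, of "int k" \<kappa>] that by auto
  qed
  then show ?thesis
    unfolding pib_expw_nonneg[of \<kappa> i, OF nn] using keys_sum_expw[of "\<lambda>k. \<kappa> - scale (int k) (root i)"] by fastforce
next
  case False
  have "height I (\<kappa> + scale (int k) (root i)) \<le> height I \<kappa>" if "k < nat (- \<kappa> i)" for k
  proof (cases "k = 0")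
    case True
    then show ?thesis by (simp add: scale_simps)
  next
    case k: False
    have "int k < - \<kappa> i" using that False by linarith
    then show ?thesis using height_string'[OF assms, of "int k" \<kappa>] k by auto
  qed
  then show ?thesis
    using pib_expw_neg[of \<kappa> i, where 'a = 'a] False
      keys_sum_expw[of "\<lambda>k. \<kappa> + scale (int k) (root i)" "{..<nat (- \<kappa> i)}", where 'a = 'a] by fastforce
qed

lemma keys_pib_low:
  assumes "i \<in> I" "keys (f :: ('n, 'a::field) laurent) \<subseteq> {\<kappa>. height I \<kappa> < c}"
  shows "keys (pib i f) \<subseteq> {\<kappa>. height I \<kappa> < c}"
proof
  fix k assume k: "k \<in> keys (pib i f)"
  have "keys (\<Sum>\<mu>\<in>keys f. smult (lookup f \<mu>) (pib i (expw \<mu>))) \<subseteq> (\<Union>\<mu>\<in>keys f. keys (pib i (expw \<mu>) :: ('n, 'a) laurent))"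
    using keys_smult keys_sum_sub by fastforce
  then obtain \<mu> where "\<mu> \<in> keys f" "k \<in> keys (pib i (expw \<mu>) :: ('n, 'a) laurent)"
    using k lin_expand[OF lin_pib, of i f] by auto
  then show "k \<in> {\<kappa>. height I \<kappa> < c}" using keys_pib_expw[OF assms(1), of \<mu>] assms(2) by fastforce
qed

lemma keys_pib_lead:
  assumes "i \<in> I" "0 < \<kappa> i"
  shows "keys (pib i (expw \<kappa>) - expw (s i \<kappa>) :: ('n, 'a::field) laurent) \<subseteq> {\<kappa>'. height I \<kappa>' < height I \<kappa>}"
proof -
  have split: "{1..nat (\<kappa> i)} = insert (nat (\<kappa> i)) {1..<nat (\<kappa> i)}" using assms by auto
  have "pib i (expw \<kappa>) - expw (s i \<kappa>) = (\<Sum>k\<in>{1..<nat (\<kappa> i)}. expw (\<kappa> - scale (int k) (root i)) :: ('n, 'a) laurent)"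
    using assms by (subst pib_expw_nonneg) (simp, subst split, simp add: s_scale)
  then show ?thesis
    using keys_sum_expw[of "\<lambda>k. \<kappa> - scale (int k) (root i)" "{1..<nat (\<kappa> i)}", where 'a = 'a]
      height_string[OF assms(1), of _ \<kappa>] by fastforce
qed

lemma descent_mono:
  assumes "u \<in> W UNIV" "len (s i \<circ> u) = Suc (len u)"
  shows "descent C u \<subseteq> descent C (s i \<circ> u)"
proof
  fix j assume "j \<in> descent C u"
  then have l: "len (u \<circ> s j) < len u" by (simp add: descent_def)
  have "len (s i) \<le> 1" using len_le[of "[i]"] by simp
  then have "len (s i \<circ> (u \<circ> s j)) \<le> Suc (len (u \<circ> s j))"
    using len_comp_le[OF sref_in_weyl[of i UNIV C] W_comp_s[OF assms(1), of j]] by simp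
  then show "j \<in> descent C (s i \<circ> u)" using l assms(2) by (simp add: descent_def comp_assoc)
qed

lemma red_Cons:
  assumes "length (i # is) = len (wd (i # is))"
  shows "length is = len (wd is)" "len (s i \<circ> wd is) = Suc (len (wd is))"
proof -
  have W: "wd is \<in> W UNIV" by (auto simp: weyl_iff_word)
  have "len (wd is) \<le> length is" by (rule len_le)
  moreover have "len (s i \<circ> wd is) \<le> Suc (len (wd is))"
    using len_comp_le[OF sref_in_weyl[of i UNIV C] W] len_le[of "[i]"] by simp
  ultimately show "length is = len (wd is)" "len (s i \<circ> wd is) = Suc (len (wd is))"
    using assms by auto
qed

text \<open>For a new left letter \<open>i\<close> the coordinate of \<open>?u x\<close> at
  \<open>i\<close> is nonnegative, because \<open>inv ?u (root i)\<close> is a positive root. It is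
  not 0, since otherwise \<open>?u\<close> and the longer \<open>s i \<circ> ?u\<close> would have
  the same image, against minimality of the latter. So the operator produces the reflected
  exponential plus terms of smaller height. The remaining terms are kept at strictly smaller height,
  a property that further operators preserve.\<close>

lemma pib_word_lead:
  assumes "set is \<subseteq> I" "length is = len (wd is)" "dominant I x"
    "\<And>i. i \<in> descent C (wd is) \<Longrightarrow> 0 < x i"
  shows "keys (op_word pib is (expw x) - expw (wd is x) :: ('n, 'a::field) laurent) \<subseteq> {\<kappa>. height I \<kappa> < height I x}"
  using assms
proof (induction "is")
  case Nil
  show ?case by simp
next
  case (Cons i "is")
  let ?u = "wd is"
  have u: "?u \<in> W I" "i \<in> I" using Cons.prems(1) by (auto simp: weyl_iff_word)
  have r: "length is = len ?u" "len (s i \<circ> ?u) = Suc (len ?u)" using red_Cons[OF Cons.prems(2)] .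
  have desc: "descent C ?u \<subseteq> descent C (s i \<circ> ?u)" using descent_mono[OF W_sub[OF u(1)] r(2)] .
  have ih: "keys (op_word pib is (expw x) - expw (?u x) :: ('n, 'a) laurent) \<subseteq> {\<kappa>. height I \<kappa> < height I x}"
  proof (rule Cons.IH[OF _ r(1) Cons.prems(3)])
    show "set is \<subseteq> I" using Cons.prems(1) by simp
    fix j assume "j \<in> descent C ?u"
    then show "0 < x j" using desc Cons.prems(4) unfolding word_elt_Cons by blast
  qed
  have iu: "inv ?u \<in> W I" using u W_inv by blast
  have "ht (inv ?u (root i)) > 0"
    using len_s_comp_cases[OF W_sub[OF u(1)], of i] r(2) by (metis Suc_n_not_le_n less_imp_le_nat)
  then have "0 \<le> bil x (inv ?u (root i))" using dominant_bil_nonneg[OF Cons.prems(3) iu u(2)] by blast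
  also have "bil x (inv ?u (root i)) = bil (?u x) (root i)"
    using bil_inv[OF u(1), of x "inv ?u (root i)"] u(1) by simp
  finally have "0 \<le> ?u x i * q i" using bil_root[of "?u x" i] by simp
  then have nn: "0 \<le> ?u x i" using q_pos[of i] by (simp add: zero_le_mult_iff)
  have "?u x i \<noteq> 0"
  proof
    assume "?u x i = 0"
    then have "?u x = (s i \<circ> ?u) x" by (simp add: s_fix)
    moreover have "0 < x j" if "j \<in> descent C (s i \<circ> ?u)" for j
      using Cons.prems(4) that unfolding word_elt_Cons by blast
    ultimately have "len (s i \<circ> ?u) \<le> len ?u"
      using min_rep(1)[OF W_s_comp[OF u(1,2)] Cons.prems(3) _ u(1)] by blast
    then show False using r by simp
  qed
  then have pos: "0 < ?u x i" using nn by simp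
  have e: "op_word pib (i # is) (expw x) - expw (wd (i # is) x)
     = (pib i (expw (?u x)) - expw (s i (?u x))) + pib i (op_word pib is (expw x) - expw (?u x) :: ('n, 'a) laurent)"
    by (simp add: lin_diff[OF lin_pib])
  have 1: "keys (pib i (expw (?u x)) - expw (s i (?u x)) :: ('n, 'a) laurent) \<subseteq> {\<kappa>. height I \<kappa> < height I x}"
    using keys_pib_lead[of i I "?u x", OF u(2) pos, where 'a = 'a] height_W[OF u(1), of x] by simp
  have 2: "keys (pib i (op_word pib is (expw x) - expw (?u x) :: ('n, 'a) laurent)) \<subseteq> {\<kappa>. height I \<kappa> < height I x}"
    by (rule keys_pib_low[OF u(2) ih])
  show ?case unfolding e by (rule order_trans[OF keys_add Un_least[OF 1 2]])
qed

lemma pib_word_lead':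
  assumes "set is \<subseteq> I" "length is = len (wd is)"
  shows "lead I (wd is (weight_of_set (descent C (wd is))))
    (op_word pib is (expw (weight_of_set (descent C (wd is)))) :: ('n, 'a::field) laurent)"
proof -
  let ?d = "weight_of_set (descent C (wd is)) :: 'n weight"
  have W: "wd is \<in> W I" using assms by (auto simp: weyl_iff_word)
  have "keys (op_word pib is (expw ?d) - expw (wd is ?d) :: ('n, 'a) laurent) \<subseteq> {\<kappa>. height I \<kappa> < height I ?d}"
    using assms by (intro pib_word_lead) (auto simp: dominant_def weight_of_set_def)
  then show ?thesis unfolding lead_def prec_def height_W[OF W] by auto
qed

end

section \<open>Braid relations for the Demazure operators\<close>

context fin_cartan
begin

lemma lin_pib_word: "lin (op_word pib is)"
  by (rule lin_op_word) (rule lin_pib)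

text \<open>Positive definiteness applied to a nonzero vector in the span of the two roots.\<close>

lemma rank_two: assumes "i \<noteq> j" shows "C i j * C j i < 4"
proof -
  \<comment> \<open>These are the coordinates of twice the projection of \<open>root j\<close> onto
    the orthogonal complement of \<open>root i\<close>; only the coordinate at \<open>j\<close> then
    contributes to the norm.\<close>
  define c where "c l = (if l = j then 2 else if l = i then - C i j else 0)" for l
  have v: "rt C c l = 2 * C l j - C i j * C l i" for l
  proof -
    have "rt C c l = (\<Sum>m\<in>{i, j}. c m * C l m)"
      unfolding rt_def simple_root_def by (rule sum.mono_neutral_right) (auto simp: c_def)
    then show ?thesis using assms by (simp add: c_def)
  qed
  have "2 * bil (rt C c) (rt C c) = (\<Sum>m\<in>{i, j}. c m * rt C c m * q m)"
    unfolding bil_rt by (rule sum.mono_neutral_right) (auto simp: c_def)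
  also have "\<dots> = 2 * (4 - C i j * C j i) * q j"
    using assms by (simp add: c_def v C_diag algebra_simps)
  finally have "bil (rt C c) (rt C c) = (4 - C i j * C j i) * q j" by (simp add: algebra_simps)
  moreover have "rt C c \<noteq> 0"
  proof
    assume "rt C c = 0"
    from rt_eq_0[OF this] have "c j = 0" by simp
    then show False by (simp add: c_def)
  qed
  ultimately have "0 < (4 - C i j * C j i) * q j" using bil_pos by metis
  then show ?thesis using q_pos[of j] by (simp add: zero_less_mult_iff)
qed

lemma rank_two_cases:
  assumes "i \<noteq> j"
  obtains "C i j = 0" "C j i = 0" | "C i j = -1" "C j i = -1" | "C i j = -1" "C j i = -2"
    | "C i j = -2" "C j i = -1" | "C i j = -1" "C j i = -3" | "C i j = -3" "C j i = -1"
proof -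
  define a b where "a = nat (- C i j)" and "b = nat (- C j i)"
  have ab: "C i j = - int a" "C j i = - int b"
    using C_neg[OF assms] C_neg[OF assms[symmetric]] by (auto simp: a_def b_def)
  then have "int (a * b) < 4" using rank_two[OF assms] by simp
  then have lt: "a * b < 4" by linarith
  have z: "a = 0 \<longleftrightarrow> b = 0" using C_zero[of i j] ab by simp
  have "a < 4 \<and> b < 4" using lt z by (cases a; cases b) (auto simp: algebra_simps)
  then have "a \<in> {0,1,2,3}" "b \<in> {0,1,2,3}" by auto
  then show ?thesis using that lt z ab by auto
qed

text \<open>The weights reachable from a fundamental weight inside a rank two parabolic, with
  integer coordinates \<open>p\<close> and \<open>r\<close>. Reflections and operators become
  arithmetic on these two numbers, and \<open>wt_inj\<close> decides equality of weights.\<close>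

definition wt :: "'n \<Rightarrow> 'n \<Rightarrow> int \<Rightarrow> int \<Rightarrow> 'n weight" where
  "wt i j p r = fund_weight i - scale p (root i) - scale r (root j)"

lemma wt_coord:
  assumes "i \<noteq> j"
  shows "wt i j p r i = 1 - 2 * p - r * C i j" "wt i j p r j = - p * C j i - 2 * r"
  using assms by (simp_all add: wt_def fund_weight_def scale_def simple_root_def C_diag)

lemma wt_step: "wt i j p r - scale k (root i) = wt i j (p + k) r" "wt i j p r - scale k (root j) = wt i j p (r + k)"
  by (simp_all add: wt_def scale_simps)

lemma wt_inj: assumes "i \<noteq> j" "wt i j p r = wt i j p' r'" shows "p = p' \<and> r = r'"
proof -
  have e: "wt i j x y = fund_weight i - rt C (\<lambda>l. (if l = i then x else 0) + (if l = j then y else 0))" for x y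
    by (simp only: rt_add rt_single wt_def scale_def diff_diff_eq)
  have "rt C (\<lambda>l. (if l = i then p else 0) + (if l = j then r else 0))
      = rt C (\<lambda>l. (if l = i then p' else 0) + (if l = j then r' else 0))"
    using assms(2) unfolding e by simp
  from rt_inj[OF this] show ?thesis using assms(1) by (auto simp: fun_eq_iff split: if_splits)
qed

lemma s_wt:
  assumes "i \<noteq> j"
  shows "s i (wt i j p r) = wt i j (1 - p - r * C i j) r" "s j (wt i j p r) = wt i j p (- r - p * C j i)"
  by (simp_all only: s_scale wt_step wt_coord[OF assms]) (simp_all add: algebra_simps)

lemma pib_0: "\<kappa> i = 0 \<Longrightarrow> pib i (expw \<kappa>) = 0"
  by (simp add: pib_expw_nonneg)

lemma pib_m1: "\<kappa> i = -1 \<Longrightarrow> pib i (expw \<kappa>) = - expw \<kappa>"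
  by (simp add: pib_expw_neg scale_simps)

lemma pib_1: "\<kappa> i = 1 \<Longrightarrow> pib i (expw \<kappa>) = expw (\<kappa> - scale 1 (root i))"
  by (simp add: pib_expw_nonneg)

lemma pib_2: "\<kappa> i = 2 \<Longrightarrow> pib i (expw \<kappa>) = expw (\<kappa> - scale 1 (root i)) + expw (\<kappa> - scale 2 (root i))"
  by (simp add: pib_expw_nonneg numeral_2_eq_2 atLeastAtMostSuc_conv)

lemma pib_3: "\<kappa> i = 3 \<Longrightarrow> pib i (expw \<kappa>)
    = expw (\<kappa> - scale 1 (root i)) + expw (\<kappa> - scale 2 (root i)) + expw (\<kappa> - scale 3 (root i))"
  by (simp add: pib_expw_nonneg eval_nat_numeral atLeastAtMostSuc_conv)

lemma pib_wt_i:
  assumes "i \<noteq> j"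
  shows "1 - 2 * p - r * C i j = 0 \<Longrightarrow> pib i (expw (wt i j p r)) = 0"
    "1 - 2 * p - r * C i j = -1 \<Longrightarrow> pib i (expw (wt i j p r)) = - expw (wt i j p r)"
    "1 - 2 * p - r * C i j = 1 \<Longrightarrow> pib i (expw (wt i j p r)) = expw (wt i j (p + 1) r)"
    "1 - 2 * p - r * C i j = 2 \<Longrightarrow> pib i (expw (wt i j p r)) = expw (wt i j (p + 1) r) + expw (wt i j (p + 2) r)"
    "1 - 2 * p - r * C i j = 3 \<Longrightarrow> pib i (expw (wt i j p r))
      = expw (wt i j (p + 1) r) + expw (wt i j (p + 2) r) + expw (wt i j (p + 3) r)"
  by (simp_all only: pib_0 pib_m1 pib_1 pib_2 pib_3 wt_step wt_coord[OF assms])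

lemma pib_wt_j:
  assumes "i \<noteq> j"
  shows "- p * C j i - 2 * r = 0 \<Longrightarrow> pib j (expw (wt i j p r)) = 0"
    "- p * C j i - 2 * r = -1 \<Longrightarrow> pib j (expw (wt i j p r)) = - expw (wt i j p r)"
    "- p * C j i - 2 * r = 1 \<Longrightarrow> pib j (expw (wt i j p r)) = expw (wt i j p (r + 1))"
    "- p * C j i - 2 * r = 2 \<Longrightarrow> pib j (expw (wt i j p r)) = expw (wt i j p (r + 1)) + expw (wt i j p (r + 2))"
    "- p * C j i - 2 * r = 3 \<Longrightarrow> pib j (expw (wt i j p r))
      = expw (wt i j p (r + 1)) + expw (wt i j p (r + 2)) + expw (wt i j p (r + 3))"
  by (simp_all only: pib_0 pib_m1 pib_1 pib_2 pib_3 wt_step wt_coord[OF assms])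

lemma altr_suffix: "\<exists>xs. altr i j (m + d) = xs @ altr i j m"
proof (induction m arbitrary: i j)
  case 0
  show ?case by simp
next
  case (Suc m)
  then obtain xs where "altr j i (m + d) = xs @ altr j i m" by blast
  then show ?case by simp
qed

lemma altr_suffix': "m \<le> n \<Longrightarrow> \<exists>xs. altr i j n = xs @ altr i j m"
  using altr_suffix[of i j m "n - m"] by simp

text \<open>The competing word applies \<open>s j\<close> first, which fixes the fundamental weight
  of \<open>i\<close>. Equality of the two words therefore forces the leftmost letter of
  \<open>altr i j (Suc k)\<close> to fix the weight reached by the letters before it.\<close>

lemma altr_fund: assumes "i \<noteq> j" "wd (altr i j (Suc k)) = wd (altr j i (Suc k))"
  shows "wd (altr i j (Suc k)) (fund_weight i) = wd (altr i j k) (fund_weight i)"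
proof -
  have "s j (fund_weight i) = fund_weight i" using assms(1) by (simp add: s_fix fund_weight_def)
  then show ?thesis unfolding assms(2) by simp
qed

text \<open>Equality of the two alternating words forces k to be at least the order of the product of
  the two reflections, since before that consecutive reflections always move the weight obtained
  from the fundamental weight; for k equal to this order, namely 2, 3, 4 or 6, the claim is a computation.\<close>

lemma alt_word_kills:
  assumes ij: "i \<noteq> j" and eq: "wd (altr i j k) = wd (altr j i k)" and k: "0 < k"
  shows "op_word pib (altr i j k) (expw (fund_weight i) :: ('n, 'a::field) laurent) = 0"
proof -
  have f: "fund_weight i = wt i j 0 0" by (simp add: wt_def scale_simps)
  have step: "op_word pib (altr x y (Suc n)) f = op_word pib (altr y x n) (pib x f)"
    "wd (altr x y (Suc n)) v = wd (altr y x n) (s x v)" for x y n and f :: "('n, 'a) laurent" and v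
    by simp_all
  have lin0: "pib x 0 = (0 :: ('n, 'a) laurent)" "pib x (f + g) = pib x f + pib x g"
      "pib x (- f) = - pib x f" for x and f g :: "('n, 'a) laurent"
    by (simp_all add: lin_zero[OF lin_pib] lin_add[OF lin_pib] lin_minus[OF lin_pib])
  have kill: "op_word pib (altr i j k) (expw (fund_weight i) :: ('n, 'a) laurent) = 0"
    if le: "m \<le> k" and "op_word pib (altr i j m) (expw (fund_weight i) :: ('n, 'a) laurent) = 0" for m
  proof -
    obtain xs where "altr i j k = xs @ altr i j m"
      using altr_suffix'[OF le] by blast
    then show ?thesis using that lin_zero[OF lin_pib_word] by simp
  qed
  have ne: "k \<noteq> Suc n" if "wd (altr i j (Suc n)) (fund_weight i) \<noteq> wd (altr i j n) (fund_weight i)" for n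
    using altr_fund[OF ij, of n] eq that by blast
  have inj: "wt i j p r = wt i j p' r' \<longleftrightarrow> p = p' \<and> r = r'" for p r p' r'
    using wt_inj[OF ij] by blast
  note simps = step altr.simps(1) op_word_Nil word_elt_Nil id_apply f inj s_wt[OF ij]
      pib_wt_i[OF ij] pib_wt_j[OF ij] lin0
  show ?thesis
  proof (cases rule: rank_two_cases[OF ij])
    case 1
    have "k \<noteq> Suc 0" by (rule ne) (simp add: simps 1 del: altr.simps(2))
    then have "Suc (Suc 0) \<le> k" using k by linarith
    then show ?thesis by (rule kill) (simp add: simps 1 del: altr.simps(2))
  next
    case 2
    have "k \<noteq> Suc 0" "k \<noteq> Suc (Suc 0)" by (rule ne, simp add: simps 2 del: altr.simps(2))+
    then have "Suc (Suc (Suc 0)) \<le> k" using k by linarith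
    then show ?thesis by (rule kill) (simp add: simps 2 del: altr.simps(2))
  next
    case 3
    have "k \<noteq> Suc 0" "k \<noteq> Suc (Suc 0)" "k \<noteq> Suc (Suc (Suc 0))"
      by (rule ne, simp add: simps 3 del: altr.simps(2))+
    then have "Suc (Suc (Suc (Suc 0))) \<le> k" using k by linarith
    then show ?thesis by (rule kill) (simp add: simps 3 del: altr.simps(2))
  next
    case 4
    have "k \<noteq> Suc 0" "k \<noteq> Suc (Suc 0)" "k \<noteq> Suc (Suc (Suc 0))"
      by (rule ne, simp add: simps 4 del: altr.simps(2))+
    then have "Suc (Suc (Suc (Suc 0))) \<le> k" using k by linarith
    then show ?thesis by (rule kill) (simp add: simps 4 del: altr.simps(2))
  next
    case 5
    have "k \<noteq> Suc 0" "k \<noteq> Suc (Suc 0)" "k \<noteq> Suc (Suc (Suc 0))" "k \<noteq> Suc (Suc (Suc (Suc 0)))"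
      "k \<noteq> Suc (Suc (Suc (Suc (Suc 0))))"
      by (rule ne, simp add: simps 5 del: altr.simps(2))+
    then have "Suc (Suc (Suc (Suc (Suc (Suc 0))))) \<le> k" using k by linarith
    then show ?thesis by (rule kill) (simp add: simps 5 del: altr.simps(2))
  next
    case 6
    have "k \<noteq> Suc 0" "k \<noteq> Suc (Suc 0)" "k \<noteq> Suc (Suc (Suc 0))" "k \<noteq> Suc (Suc (Suc (Suc 0)))"
      "k \<noteq> Suc (Suc (Suc (Suc (Suc 0))))"
      by (rule ne, simp add: simps 6 del: altr.simps(2))+
    then have "Suc (Suc (Suc (Suc (Suc (Suc 0))))) \<le> k" using k by linarith
    then show ?thesis by (rule kill) (simp add: simps 6 del: altr.simps(2))
  qed
qed

text \<open>Of the two possible next letters, \<open>c l\<close> prolongs the alternating word of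
  length \<open>l\<close>, while \<open>c (Suc l)\<close> repeats its front letter and only
  contributes a sign by \<open>pib_pib\<close>. In the second case one letter is absorbed, and since
  \<open>l\<close> is positive the resulting alternating word still has length at least
  \<open>k\<close>.\<close>

lemma alt_alt_kills:
  assumes "i \<noteq> j" and kills: "\<And>l. k \<le> l \<Longrightarrow> op_word pib (altr i j l) e = 0"
    and l: "0 < l" and xy: "(x, y) = (i, j) \<or> (x, y) = (j, i)" and k: "0 < k"
  shows "op_word pib (altr x y k) (op_word pib (altr i j l) e) = 0"
proof -
  let ?Z = "\<lambda>l. op_word pib (altr i j l) e"
  define c where "c l = (if even l then i else j)" for l :: nat
  have front: "altr a b (Suc l) = (if even l then a else b) # altr a b l" for a b :: 'n and l
    by (induction l arbitrary: a b) auto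
  have Z: "pib (c l) (?Z l) = ?Z (Suc l)" for l
    using front[of i j l] by (simp add: c_def del: altr.simps)
  have run: "op_word pib (altr (c l) (c (Suc l)) n) (?Z l) = ?Z (l + n)" for l n
  proof (induction n arbitrary: l)
    case 0
    show ?case by simp
  next
    case (Suc n)
    have cc: "c (Suc (Suc l)) = c l" by (simp add: c_def)
    have "op_word pib (altr (c l) (c (Suc l)) (Suc n)) (?Z l) = op_word pib (altr (c (Suc l)) (c l) n) (pib (c l) (?Z l))"
      by simp
    also have "\<dots> = op_word pib (altr (c (Suc l)) (c (Suc (Suc l))) n) (?Z (Suc l))"
      by (simp only: Z cc)
    also have "\<dots> = ?Z (Suc l + n)" by (rule Suc.IH)
    finally show ?case by (simp only: add_Suc add_Suc_right)
  qed
  have bck: "pib (c (Suc l)) (?Z l) = - ?Z l"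
  proof -
    obtain l' where l': "l = Suc l'" using l by (cases l) auto
    have "c (Suc l) = c l'" by (simp add: c_def l')
    then show ?thesis using Z[of l', symmetric] by (simp add: l' pib_pib del: altr.simps)
  qed
  have "(x, y) = (c l, c (Suc l)) \<or> (x, y) = (c (Suc l), c l)" using xy by (auto simp: c_def)
  then show ?thesis
  proof
    assume "(x, y) = (c l, c (Suc l))"
    then show ?thesis using run[of l k] kills[of "l + k"] by simp
  next
    assume xy: "(x, y) = (c (Suc l), c l)"
    obtain k' where k': "k = Suc k'" using k by (cases k) auto
    have "op_word pib (altr x y k) (?Z l) = op_word pib (altr (c l) (c (Suc l)) k') (- ?Z l)"
      using xy bck by (simp add: k')
    also have "\<dots> = - ?Z (l + k')" by (simp add: lin_minus[OF lin_pib_word] run)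
    also have "\<dots> = 0" using kills[of "l + k'"] l k' by simp
    finally show ?thesis .
  qed
qed

text \<open>As every index in \<open>I\<close> is a descent, \<open>len_par_sub\<close> shows that
  the conjugate \<open>?v\<close> of \<open>s l\<close> has length 1, so it is a simple reflection
  \<open>s c\<close> with \<open>c\<close> in \<open>I\<close>. Comparing both sides on
  \<open>?\<rho>\<close> makes \<open>w (root c)\<close> the multiple of \<open>root l\<close> by
  the coordinate in question. This multiple is 1 or -1 by \<open>root_multiple\<close>, and
  negativity of the root excludes 1.\<close>

lemma top_coord:
  assumes w: "w \<in> W I" and d: "I \<subseteq> descent C w" and l: "l \<in> I"
  shows "w (weight_of_set I) l = -1"
proof -
  let ?v = "inv w \<circ> s l \<circ> w" and ?\<rho> = "weight_of_set I :: 'n weight"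
  have v: "?v \<in> W I" using w l by (meson W_comp_s W_inv weyl_comp)
  have wv: "w \<circ> ?v = s l \<circ> w" by (rule ext) (simp add: W_inv_apply(2)[OF w])
  have n: "\<And>k. k \<in> I \<Longrightarrow> ht (w (root k)) < 0" using descent_iff[OF w] d by blast
  have "len (s l \<circ> w) + len ?v = len w" using len_par_sub[OF W_sub[OF w] n v] unfolding wv by blast
  then have "len ?v = 1"
    by (cases rule: len_s_comp_cases[OF W_sub[OF w], of l]) auto
  then obtain "is" where "wd is = ?v" "length is = 1" using red_exists[OF W_sub[OF v]] by metis
  then obtain c where "s c = ?v" by (cases "is") auto
  note c = this[symmetric]
  have "ht (s c (root c)) < 0" using q_pos[of c] by (simp add: ht_root)
  then have "c \<in> descent C ?v" using descent_iff[OF v] c by simp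
  then have cI: "c \<in> I" using descent_sub[OF v] by blast
  have "w (s c ?\<rho>) = s l (w ?\<rho>)" using wv unfolding c by (metis comp_apply)
  moreover have "?\<rho> c = 1" using cI by (simp add: weight_of_set_def)
  ultimately have "w ?\<rho> - (\<lambda>i. w (root c) i) = w ?\<rho> - (\<lambda>i. w ?\<rho> l * root l i)"
    using weyl_sref[OF w, of c ?\<rho>] by (simp only: sref_eq mult_1)
  then have e: "w (root c) = (\<lambda>i. w ?\<rho> l * root l i)" by (simp only: diff_left_imp_eq)
  have "w ?\<rho> l \<noteq> 1"
  proof
    assume "w ?\<rho> l = 1"
    then have "ht (w (root c)) = q l" using e by (simp add: ht_root)
    then show False using n[OF cI] q_pos[of l] by simp
  qed
  then show ?thesis using root_multiple[OF w e] by blast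
qed

lemma alt_top:
  assumes "\<nu> i = -1" "\<nu> j = -1"
  shows "op_word pib (altr i j k) (expw \<nu>) = smult ((- 1) ^ k) (expw \<nu>)"
  using assms
proof (induction k arbitrary: i j)
  case 0
  show ?case by simp
next
  case (Suc k)
  then show ?case
    by (simp add: pib_m1 lin_minus[OF lin_pib_word] smult_minus_left)
qed

lemma alt_one: "0 < k \<Longrightarrow> op_word pib (altr i j k) (expw 0) = 0"
  by (cases k) (simp_all add: pib_0 lin_zero[OF lin_pib_word])

lemma pib_word_mon:
  assumes "set is \<subseteq> I"
  shows "op_word pib is (mon I \<mu> * f) = mon I \<mu> * op_word pib is f"
  using assms by (induction "is") (simp_all add: pib_invariant_mult wact_mon)

lemma weight_of_set_single: "weight_of_set {i} = fund_weight i"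
  by (auto simp: weight_of_set_def fund_weight_def)

lemma weight_of_set_empty: "weight_of_set {} = (0 :: 'n weight)"
  by (auto simp: weight_of_set_def)

text \<open>Both alternating words act on the module basis of the group algebra over the dihedral
  invariants in the same way: they kill 1 and the elements coming from the two fundamental
  weights, and act by a sign on the remaining basis element.\<close>

lemma pib_braid:
  fixes i j :: 'n
  assumes ij: "i \<noteq> j" and eq: "wd (altr i j k) = wd (altr j i k)"
  shows "op_word pib (altr i j k) = (op_word pib (altr j i k) :: ('n, 'a::field) laurent \<Rightarrow> _)"
proof (cases "k = 0")
  case True
  then show ?thesis by simp
next
  case False
  then have k: "0 < k" by simp
  let ?I = "{i, j}"
  let ?X = "op_word pib (altr i j k) :: ('n, 'a) laurent \<Rightarrow> _"
  let ?Y = "op_word pib (altr j i k) :: ('n, 'a) laurent \<Rightarrow> _"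
  \<comment> \<open>Independence of the reduced word is not yet available, so \<open>b\<close> fixes
    one alternating word for each element with a single descent. For the full descent set it takes
    the bare leading exponential, which is a common eigenvector of both operators.\<close>
  define b :: "'n weyl_elt \<Rightarrow> ('n, 'a) laurent" where
    "b w = (if descent C w = {i} then op_word pib (altr i j (len w)) (expw (fund_weight i))
      else if descent C w = {j} then op_word pib (altr j i (len w)) (expw (fund_weight j))
      else expw (w (weight_of_set (descent C w))))" for w
  have sub: "set (altr i j n) \<subseteq> ?I" "set (altr j i n) \<subseteq> ?I" for n
    using set_altr[of i j n] set_altr[of j i n] by auto
  have ht: "ht (w (root l)) < 0" if "w \<in> W ?I" "descent C w = {l}" for w l
    using descent_iff[OF that(1), of l] that(2) by simp
  have wi: "w = wd (altr i j (len w))" if "w \<in> W ?I" "descent C w = {i}" for w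
    using altr_word[OF that(1) ht[OF that]] .
  have wj: "w = wd (altr j i (len w))" if "w \<in> W ?I" "descent C w = {j}" for w
    using altr_word[of w j i] that ht[OF that] by (simp add: insert_commute)
  have lead: "lead ?I (w (weight_of_set (descent C w))) (b w)" if w: "w \<in> W ?I" for w
  proof -
    consider "descent C w = {i}" | "descent C w = {j}" | "descent C w \<noteq> {i}" "descent C w \<noteq> {j}" by blast
    then show ?thesis
    proof cases
      case 1
      note e = wi[OF w 1]
      have "lead ?I (wd (altr i j (len w)) (weight_of_set (descent C (wd (altr i j (len w))))))
          (op_word pib (altr i j (len w)) (expw (weight_of_set (descent C (wd (altr i j (len w)))))) :: ('n, 'a) laurent)"
        by (rule pib_word_lead'[OF sub(1)]) (simp add: e[symmetric])
      then show ?thesis unfolding e[symmetric] using 1 by (simp add: b_def weight_of_set_single)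
    next
      case 2
      note e = wj[OF w 2]
      have "lead ?I (wd (altr j i (len w)) (weight_of_set (descent C (wd (altr j i (len w))))))
          (op_word pib (altr j i (len w)) (expw (weight_of_set (descent C (wd (altr j i (len w)))))) :: ('n, 'a) laurent)"
        by (rule pib_word_lead'[OF sub(2)]) (simp add: e[symmetric])
      then show ?thesis unfolding e[symmetric] using 2 ij by (simp add: b_def weight_of_set_single)
    next
      case 3
      then show ?thesis by (simp add: b_def lead_def)
    qed
  qed
  have ki: "op_word pib (altr i j l) (expw (fund_weight i) :: ('n, 'a) laurent) = 0" if le: "k \<le> l" for l
  proof -
    obtain xs where "altr i j l = xs @ altr i j k"
      using altr_suffix'[OF le] by blast
    then show ?thesis
      using alt_word_kills[OF ij eq k, where 'a = 'a] by (simp add: lin_zero[OF lin_pib_word])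
  qed
  have kj: "op_word pib (altr j i l) (expw (fund_weight j) :: ('n, 'a) laurent) = 0" if le: "k \<le> l" for l
  proof -
    obtain xs where "altr j i l = xs @ altr j i k"
      using altr_suffix'[OF le] by blast
    then show ?thesis
      using alt_word_kills[OF ij[symmetric] eq[symmetric] k, where 'a = 'a] by (simp add: lin_zero[OF lin_pib_word])
  qed
  have XY: "?X (b w) = ?Y (b w)" if w: "w \<in> W ?I" for w
  proof -
    have len: "0 < len w" if "descent C w \<noteq> {}" using that by (auto simp: descent_def)
    have "descent C w \<subseteq> ?I" by (rule descent_sub[OF w])
    then consider "descent C w = {i}" | "descent C w = {j}" | "descent C w = {}" | "descent C w = ?I"
      by blast
    then show ?thesis
    proof cases
      case 1
      then have l: "0 < len w" using len by simp
      show ?thesis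
        using alt_alt_kills[OF ij ki l _ k, of i j] alt_alt_kills[OF ij ki l _ k, of j i] 1 by (simp add: b_def)
    next
      case 2
      then have l: "0 < len w" using len by simp
      show ?thesis
        using alt_alt_kills[OF ij[symmetric] kj l _ k, of i j] alt_alt_kills[OF ij[symmetric] kj l _ k, of j i] 2 ij
        by (simp add: b_def)
    next
      case 3
      then have "b w = expw 0" using weyl_zero[OF w] by (simp add: b_def weight_of_set_empty)
      then show ?thesis by (simp add: alt_one[OF k])
    next
      case 4
      have "w (weight_of_set ?I) i = -1" "w (weight_of_set ?I) j = -1"
        using top_coord[OF w] 4 by auto
      moreover have "b w = expw (w (weight_of_set ?I))" using 4 ij by (auto simp: b_def)
      ultimately show ?thesis by (simp add: alt_top)
    qed
  qed
  have "?X f = ?Y f" for f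
  proof (rule lead_span[of ?I "lead_family b ?I" "\<lambda>f. ?X f = ?Y f"])
    show "lead ?I \<nu> (lead_family b ?I \<nu>)" for \<nu> by (rule lead_lead_family) (rule lead)
    show "?X (lead_family b ?I \<nu>) = ?Y (lead_family b ?I \<nu>)" for \<nu>
      unfolding lead_family_def pib_word_mon[OF sub(1)] pib_word_mon[OF sub(2)] XY[OF min_elt_props(1)] ..
  qed (simp_all add: lin_add[OF lin_pib_word] lin_smult[OF lin_pib_word])
  then show ?thesis by blast
qed

section \<open>Operators indexed by group elements\<close>

definition word_indep :: "('n \<Rightarrow> 'x \<Rightarrow> 'x) \<Rightarrow> bool" where
  "word_indep f \<longleftrightarrow> (\<forall>a b. length a = len (wd a) \<longrightarrow> length b = len (wd b) \<longrightarrow> wd a = wd b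
     \<longrightarrow> op_word f a = op_word f b)"

definition opw :: "('n \<Rightarrow> 'x \<Rightarrow> 'x) \<Rightarrow> 'n weyl_elt \<Rightarrow> 'x \<Rightarrow> 'x" where
  "opw f w = op_word f (reduced_word_of C w)"

lemma opw_red:
  assumes "word_indep f" "length a = len (wd a)"
  shows "opw f (wd a) = op_word f a"
proof -
  have W: "wd a \<in> W UNIV" by (auto simp: weyl_iff_word)
  show ?thesis
    using assms red_word[OF W] unfolding opw_def word_indep_def by metis
qed

lemma opw_mult:
  assumes "word_indep f" "u \<in> W UNIV" "v \<in> W UNIV" "len (u \<circ> v) = len u + len v"
  shows "opw f (u \<circ> v) = opw f u \<circ> opw f v"
proof -
  let ?a = "reduced_word_of C u" and ?b = "reduced_word_of C v"
  have "opw f (wd (?a @ ?b)) = op_word f (?a @ ?b)"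
    using assms red_word[OF assms(2)] red_word[OF assms(3)] by (intro opw_red) simp_all
  then show ?thesis
    using red_word[OF assms(2)] red_word[OF assms(3)] by (simp add: opw_def)
qed

lemma len_s: "len (s i) = 1"
proof -
  have "len (id \<circ> s i) = Suc (len id)" using q_pos[of i] by (intro len_pos id_in_W) (simp add: ht_root)
  then show ?thesis by (simp only: id_comp len_id One_nat_def)
qed

lemma opw_s: "word_indep f \<Longrightarrow> opw f (s i) = f i"
  using opw_red[of f "[i]"] len_s[of i] by simp

lemma opw_left:
  assumes "word_indep f" "w \<in> W UNIV" "len (s i \<circ> w) = Suc (len w)"
  shows "opw f (s i \<circ> w) = f i \<circ> opw f w"
  using opw_mult[OF assms(1) sref_in_weyl[of i UNIV C] assms(2)] assms(3) len_s[of i]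
  by (simp add: opw_s[OF assms(1)])

lemma opw_right:
  assumes "word_indep f" "w \<in> W UNIV" "i \<in> descent C w"
  shows "opw f w = opw f (w \<circ> s i) \<circ> f i"
proof -
  have "Suc (len (w \<circ> s i)) = len w" using len_neg assms descent_iff by blast
  then show ?thesis
    using opw_mult[OF assms(1) W_comp_s[OF assms(2), of i] sref_in_weyl[of i UNIV C]] len_s[of i]
    by (simp add: opw_s[OF assms(1)])
qed

lemma opw_idem_left:
  assumes "word_indep f" "w \<in> W UNIV" "len (s i \<circ> w) < len w" "\<And>x. f i (f i x) = g (f i x)"
  shows "f i (opw f w x) = g (opw f w x)"
proof -
  let ?u = "s i \<circ> w"
  have u: "?u \<in> W UNIV" by (simp add: W_s_comp assms(2))
  have e: "s i \<circ> ?u = w" by simp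
  have "len (s i \<circ> ?u) = Suc (len ?u)"
    unfolding e using assms(3) by (cases rule: len_s_comp_cases[OF assms(2), of i]) simp_all
  from opw_left[OF assms(1) u this] have "opw f w = f i \<circ> opw f ?u" unfolding e .
  then show ?thesis using assms(4) by simp
qed

lemma word_indep_pib: "word_indep (demazure_bar C :: 'n \<Rightarrow> ('n, 'a::field) laurent \<Rightarrow> _)"
  unfolding word_indep_def using matsumoto[OF pib_braid] by blast

lemma demazure_bar_w_opw: "demazure_bar_w C w = opw pib w"
  by (simp add: demazure_bar_w_def opw_def)

lemma lin_opw_pib: "lin (opw pib w)"
  unfolding opw_def by (rule lin_pib_word)

lemma red_exists_in: "w \<in> W I \<Longrightarrow> \<exists>is. set is \<subseteq> I \<and> wd is = w \<and> length is = len w"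
proof (induction rule: weyl_induct)
  case id
  show "\<exists>is. set is \<subseteq> I \<and> wd is = id \<and> length is = len id"
    by (rule exI[of _ "[]"]) (simp only: list.set empty_subsetI word_elt_Nil len_id list.size simp_thms)
next
  case (step w i)
  then obtain "is" where "set is \<subseteq> I" "wd is = w" "length is = len w" by blast
  then have "set (is @ [i]) \<subseteq> I" "wd (is @ [i]) = w \<circ> s i" "length (is @ [i]) = len (w \<circ> s i)"
    using step(2,4) by simp_all
  then show "\<exists>is. set is \<subseteq> I \<and> wd is = w \<circ> s i \<and> length is = len (w \<circ> s i)" by blast
qed

lemma longest_factor:
  assumes "w \<in> W UNIV" "I \<subseteq> descent C w"
  obtains u where "u \<in> W UNIV" "u \<circ> longest C I = w" "len w = len u + len (longest C I)"
proof -
  let ?x = "longest C I"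
  have x: "?x \<in> W I" by (rule longest_props)
  have "len (w \<circ> inv ?x) + len (inv ?x) = len w"
    using assms descent_iff[OF assms(1)] by (intro len_par_sub[OF assms(1) _ W_inv[OF x]]) blast
  moreover have "w \<circ> inv ?x \<circ> ?x = w" by (simp only: comp_assoc W_inv_comp[OF x] comp_id)
  moreover have "w \<circ> inv ?x \<in> W UNIV" by (rule weyl_comp[OF assms(1) W_sub[OF W_inv[OF x]]])
  ultimately show ?thesis using that[of "w \<circ> inv ?x"] len_inv[OF x] by simp
qed

section \<open>The 0-Hecke algebra\<close>

definition hscale :: "'a::field \<Rightarrow> ('n, 'a) hecke \<Rightarrow> ('n, 'a) hecke" where
  "hscale c h = (\<lambda>v. c * h v)"

lemma hscale_apply [simp]: "hscale c h v = c * h v"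
  by (simp add: hscale_def)

lemma sum_hecke_apply: "(\<Sum>x\<in>A. g x) v = (\<Sum>x\<in>A. g x v)" for g :: "'x \<Rightarrow> ('n, 'a::field) hecke"
  by (induction A rule: infinite_finite_induct) simp_all

lemma hscale_simps: "hscale c (g + h) = hscale c g + hscale c h" "hscale c (hscale d h) = hscale (c * d) h" "hscale (c + d) h = hscale c h + hscale d h"
  "hscale c 0 = 0" "hscale 0 h = 0" "hscale 1 h = h" "hscale c (- h) = - hscale c h" "hscale (-1) h = - h"
  by (rule ext, simp add: algebra_simps)+

lemma hscale_sum: "hscale c (\<Sum>x\<in>A. g x) = (\<Sum>x\<in>A. hscale c (g x))"
  by (rule ext) (simp add: sum_hecke_apply sum_distrib_left)

definition hlin :: "(('n, 'a::field) hecke \<Rightarrow> ('n, 'a) hecke) \<Rightarrow> bool" where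
  "hlin F \<longleftrightarrow> (\<forall>g h. F (g + h) = F g + F h) \<and> (\<forall>c h. F (hscale c h) = hscale c (F h))"

lemma hlin_add: "hlin F \<Longrightarrow> F (g + h) = F g + F h"
  and hlin_hscale: "hlin F \<Longrightarrow> F (hscale c h) = hscale c (F h)"
  by (simp_all add: hlin_def)

lemma hlin_zero: "hlin F \<Longrightarrow> F 0 = 0"
  using hlin_hscale[of F 0 0] by (simp add: hscale_simps)

lemma hlin_minus: "hlin F \<Longrightarrow> F (- h) = - F h"
  using hlin_hscale[of F "-1" h] by (simp add: hscale_simps)

lemma hlin_sum:
  assumes "hlin F"
  shows "F (\<Sum>x\<in>A. g x) = (\<Sum>x\<in>A. F (g x))"
proof (induction A rule: infinite_finite_induct)
  case (infinite A)
  show "F (\<Sum>x\<in>A. g x) = (\<Sum>x\<in>A. F (g x))"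
    unfolding sum.infinite[OF infinite] by (rule hlin_zero[OF assms])
next
  case empty
  show "F (\<Sum>x\<in>{}. g x) = (\<Sum>x\<in>{}. F (g x))"
    unfolding sum.empty by (rule hlin_zero[OF assms])
next
  case (insert a A)
  show "F (\<Sum>x\<in>insert a A. g x) = (\<Sum>x\<in>insert a A. F (g x))"
    unfolding sum.insert[OF insert.hyps] hlin_add[OF assms] insert.IH ..
qed

text \<open>Right multiplication commutes with left multiplication; hence a word in the left generators
  is determined by its value at the unit, which only depends on the group element.\<close>

definition rgen_times_basis :: "'n \<Rightarrow> 'n weyl_elt \<Rightarrow> ('n, 'a::field) hecke" where
  "rgen_times_basis j w = (if len w < len (w \<circ> s j) then hbasis (w \<circ> s j) else - hbasis w)"

definition rgen :: "'n \<Rightarrow> ('n, 'a::field) hecke \<Rightarrow> ('n, 'a) hecke" where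
  "rgen j h = (\<Sum>w\<in>W UNIV. hscale (h w) (rgen_times_basis j w))"

lemma hgen_eq: "hgen C i h = (\<Sum>w\<in>W UNIV. hscale (h w) (hgen_times_basis C i w))"
  by (simp add: hgen_def hscale_def)

lemma hlin_expansion: "hlin (\<lambda>h. \<Sum>w\<in>W UNIV. hscale (h w) (t w))"
  by (auto simp: hlin_def hscale_simps hscale_sum sum.distrib)

lemma hlin_hgen: "hlin (hgen C i)"
  using hlin_expansion[of "hgen_times_basis C i"] by (simp add: hgen_eq[abs_def])

lemma hlin_rgen: "hlin (rgen j)"
  using hlin_expansion[of "rgen_times_basis j"] by (simp add: rgen_def[abs_def])

lemma hlin_op_word: "(\<And>i. hlin (F i)) \<Longrightarrow> hlin (op_word F is)"
  by (induction "is") (simp_all add: hlin_def)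

lemma expansion_basis:
  fixes t :: "'n weyl_elt \<Rightarrow> ('n, 'a::field) hecke"
  assumes "u \<in> W UNIV"
  shows "(\<Sum>w\<in>W UNIV. hscale (hbasis u w) (t w)) = t u"
proof -
  have "(\<Sum>w\<in>W UNIV. hscale (hbasis u w) (t w)) = (\<Sum>w\<in>W UNIV. if w = u then t w else 0)"
    by (rule sum.cong) (auto simp: hbasis_def hscale_simps)
  then show ?thesis using assms finite_W by (simp add: sum.delta)
qed

lemma hgen_basis: "w \<in> W UNIV \<Longrightarrow> hgen C i (hbasis w) = hgen_times_basis C i w"
  unfolding hgen_eq by (rule expansion_basis)

lemma rgen_basis: "w \<in> W UNIV \<Longrightarrow> rgen j (hbasis w) = rgen_times_basis j w"
  unfolding rgen_def by (rule expansion_basis)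

lemma hecke_expand:
  assumes "h \<in> hecke_alg C"
  shows "h = (\<Sum>w\<in>W UNIV. hscale (h w) (hbasis w))"
proof
  fix v
  have "(\<Sum>w\<in>W UNIV. hscale (h w) (hbasis w)) v = (\<Sum>w\<in>W UNIV. if w = v then h w else 0)"
    unfolding sum_hecke_apply by (rule sum.cong) (auto simp: hbasis_def)
  then show "h v = (\<Sum>w\<in>W UNIV. hscale (h w) (hbasis w)) v"
    using assms finite_W by (simp add: sum.delta hecke_alg_def)
qed

text \<open>Left and right products differ in form only if both one-sided products lengthen
  \<open>w\<close> while the two-sided one does not. In that case the two one-sided products are the
  same group element.\<close>

lemma hgen_rgen_basis:
  assumes w: "w \<in> W UNIV"
  shows "hgen C i (rgen_times_basis j w) = (rgen j (hgen_times_basis C i w) :: ('n, 'a::field) hecke)"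
proof -
  have wj: "w \<circ> s j \<in> W UNIV" and iw: "s i \<circ> w \<in> W UNIV" using W_comp_s[OF w] W_s_comp[OF w] by blast+
  have as: "s i \<circ> (w \<circ> s j) = s i \<circ> w \<circ> s j" by (rule comp_assoc[symmetric])
  let ?L = "len w < len (s i \<circ> w)" and ?R = "len w < len (w \<circ> s j)"
  let ?LR = "len (w \<circ> s j) < len (s i \<circ> w \<circ> s j)" and ?RL = "len (s i \<circ> w) < len (s i \<circ> w \<circ> s j)"
  have l: "hgen C i (rgen_times_basis j w) = (if ?R then if ?LR then hbasis (s i \<circ> w \<circ> s j) else - hbasis (w \<circ> s j)
      else if ?L then - hbasis (s i \<circ> w) else hbasis w :: ('n, 'a) hecke)"
    using hgen_basis[OF w, of i, where 'a = 'a] hgen_basis[OF wj, of i, where 'a = 'a]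
    by (simp add: rgen_times_basis_def hlin_minus[OF hlin_hgen] hgen_times_basis_def as)
  have r: "rgen j (hgen_times_basis C i w) = (if ?L then if ?RL then hbasis (s i \<circ> w \<circ> s j) else - hbasis (s i \<circ> w)
      else if ?R then - hbasis (w \<circ> s j) else hbasis w :: ('n, 'a) hecke)"
    using rgen_basis[OF w, of j, where 'a = 'a] rgen_basis[OF iw, of j, where 'a = 'a]
    by (simp add: rgen_times_basis_def hlin_minus[OF hlin_rgen] hgen_times_basis_def)
  have le: "len (s i \<circ> w \<circ> s j) \<le> Suc (len (s i \<circ> w))" "len (s i \<circ> w \<circ> s j) \<le> Suc (len (w \<circ> s j))"
    using len_comp_s_le[OF iw, of j] len_comp_le[OF sref_in_weyl[of i UNIV C] wj] len_s[of i] by (simp_all add: as)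
  have L: "len (s i \<circ> w) = Suc (len w) \<or> len w = Suc (len (s i \<circ> w))"
    by (cases rule: len_s_comp_cases[OF w, of i]) simp_all
  have R: "len (w \<circ> s j) = Suc (len w) \<or> len w = Suc (len (w \<circ> s j))"
    using len_pos[OF w, of j] len_neg[OF w, of j] ht_root_nz[OF w, of j] by force
  \<comment> \<open>The positive root \<open>inv w (root i)\<close> becomes negative under
    \<open>s j\<close>, so it equals \<open>root j\<close>, and \<open>refl_conj\<close> turns this
    into the equality of the two products.\<close>
  have eq: "s i \<circ> w = w \<circ> s j" if "?L" "?R" "\<not> ?LR"
  proof -
    have 1: "ht (inv w (root i)) > 0"
      using that(1) by (cases rule: len_s_comp_cases[OF w, of i]) simp_all
    have "\<not> ht (inv (w \<circ> s j) (root i)) > 0"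
      using len_s_comp(1)[OF wj, of i] that(3) as by auto
    then have "ht (inv (w \<circ> s j) (root i)) < 0" using ht_root_nz[OF W_inv[OF wj], of i] by simp
    moreover have "inv (w \<circ> s j) = s j \<circ> inv w"
      using w by (intro inv_unique_comp) (rule ext, simp)+
    ultimately have "ht (s j (inv w (root i))) < 0" by simp
    then have "inv w (root i) = root j" using simple_of_sign_change[OF W_inv[OF w] 1] by blast
    then have "inv w \<circ> s i = s j \<circ> inv w" using refl_conj[OF W_inv[OF w]] by blast
    then have "w \<circ> (inv w \<circ> s i) \<circ> w = w \<circ> (s j \<circ> inv w) \<circ> w" by simp
    then have "(w \<circ> inv w) \<circ> s i \<circ> w = w \<circ> s j \<circ> (inv w \<circ> w)" by (simp only: comp_assoc)
    then show ?thesis by (simp only: W_inv_comp[OF w] id_comp comp_id)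
  qed
  show ?thesis
  proof (cases ?L)
    case lt: True
    show ?thesis
    proof (cases ?R)
      case True
      have "?LR \<longleftrightarrow> ?RL" using L R lt True by linarith
      then show ?thesis unfolding l r using lt True eq by auto
    next
      case False
      then have "\<not> ?RL" using L R lt le by linarith
      then show ?thesis unfolding l r using lt False by simp
    qed
  next
    case ge: False
    show ?thesis
    proof (cases ?R)
      case True
      then have "\<not> ?LR" using L R ge le by linarith
      then show ?thesis unfolding l r using ge True by simp
    next
      case False
      then show ?thesis unfolding l r using ge by simp
    qed
  qed
qed

lemma hgen_rgen: "hgen C i (rgen j h) = rgen j (hgen C i h)"
  by (simp only: rgen_def[of j h] hgen_eq[of i h] hlin_sum[OF hlin_hgen] hlin_sum[OF hlin_rgen]
      hlin_hscale[OF hlin_hgen] hlin_hscale[OF hlin_rgen]) (rule sum.cong, simp_all only: hgen_rgen_basis)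

lemma hgen_hgen: "hgen C i (hgen C i h) = - (hgen C i h :: ('n, 'a::field) hecke)"
proof -
  have "hgen C i (hgen_times_basis C i w) = (- hgen_times_basis C i w :: ('n, 'a) hecke)" if w: "w \<in> W UNIV" for w
  proof (cases "len w < len (s i \<circ> w)")
    case True
    then show ?thesis
      using hgen_basis[OF W_s_comp[OF w UNIV_I[of i]], of i, where 'a = 'a] by (simp add: hgen_times_basis_def)
  next
    case False
    then show ?thesis
      using hgen_basis[OF w, of i, where 'a = 'a] by (simp add: hgen_times_basis_def hlin_minus[OF hlin_hgen])
  qed
  then show ?thesis
    unfolding hgen_eq[of i h] hlin_sum[OF hlin_hgen] hlin_hscale[OF hlin_hgen]
    by (simp add: hscale_simps sum_negf)
qed

lemma hgen_word_basis:
  assumes "u \<in> W UNIV" "len (wd is \<circ> u) = length is + len u"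
  shows "op_word (hgen C) is (hbasis u) = (hbasis (wd is \<circ> u) :: ('n, 'a::field) hecke)"
  using assms(2)
proof (induction "is")
  case Nil
  show ?case by simp
next
  case (Cons i "is")
  let ?x = "wd is \<circ> u"
  have W: "wd is \<in> W UNIV" by (auto simp: weyl_iff_word)
  then have x: "?x \<in> W UNIV" using assms(1) weyl_comp by blast
  have e: "wd (i # is) \<circ> u = s i \<circ> ?x" by (simp only: word_elt_Cons comp_assoc)
  have "len ?x \<le> length is + len u"
    using len_comp_le[OF W assms(1)] len_le[of "is"] by linarith
  moreover have "len (s i \<circ> ?x) \<le> Suc (len ?x)"
    using len_comp_le[OF sref_in_weyl[of i UNIV C] x] len_s[of i] by simp
  moreover have "len (s i \<circ> ?x) = Suc (length is) + len u"
    using Cons.prems unfolding e by (simp only: list.size add_Suc_right add_0_right)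
  ultimately have l: "len ?x = length is + len u" "len ?x < len (s i \<circ> ?x)" by linarith+
  have ih: "op_word (hgen C) is (hbasis u) = (hbasis ?x :: ('n, 'a) hecke)" by (rule Cons.IH[OF l(1)])
  have "hgen C i (hbasis ?x) = (hbasis (s i \<circ> ?x) :: ('n, 'a) hecke)"
    using hgen_basis[OF x, of i, where 'a = 'a] l(2) by (simp only: hgen_times_basis_def if_True)
  then show ?case unfolding e op_word_Cons comp_apply ih .
qed

lemma op_word_hgen_rgen: "op_word (hgen C) is (rgen j h) = rgen j (op_word (hgen C) is h)"
  by (induction "is") (simp_all add: hgen_rgen)

text \<open>\<open>hgen\<close> reads only the values on the group, whereas its argument type also
  admits functions with other support.\<close>

lemma hgen_restrict: "hgen C i (\<Sum>w\<in>W UNIV. hscale (h w) (hbasis w)) = (hgen C i h :: ('n, 'a::field) hecke)"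
  unfolding hlin_sum[OF hlin_hgen] hlin_hscale[OF hlin_hgen] hgen_eq[of i h]
  by (rule sum.cong) (simp_all add: hgen_basis)

lemma word_indep_hgen: "word_indep (hgen C :: 'n \<Rightarrow> ('n, 'a::field) hecke \<Rightarrow> _)"
  unfolding word_indep_def
proof (intro allI impI)
  fix a b :: "'n list"
  assume a: "length a = len (wd a)" and b: "length b = len (wd b)" and ab: "wd a = wd b"
  let ?F = "op_word (hgen C) a :: ('n, 'a) hecke \<Rightarrow> _" and ?G = "op_word (hgen C) b :: ('n, 'a) hecke \<Rightarrow> _"
  have basis: "?F (hbasis w) = ?G (hbasis w)" if "w \<in> W UNIV" for w
    using that
  proof (induction rule: weyl_induct)
    case id
    show "?F (hbasis id) = ?G (hbasis id)"
      using hgen_word_basis[OF id_in_W, of a, where 'a = 'a] hgen_word_basis[OF id_in_W, of b, where 'a = 'a] a b ab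
      by (simp only: comp_id len_id add_0_right)
  next
    case (step w i)
    have "hbasis (w \<circ> s i) = (rgen i (hbasis w) :: ('n, 'a) hecke)"
      using rgen_basis[OF step(1), of i, where 'a = 'a] step(4) by (simp only: rgen_times_basis_def lessI if_True)
    then show "?F (hbasis (w \<circ> s i)) = ?G (hbasis (w \<circ> s i))"
      using step(5) by (simp only: op_word_hgen_rgen)
  qed
  show "?F = ?G"
  \<comment> \<open>The empty word acts as the identity even outside the group, while a nonempty
    word first discards that part of its argument. The reduction to the group basis is therefore
    made for nonempty words only.\<close>
  proof (cases "a = []")
    case True
    then show ?thesis using a b ab by simp
  next
    case False
    moreover have "b \<noteq> []" using False a b ab by auto
    ultimately obtain a' i b' j where ab': "a = a' @ [i]" "b = b' @ [j]" by (meson rev_exhaust)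
    show ?thesis
    proof
      fix h :: "('n, 'a) hecke"
      let ?h = "\<Sum>w\<in>W UNIV. hscale (h w) (hbasis w)"
      have "?F ?h = ?G ?h"
        unfolding hlin_sum[OF hlin_op_word[OF hlin_hgen]] hlin_hscale[OF hlin_op_word[OF hlin_hgen]]
        by (rule sum.cong) (simp_all add: basis)
      moreover have "?F ?h = ?F h" "?G ?h = ?G h" unfolding ab' by (simp_all add: hgen_restrict)
      ultimately show "?F h = ?G h" by simp
    qed
  qed
qed

text \<open>Expanding the product of the factors T + 1 and using that T_i squared is -T_i leaves
  every nonempty alternating word of length at most \<open>k\<close> once in each order, together
  with the unit and one word of length \<open>Suc k\<close>. Apart from the last term this is
  symmetric in \<open>i\<close> and \<open>j\<close>, so the braid relation passes from T to
  T'.\<close>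

lemma alt_hgen':
  fixes f :: "('n, 'a::field) hecke" and i j :: 'n and k :: nat
  shows "op_word (hgen' C) (altr i j (Suc k)) f = f + (\<Sum>l=1..k. op_word (hgen C) (altr i j l) f + op_word (hgen C) (altr j i l) f)
     + op_word (hgen C) (altr i j (Suc k)) f"
proof -
  define P :: "nat \<Rightarrow> bool" where
    "P k \<longleftrightarrow> (\<forall>i j (f :: ('n, 'a) hecke). op_word (hgen' C) (altr i j (Suc k)) f
     = f + (\<Sum>l=1..k. op_word (hgen C) (altr i j l) f + op_word (hgen C) (altr j i l) f)
     + op_word (hgen C) (altr i j (Suc k)) f)" for k
  have "P k"
  proof (induction k)
    case 0
    show ?case by (simp add: P_def hgen'_def add.commute)
  next
    case (Suc k)
    note IH = Suc.IH[unfolded P_def]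
    show ?case unfolding P_def
    proof (intro allI)
      fix i j :: 'n and f :: "('n, 'a) hecke"
      let ?A = "\<lambda>l f. op_word (hgen C) (altr i j l) f :: ('n, 'a) hecke"
      let ?B = "\<lambda>l f. op_word (hgen C) (altr j i l) f :: ('n, 'a) hecke"
      let ?g = "hgen C i f + f"
      note lin = hlin_op_word[OF hlin_hgen]
      \<comment> \<open>Against \<open>?g\<close> a word with last letter \<open>j\<close> splits
        into two alternating words, while a nonempty word with last letter \<open>i\<close> gives 0,
        because T_i annihilates T_i + 1.\<close>
      have B: "?B l ?g = ?A (Suc l) f + ?B l f" for l by (simp add: hlin_add[OF lin])
      have A: "?A l ?g = 0" if "l \<in> {1..k}" for l
        using that by (cases l) (simp_all add: hlin_add[OF lin] hlin_add[OF hlin_hgen] hgen_hgen hlin_zero[OF lin])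
      have "op_word (hgen' C) (altr i j (Suc (Suc k))) f = op_word (hgen' C) (altr j i (Suc k)) ?g"
        unfolding altr.simps(2)[of i j "Suc k"] by (simp add: hgen'_def)
      also have "\<dots> = ?g + (\<Sum>l=1..k. ?B l ?g + ?A l ?g) + ?B (Suc k) ?g" by (rule IH[rule_format])
      also have "(\<Sum>l=1..k. ?B l ?g + ?A l ?g) = (\<Sum>l=1..k. ?A (Suc l) f + ?B l f)"
        by (rule sum.cong) (simp_all only: A B add_0_right)
      also have "\<dots> = (\<Sum>l=1..k. ?A (Suc l) f) + (\<Sum>l=1..k. ?B l f)" by (rule sum.distrib)
      also have "?g + ((\<Sum>l=1..k. ?A (Suc l) f) + (\<Sum>l=1..k. ?B l f)) + ?B (Suc k) ?g
          = f + ((?A 1 f + (\<Sum>l=1..k. ?A (Suc l) f)) + ((\<Sum>l=1..k. ?B l f) + ?B (Suc k) f)) + ?A (Suc (Suc k)) f"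
        unfolding B by (simp only: ac_simps One_nat_def altr.simps append_Nil op_word_Cons op_word_Nil comp_id)
      finally have e: "op_word (hgen' C) (altr i j (Suc (Suc k))) f
          = f + ((?A 1 f + (\<Sum>l=1..k. ?A (Suc l) f)) + ((\<Sum>l=1..k. ?B l f) + ?B (Suc k) f)) + ?A (Suc (Suc k)) f" .
      have s1: "?A 1 f + (\<Sum>l=1..k. ?A (Suc l) f) = (\<Sum>l=1..Suc k. ?A l f)"
        by (simp only: sum.atLeast_Suc_atMost[of 1 "Suc k"] sum.atLeast_Suc_atMost_Suc_shift One_nat_def)
          (simp add: sum.atLeast_Suc_atMost[of 0])
      have s2: "(\<Sum>l=1..k. ?B l f) + ?B (Suc k) f = (\<Sum>l=1..Suc k. ?B l f)" by (simp del: altr.simps)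
      show "op_word (hgen' C) (altr i j (Suc (Suc k))) f
         = f + (\<Sum>l=1..Suc k. ?A l f + ?B l f) + ?A (Suc (Suc k)) f"
        using e unfolding s1 s2 by (simp only: sum.distrib)
    qed
  qed
  then show ?thesis unfolding P_def by blast
qed

lemma word_indep_hgen': "word_indep (hgen' C :: 'n \<Rightarrow> ('n, 'a::field) hecke \<Rightarrow> _)"
  unfolding word_indep_def
proof (intro allI impI)
  fix a b :: "'n list"
  assume ab: "length a = len (wd a)" "length b = len (wd b)" "wd a = wd b"
  show "op_word (hgen' C) a = (op_word (hgen' C) b :: ('n, 'a) hecke \<Rightarrow> _)"
  proof (rule matsumoto[OF _ ab])
    fix i j :: 'n and k
    assume "i \<noteq> j" and e: "wd (altr i j k) = wd (altr j i k)" "len (wd (altr i j k)) = k"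
    have h: "op_word (hgen C) (altr i j k) = (op_word (hgen C) (altr j i k) :: ('n, 'a) hecke \<Rightarrow> _)"
      using word_indep_hgen e unfolding word_indep_def by (metis length_altr)
    show "op_word (hgen' C) (altr i j k) = (op_word (hgen' C) (altr j i k) :: ('n, 'a) hecke \<Rightarrow> _)"
    proof (cases k)
      case 0
      then show ?thesis by simp
    next
      case (Suc k')
      show ?thesis
        by (rule ext) (use h in \<open>simp only: Suc alt_hgen' add.commute[of "op_word (hgen C) (altr j i _) _"]\<close>)
    qed
  qed
qed

lemma hT_opw: "hT C w = opw (hgen C) w"
  by (simp add: hT_def opw_def)

lemma hT'_opw: "hT' C w = opw (hgen' C) w"
  by (simp add: hT'_def opw_def)

lemma hlin_hT: "hlin (hT C w)"
  unfolding hT_def by (rule hlin_op_word) (rule hlin_hgen)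

section \<open>The elements T' of longest elements and a basis adapted to descents\<close>

definition Tprime_longest :: "'n set \<Rightarrow> ('n, 'a::field) hecke" where
  "Tprime_longest K = hT' C (longest C K) (hbasis id)"

text \<open>The longest element has a reduced word beginning with \<open>k\<close>, and T_k
  annihilates T'_k.\<close>

lemma hgen_Tprime_longest:
  assumes "k \<in> K"
  shows "hgen C k (Tprime_longest K) = (0 :: ('n, 'a::field) hecke)"
proof -
  let ?x = "longest C K"
  have x: "?x \<in> W K" by (rule longest_props)
  let ?u = "s k \<circ> ?x"
  have u: "?u \<in> W K" by (rule W_s_comp[OF x assms])
  have neg: "\<And>l. l \<in> K \<Longrightarrow> ht (?x (root l)) < 0" by (rule longest_props)
  have "inv ?x \<circ> ?u \<in> W K" by (rule weyl_comp[OF W_inv[OF x] u])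
  moreover have "?x \<circ> (inv ?x \<circ> ?u) = ?u" by (rule ext) (simp add: W_inv_apply(2)[OF x])
  ultimately have "len ?u \<le> len ?x" using len_par_sub[OF W_sub[OF x] neg, of K "inv ?x \<circ> ?u"] by simp
  then have "len ?x = Suc (len ?u)" by (cases rule: len_s_comp_cases[OF W_sub[OF x], of k]) simp_all
  moreover have e: "s k \<circ> ?u = ?x" by simp
  ultimately have "len (s k \<circ> ?u) = Suc (len ?u)" by simp
  note h = opw_left[OF word_indep_hgen' W_sub[OF u] this, unfolded e]
  have "Tprime_longest K = (hgen' C k (opw (hgen' C) ?u (hbasis id)) :: ('n, 'a) hecke)"
    by (simp only: Tprime_longest_def hT'_opw h comp_apply)
  then show ?thesis by (simp add: hgen'_def hlin_add[OF hlin_hgen] hgen_hgen)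
qed

text \<open>T_i times anything has no coefficient at the identity: a lengthened product is not the
  identity, and in the other case the basis element that is negated has \<open>i\<close> as a left
  descent.\<close>

lemma hgen_support:
  assumes "i \<in> K" "\<And>w. w \<notin> W K \<Longrightarrow> h w = (0 :: 'a::field)"
  shows "w \<notin> W K \<Longrightarrow> hgen C i h w = 0" "hgen C i h id = 0"
proof -
  have "hscale (h u) (hgen_times_basis C i u) w = 0" if "w \<notin> W K" for u
  proof (cases "u \<in> W K")
    case True
    then show ?thesis
      using that W_s_comp[OF True assms(1)] by (auto simp: hgen_times_basis_def hbasis_def)
  next
    case False
    then show ?thesis using assms(2) by simp
  qed
  then show "w \<notin> W K \<Longrightarrow> hgen C i h w = 0" unfolding hgen_eq sum_hecke_apply by (intro sum.neutral ballI)
  have "hscale (h u) (hgen_times_basis C i u) id = 0" if "u \<in> W UNIV" for u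
  proof (cases "len u < len (s i \<circ> u)")
    case True
    then have "s i \<circ> u \<noteq> id" by (metis len_id not_less0)
    then show ?thesis using True by (simp add: hgen_times_basis_def hbasis_def)
  next
    case False
    have "u \<noteq> id"
    proof
      assume "u = id"
      then show False using False len_s[of i] by simp
    qed
    then show ?thesis using False by (simp add: hgen_times_basis_def hbasis_def)
  qed
  then show "hgen C i h id = 0" unfolding hgen_eq sum_hecke_apply by (intro sum.neutral ballI)
qed

text \<open>Each factor T_i + 1 keeps the coefficient at the identity, since by
  \<open>hgen_support\<close> the part T_i contributes nothing there. This is the source of the
  diagonal entries 1 in \<open>hecke_el_triangular\<close>.\<close>

lemma Tprime_longest_support: "w \<notin> W K \<Longrightarrow> Tprime_longest K w = (0 :: 'a::field)" "Tprime_longest K id = (1 :: 'a)"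
proof -
  have word: "(\<forall>w. w \<notin> W K \<longrightarrow> op_word (hgen' C) is (hbasis id) w = (0 :: 'a))
      \<and> op_word (hgen' C) is (hbasis id) id = (1 :: 'a)" if "set is \<subseteq> K" for "is"
    using that
  proof (induction "is")
    case Nil
    show "(\<forall>w. w \<notin> W K \<longrightarrow> op_word (hgen' C) [] (hbasis id) w = (0 :: 'a))
      \<and> op_word (hgen' C) [] (hbasis id) id = (1 :: 'a)"
    proof (intro conjI allI impI)
      fix w assume "w \<notin> W K"
      then have "w \<noteq> id" using id_in_W by blast
      then show "op_word (hgen' C) [] (hbasis id) w = (0 :: 'a)"
        by (simp only: op_word_Nil id_apply hbasis_def if_False)
    qed (simp only: op_word_Nil id_apply hbasis_def if_True simp_thms)
  next
    case (Cons i "is")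
    have p: "i \<in> K" "set is \<subseteq> K" using Cons.prems by simp_all
    have ih: "w \<notin> W K \<Longrightarrow> op_word (hgen' C) is (hbasis id) w = (0 :: 'a)"
      "op_word (hgen' C) is (hbasis id) id = (1 :: 'a)" for w
      using Cons.IH[OF p(2)] by blast+
    have apply': "hgen' C i h v = hgen C i h v + h v" for h :: "('n, 'a) hecke" and v
      by (simp add: hgen'_def)
    show "(\<forall>w. w \<notin> W K \<longrightarrow> op_word (hgen' C) (i # is) (hbasis id) w = (0 :: 'a))
      \<and> op_word (hgen' C) (i # is) (hbasis id) id = (1 :: 'a)"
    proof -
      let ?h = "op_word (hgen' C) is (hbasis id) :: ('n, 'a) hecke"
      have "w \<notin> W K \<Longrightarrow> hgen C i ?h w = 0" for w by (rule hgen_support(1)[of i K ?h, OF p(1) ih(1)])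
      moreover have "hgen C i ?h id = 0" by (rule hgen_support(2)[of i K ?h, OF p(1) ih(1)])
      ultimately show ?thesis
        unfolding op_word_Cons comp_apply apply' ih(2) using ih(1) by simp
    qed
  qed
  obtain a where a: "set a \<subseteq> K" "wd a = longest C K" "length a = len (longest C K)"
    using red_exists_in[OF longest_props(1)] by blast
  have h: "length a = len (wd a)" using a by simp
  have "Tprime_longest K = op_word (hgen' C) a (hbasis id :: ('n, 'a) hecke)"
    by (simp only: Tprime_longest_def hT'_opw a(2)[symmetric] opw_red[OF word_indep_hgen' h])
  then show "w \<notin> W K \<Longrightarrow> Tprime_longest K w = (0 :: 'a)" "Tprime_longest K id = (1 :: 'a)" using word[OF a(1)] by simp_all
qed

definition hecke_el :: "'n weyl_elt \<Rightarrow> ('n, 'a::field) hecke" where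
  "hecke_el w = hT C w (Tprime_longest (- descent C w))"

definition descent_el :: "'n weyl_elt \<Rightarrow> ('n, 'a::field) laurent" where
  "descent_el w = demazure_bar_w C w (expw (weight_of_set (descent C w)))"

text \<open>No index of the complement is a descent of \<open>w\<close>, so lengths add for every
  \<open>u\<close> in that parabolic subgroup and T_w sends the basis element of \<open>u\<close> to
  that of \<open>w \<circ> u\<close>.\<close>

lemma hecke_el_eq:
  assumes w: "w \<in> W UNIV"
  shows "hecke_el w = (\<Sum>u\<in>W (- descent C w). hscale (Tprime_longest (- descent C w) u) (hbasis (w \<circ> u)) :: ('n, 'a::field) hecke)"
proof -
  let ?K = "- descent C w"
  have "Tprime_longest ?K \<in> hecke_alg C"
    using Tprime_longest_support(1)[of _ ?K] W_sub[of _ ?K] by (auto simp: hecke_alg_def)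
  then have "Tprime_longest ?K = (\<Sum>u\<in>W UNIV. hscale (Tprime_longest ?K u) (hbasis u) :: ('n, 'a) hecke)" by (rule hecke_expand)
  also have "\<dots> = (\<Sum>u\<in>W ?K. hscale (Tprime_longest ?K u) (hbasis u))"
    using finite_W W_sub by (intro sum.mono_neutral_right) (auto simp: Tprime_longest_support hscale_simps)
  finally have e: "Tprime_longest ?K = (\<Sum>u\<in>W ?K. hscale (Tprime_longest ?K u) (hbasis u) :: ('n, 'a) hecke)" .
  have "hecke_el w = (hT C w (\<Sum>u\<in>W ?K. hscale (Tprime_longest ?K u) (hbasis u)) :: ('n, 'a) hecke)"
    unfolding hecke_el_def by (rule arg_cong[OF e])
  also have "\<dots> = (\<Sum>u\<in>W ?K. hscale (Tprime_longest ?K u) (hT C w (hbasis u)))"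
    by (simp only: hlin_sum[OF hlin_hT] hlin_hscale[OF hlin_hT])
  also have "\<dots> = (\<Sum>u\<in>W ?K. hscale (Tprime_longest ?K u) (hbasis (w \<circ> u)))"
  proof (rule sum.cong[OF refl])
    fix u assume u: "u \<in> W ?K"
    have "len (w \<circ> u) = len w + len u"
      using not_descent_iff[OF w] by (intro len_par_add[OF w _ u]) auto
    then have "op_word (hgen C) (reduced_word_of C w) (hbasis u) = (hbasis (w \<circ> u) :: ('n, 'a) hecke)"
      using hgen_word_basis[OF W_sub[OF u], of "reduced_word_of C w", where 'a = 'a] red_word[OF w]
      by (simp only:)
    then show "hscale (Tprime_longest ?K u) (hT C w (hbasis u)) = (hscale (Tprime_longest ?K u) (hbasis (w \<circ> u)) :: ('n, 'a) hecke)"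
      by (simp only: hT_def)
  qed
  finally show ?thesis .
qed

lemma hecke_el_triangular:
  assumes w: "w \<in> W UNIV"
  shows "hecke_el w w = (1 :: 'a::field)" "v \<noteq> w \<Longrightarrow> hecke_el w v \<noteq> (0 :: 'a) \<Longrightarrow> len w < len v"
    "v \<notin> W UNIV \<Longrightarrow> hecke_el w v = (0 :: 'a)"
proof -
  let ?K = "- descent C w"
  have val: "hecke_el w v = (\<Sum>u\<in>W ?K. if v = w \<circ> u then Tprime_longest ?K u else (0 :: 'a))" for v
    unfolding hecke_el_eq[OF w] sum_hecke_apply by (rule sum.cong) (auto simp: hbasis_def)
  have "w = w \<circ> u \<longleftrightarrow> u = id" if "u \<in> W ?K" for u
  proof
    assume "w = w \<circ> u"
    then have "inv w \<circ> w = inv w \<circ> (w \<circ> u)" by (rule arg_cong)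
    then show "u = id" by (simp only: comp_assoc[symmetric] W_inv_comp[OF w] id_comp)
  qed simp
  then have "hecke_el w w = (\<Sum>u\<in>W ?K. if u = id then Tprime_longest ?K u else (0 :: 'a))"
    unfolding val by (intro sum.cong) auto
  then show "hecke_el w w = (1 :: 'a)" using finite_W_sub[of ?K] id_in_W[of ?K] Tprime_longest_support(2)[of ?K] by simp
  show "len w < len v" if ne: "v \<noteq> w" and nz: "hecke_el w v \<noteq> (0 :: 'a)"
  proof -
    obtain u where u: "u \<in> W ?K" "v = w \<circ> u"
      using sum.not_neutral_contains_not_neutral[OF nz[unfolded val]] by (metis (mono_tags, lifting))
    have "len (w \<circ> u) = len w + len u"
      using not_descent_iff[OF w] by (intro len_par_add[OF w _ u(1)]) auto
    moreover have "len u \<noteq> 0" using len_0[OF W_sub[OF u(1)]] u(2) ne by auto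
    ultimately show ?thesis using u(2) by simp
  qed
  show "hecke_el w v = (0 :: 'a)" if "v \<notin> W UNIV"
    unfolding val using that weyl_comp[OF w W_sub] by (intro sum.neutral) auto
qed

lemma hecke_el_alg: "w \<in> W UNIV \<Longrightarrow> hecke_el w \<in> hecke_alg C"
  by (simp add: hecke_alg_def hecke_el_triangular(3))

definition hecke_comb :: "('n weyl_elt \<Rightarrow> 'a::field) \<Rightarrow> ('n, 'a) hecke" where
  "hecke_comb c = (\<Sum>w\<in>W UNIV. hscale (c w) (hecke_el w))"

lemma hecke_comb_simps: "hecke_comb (\<lambda>w. c w + d w) = hecke_comb c + hecke_comb d" "hecke_comb (\<lambda>w. a * c w) = hscale a (hecke_comb c)"
  by (simp_all add: hecke_comb_def hscale_simps sum.distrib hscale_sum)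

lemma hecke_comb_single: "u \<in> W UNIV \<Longrightarrow> hecke_comb (\<lambda>w. if w = u then 1 else 0) = hecke_el u"
proof -
  assume u: "u \<in> W UNIV"
  have "hecke_comb (\<lambda>w. if w = u then 1 else 0) = (\<Sum>w\<in>W UNIV. if w = u then hecke_el w else 0)"
    unfolding hecke_comb_def by (rule sum.cong) (auto simp: hscale_simps)
  then show ?thesis using u finite_W by (simp add: sum.delta)
qed

lemma hecke_comb_inj:
  assumes "hecke_comb c = (0 :: ('n, 'a::field) hecke)" "w \<in> W UNIV"
  shows "c w = 0"
proof (rule ccontr)
  assume "c w \<noteq> 0"
  then obtain u where u: "u \<in> W UNIV" "c u \<noteq> 0" "\<And>v. v \<in> W UNIV \<Longrightarrow> c v \<noteq> 0 \<Longrightarrow> len u \<le> len v"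
    using ex_has_least_nat[of "\<lambda>w. w \<in> W UNIV \<and> c w \<noteq> 0" w len] assms(2) by blast
  have "hecke_comb c u = (\<Sum>w\<in>W UNIV. c w * hecke_el w u)" by (simp add: hecke_comb_def sum_hecke_apply)
  also have "\<dots> = (\<Sum>w\<in>W UNIV. if w = u then c w else 0)"
  proof (rule sum.cong[OF refl])
    fix v assume v: "v \<in> W UNIV"
    consider "v = u" | "c v = 0" | "v \<noteq> u" "c v \<noteq> 0" by blast
    then show "c v * hecke_el v u = (if v = u then c v else 0)"
    proof cases
      case 3
      then have "hecke_el v u = (0 :: 'a)" using hecke_el_triangular(2)[OF v, of u] u(3)[OF v] by force
      then show ?thesis using 3 by simp
    qed (auto simp: hecke_el_triangular(1)[OF u(1)])
  qed
  also have "\<dots> = c u" using u(1) finite_W by (simp add: sum.delta)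
  finally show False using assms(1) u(2) by simp
qed

text \<open>Downward induction on the length: apart from the basis element of \<open>w\<close>, only
  basis elements of greater length occur in \<open>hecke_el w\<close>.\<close>

lemma hecke_comb_surj:
  assumes "h \<in> hecke_alg C"
  shows "\<exists>c. h = hecke_comb (c :: _ \<Rightarrow> 'a::field)"
proof -
  define M where "M = Max (len ` W UNIV)"
  have M: "len w \<le> M" if "w \<in> W UNIV" for w
    unfolding M_def using finite_W that by (intro Max_ge) auto
  have comb: "\<exists>c. (\<Sum>v\<in>A. hscale (a v) (g v)) = hecke_comb (c :: _ \<Rightarrow> 'a)"
    if "\<And>v. v \<in> A \<Longrightarrow> a v \<noteq> 0 \<Longrightarrow> \<exists>c. g v = hecke_comb c" for A :: "'n weyl_elt set" and a :: "_ \<Rightarrow> 'a" and g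
  proof -
    have "\<exists>c. \<forall>v\<in>A. a v \<noteq> 0 \<longrightarrow> g v = hecke_comb (c v)" using that by metis
    then obtain c where c: "\<And>v. v \<in> A \<Longrightarrow> a v \<noteq> 0 \<Longrightarrow> g v = hecke_comb (c v)" by blast
    have "hscale (a v) (g v) = hscale (a v) (hecke_comb (c v))" if "v \<in> A" for v
      using c[OF that] by (cases "a v = 0") (simp_all add: hscale_simps)
    then have "(\<Sum>v\<in>A. hscale (a v) (g v)) = (\<Sum>v\<in>A. hscale (a v) (hecke_comb (c v)))" by (intro sum.cong) auto
    also have "\<dots> = hecke_comb (\<lambda>w. \<Sum>v\<in>A. a v * c v w)"
      by (rule ext)
        (simp add: hecke_comb_def sum_hecke_apply sum_distrib_left sum_distrib_right mult.assoc sum.swap[of _ A])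
    finally show ?thesis by blast
  qed
  have "\<exists>c. hbasis w = hecke_comb (c :: _ \<Rightarrow> 'a)" if "w \<in> W UNIV" for w
    using that
  proof (induction "M - len w" arbitrary: w rule: less_induct)
    case less
    define g where "g = (hecke_el w - hbasis w :: ('n, 'a) hecke)"
    have gw: "g w = 0" using hecke_el_triangular(1)[OF less.prems] by (simp add: g_def hbasis_def)
    have ga: "g \<in> hecke_alg C" using hecke_el_triangular(3)[OF less.prems] less.prems
      by (auto simp: hecke_alg_def g_def hbasis_def)
    have "\<exists>c. (\<Sum>v\<in>W UNIV. hscale (g v) (hbasis v)) = hecke_comb (c :: _ \<Rightarrow> 'a)"
    proof (rule comb)
      fix v assume v: "v \<in> W UNIV" "g v \<noteq> 0"
      then have "v \<noteq> w" using gw by auto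
      then have "hecke_el w v \<noteq> (0 :: 'a)" using v(2) by (auto simp: g_def hbasis_def)
      then have "len w < len v" using hecke_el_triangular(2)[OF less.prems \<open>v \<noteq> w\<close>] by blast
      then show "\<exists>c. hbasis v = hecke_comb (c :: _ \<Rightarrow> 'a)"
        using M[OF v(1)] by (intro less.hyps v(1) diff_less_mono2) auto
    qed
    then obtain c where c: "g = hecke_comb (c :: _ \<Rightarrow> 'a)" using hecke_expand[OF ga] by metis
    have "hbasis w = hecke_el w + hscale (-1) g" by (simp only: g_def hscale_simps) simp
    also have "\<dots> = hecke_comb (\<lambda>v. (if v = w then 1 else 0) + (-1) * c v)"
      unfolding hecke_comb_simps hecke_comb_single[OF less.prems] c ..
    finally show ?case by blast
  qed
  then have "\<exists>c. (\<Sum>w\<in>W UNIV. hscale (h w) (hbasis w)) = hecke_comb (c :: _ \<Rightarrow> 'a)" by (intro comb)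
  then show ?thesis using hecke_expand[OF assms] by metis
qed

section \<open>The comparison map and its equivariance\<close>

definition descent_comb :: "('n weyl_elt \<Rightarrow> 'a::field) \<Rightarrow> ('n, 'a) laurent" where
  "descent_comb c = lincomb (W UNIV) c descent_el"

lemma descent_comb_simps: "descent_comb (\<lambda>w. c w + d w) = descent_comb c + descent_comb d" "descent_comb (\<lambda>w. a * c w) = smult a (descent_comb c)"
  "descent_comb (\<lambda>w. c w - d w) = descent_comb c - descent_comb d"
proof -
  show add: "descent_comb (\<lambda>w. c w + d w) = descent_comb c + descent_comb d" for c d :: "_ \<Rightarrow> 'a"
    by (simp add: descent_comb_def lincomb_def smult_add_left sum.distrib)
  show "descent_comb (\<lambda>w. a * c w) = smult a (descent_comb c)"
    by (simp add: descent_comb_def lincomb_def smult_smult smult_sum)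
  show "descent_comb (\<lambda>w. c w - d w) = descent_comb c - descent_comb d"
    using add[of "\<lambda>w. c w - d w" d] by simp
qed

lemma descent_comb_cong: "(\<And>w. w \<in> W UNIV \<Longrightarrow> c w = d w) \<Longrightarrow> descent_comb c = descent_comb d"
  by (simp add: descent_comb_def lincomb_def)

lemma descent_comb_single: "u \<in> W UNIV \<Longrightarrow> descent_comb (\<lambda>w. if w = u then 1 else 0) = descent_el u"
proof -
  assume u: "u \<in> W UNIV"
  have "descent_comb (\<lambda>w. if w = u then 1 else 0) = (\<Sum>w\<in>W UNIV. if w = u then descent_el w else 0)"
    unfolding descent_comb_def lincomb_def by (rule sum.cong) auto
  then show ?thesis using u finite_W by (simp add: sum.delta)
qed

text \<open>The coefficients picked by \<open>SOME\<close> are determined only on the group, by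
  \<open>hecke_comb_inj\<close>, and \<open>descent_comb\<close> depends on these values alone. The
  target is the group algebra itself and not its quotient.\<close>

definition phi :: "('n, 'a::field) hecke \<Rightarrow> ('n, 'a) laurent" where
  "phi h = descent_comb (SOME c. h = hecke_comb c)"

lemma phi_hecke_comb: "phi (hecke_comb c) = descent_comb c"
proof -
  let ?d = "SOME d. hecke_comb c = hecke_comb d"
  have "hecke_comb c = hecke_comb ?d" by (rule someI[of "\<lambda>d. hecke_comb c = hecke_comb d" c]) (rule refl)
  then have "hecke_comb (\<lambda>w. c w + (-1) * ?d w) = 0"
    by (simp only: hecke_comb_simps(1) hecke_comb_simps(2)[of "-1" ?d] hscale_simps) simp
  then have "c w = ?d w" if "w \<in> W UNIV" for w using hecke_comb_inj[OF _ that] by fastforce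
  then show ?thesis unfolding phi_def by (intro descent_comb_cong) simp
qed

lemma phi_hecke_el: "w \<in> W UNIV \<Longrightarrow> phi (hecke_el w) = descent_el w"
  using phi_hecke_comb[of "\<lambda>v. if v = w then 1 else 0"] by (simp add: hecke_comb_single descent_comb_single)

lemma phi_add: "g \<in> hecke_alg C \<Longrightarrow> h \<in> hecke_alg C \<Longrightarrow> phi (g + h) = phi g + phi h"
proof -
  assume "g \<in> hecke_alg C" "h \<in> hecke_alg C"
  then obtain c d where "g = hecke_comb c" "h = hecke_comb d" using hecke_comb_surj by blast
  then show ?thesis by (simp only: hecke_comb_simps(1)[symmetric] phi_hecke_comb descent_comb_simps(1))
qed

lemma phi_hscale: "h \<in> hecke_alg C \<Longrightarrow> phi (hscale a h) = smult a (phi h)"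
proof -
  assume "h \<in> hecke_alg C"
  then obtain c where "h = hecke_comb c" using hecke_comb_surj by blast
  then show ?thesis by (simp only: hecke_comb_simps(2)[symmetric] phi_hecke_comb descent_comb_simps(2))
qed

lemma alg_closed: "g \<in> hecke_alg C \<Longrightarrow> h \<in> hecke_alg C \<Longrightarrow> g + h \<in> hecke_alg C"
  "h \<in> hecke_alg C \<Longrightarrow> hscale a h \<in> hecke_alg C" "0 \<in> hecke_alg C"
  by (simp_all add: hecke_alg_def)

lemma phi_zero: "phi 0 = 0"
  using phi_hscale[OF alg_closed(3), of 0] by (simp only: hscale_simps smult_0)

lemma phi_sum:
  assumes "\<And>x. x \<in> A \<Longrightarrow> g x \<in> hecke_alg C"
  shows "phi (\<Sum>x\<in>A. hscale (a x) (g x)) = (\<Sum>x\<in>A. smult (a x) (phi (g x))) \<and> (\<Sum>x\<in>A. hscale (a x) (g x)) \<in> hecke_alg C"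
  using assms
proof (induction A rule: infinite_finite_induct)
  case (infinite A)
  show "phi (\<Sum>x\<in>A. hscale (a x) (g x)) = (\<Sum>x\<in>A. smult (a x) (phi (g x))) \<and> (\<Sum>x\<in>A. hscale (a x) (g x)) \<in> hecke_alg C"
    unfolding sum.infinite[OF infinite(1)] by (intro conjI phi_zero alg_closed(3))
next
  case empty
  show "phi (\<Sum>x\<in>{}. hscale (a x) (g x)) = (\<Sum>x\<in>{}. smult (a x) (phi (g x))) \<and> (\<Sum>x\<in>{}. hscale (a x) (g x)) \<in> hecke_alg C"
    unfolding sum.empty by (intro conjI phi_zero alg_closed(3))
next
  case (insert x A)
  have p: "g x \<in> hecke_alg C" "\<And>x. x \<in> A \<Longrightarrow> g x \<in> hecke_alg C" using insert.prems by blast+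
  have i2: "phi (\<Sum>x\<in>A. hscale (a x) (g x)) = (\<Sum>x\<in>A. smult (a x) (phi (g x)))"
    by (rule conjunct1[OF insert.IH[OF p(2)]])
  have i3: "(\<Sum>x\<in>A. hscale (a x) (g x)) \<in> hecke_alg C" by (rule conjunct2[OF insert.IH[OF p(2)]])
  note i = p(1) i2 i3
  show "phi (\<Sum>x\<in>insert x A. hscale (a x) (g x)) = (\<Sum>x\<in>insert x A. smult (a x) (phi (g x)))
      \<and> (\<Sum>x\<in>insert x A. hscale (a x) (g x)) \<in> hecke_alg C"
    unfolding sum.insert[OF insert.hyps] phi_add[OF alg_closed(2)[OF i(1), of "a x"] i(3)] phi_hscale[OF i(1)] i(2)
    by (intro conjI refl alg_closed(1) alg_closed(2) i)
qed

lemma hT_kills: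
  assumes "w \<in> W UNIV" "j \<in> descent C w" "hgen C j y = 0"
  shows "hT C w y = 0"
  unfolding hT_opw opw_right[OF word_indep_hgen assms(1,2)] comp_apply assms(3)
  by (rule hlin_zero[OF hlin_hT, unfolded hT_opw])

lemma pib_kills:
  assumes "w \<in> W UNIV" "j \<in> descent C w" "j \<notin> I"
  shows "opw pib w (expw (weight_of_set I)) = (0 :: ('n, 'a::field) laurent)"
proof -
  have "pib j (expw (weight_of_set I)) = (0 :: ('n, 'a) laurent)" by (rule pib_0) (simp add: weight_of_set_def assms(3))
  then show ?thesis
    unfolding opw_right[OF word_indep_pib assms(1,2)] comp_apply by (simp only: lin_zero[OF lin_opw_pib])
qed

text \<open>If \<open>i\<close> is a left descent of \<open>w\<close>, the quadratic relation gives
  the sign. Otherwise the descents of \<open>s i \<circ> w\<close> include those of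
  \<open>w\<close>. With no new descent the result is the next basis element. With a new descent
  \<open>j\<close>, the operators of \<open>s i \<circ> w\<close> can be made to apply index
  \<open>j\<close> first: T_j kills T' of the complement, which contains \<open>j\<close>, and
  pibar_j kills the exponential, whose weight has coordinate 0 at \<open>j\<close>.\<close>

lemma module_step:
  assumes w: "w \<in> W UNIV"
  shows "(hgen C i (hecke_el w) = (- hecke_el w :: ('n, 'a::field) hecke) \<and> pib i (descent_el w) = (- descent_el w :: ('n, 'a) laurent))
    \<or> (hgen C i (hecke_el w) = (0 :: ('n, 'a) hecke) \<and> pib i (descent_el w) = (0 :: ('n, 'a) laurent))
    \<or> (hgen C i (hecke_el w) = (hecke_el (s i \<circ> w) :: ('n, 'a) hecke) \<and> pib i (descent_el w) = (descent_el (s i \<circ> w) :: ('n, 'a) laurent)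
      \<and> s i \<circ> w \<in> W UNIV \<and> descent C (s i \<circ> w) = descent C w)"
    (is "?down \<or> ?kill \<or> ?up")
proof -
  let ?I = "descent C w"
  let ?u = "s i \<circ> w"
  have u: "?u \<in> W UNIV" by (simp add: W_s_comp w)
  show ?thesis
  proof (cases rule: len_s_comp_cases[OF w, of i])
    case 2
    show ?thesis
    proof (intro disjI1 conjI)
      have "hgen C i (hgen C i x) = uminus (hgen C i x)" for x :: "('n, 'a) hecke" by (rule hgen_hgen)
      from opw_idem_left[where f = "hgen C" and g = uminus, OF word_indep_hgen w 2(1) this]
      show "hgen C i (hecke_el w) = (- hecke_el w :: ('n, 'a) hecke)" unfolding hecke_el_def hT_opw .
      have "pib i (pib i x) = uminus (pib i x)" for x :: "('n, 'a) laurent" by (rule pib_pib)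
      from opw_idem_left[where f = pib and g = uminus, OF word_indep_pib w 2(1) this]
      show "pib i (descent_el w) = (- descent_el w :: ('n, 'a) laurent)" unfolding descent_el_def demazure_bar_w_opw .
    qed
  next
    case 1
    have h: "hgen C i (hecke_el w) = (hT C ?u (Tprime_longest (- ?I)) :: ('n, 'a) hecke)"
      by (simp only: hecke_el_def hT_opw opw_left[OF word_indep_hgen w 1(2)] comp_apply)
    have p: "pib i (descent_el w) = (opw pib ?u (expw (weight_of_set ?I)) :: ('n, 'a) laurent)"
      by (simp only: descent_el_def demazure_bar_w_opw opw_left[OF word_indep_pib w 1(2)] comp_apply)
    have sub: "?I \<subseteq> descent C ?u" by (rule descent_mono[OF w 1(2)])
    show ?thesis
    proof (cases "descent C ?u = ?I")
      case True
      have ?up using h p u True by (simp only: hecke_el_def descent_el_def demazure_bar_w_opw)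
      then show ?thesis by blast
    next
      case False
      then obtain j where j: "j \<in> descent C ?u" "j \<notin> ?I" using sub by blast
      have "j \<in> - ?I" using j by simp
      have ?kill unfolding h p by (intro conjI hT_kills[OF u j(1) hgen_Tprime_longest[OF \<open>j \<in> - ?I\<close>]] pib_kills[OF u j])
      then show ?thesis by blast
    qed
  qed
qed

text \<open>Equivariance holds in the group algebra itself, not only modulo the ideal, since
  \<open>module_step\<close> describes both actions on corresponding basis elements by the same
  three cases.\<close>

lemma phi_hgen:
  assumes "h \<in> hecke_alg C"
  shows "phi (hgen C i h) = pib i (phi (h :: ('n, 'a::field) hecke))"
proof -
  obtain c where c: "h = hecke_comb (c :: _ \<Rightarrow> 'a)" using hecke_comb_surj[OF assms] by blast
  have y: "(hgen C i (hecke_el w) :: ('n, 'a) hecke) \<in> hecke_alg C \<and> phi (hgen C i (hecke_el w)) = pib i (descent_el w :: ('n, 'a) laurent)"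
    if w: "w \<in> W UNIV" for w
  proof -
    consider (down) "hgen C i (hecke_el w) = (- hecke_el w :: ('n, 'a) hecke)" "pib i (descent_el w) = (- descent_el w :: ('n, 'a) laurent)"
      | (kill) "hgen C i (hecke_el w) = (0 :: ('n, 'a) hecke)" "pib i (descent_el w) = (0 :: ('n, 'a) laurent)"
      | (up) "hgen C i (hecke_el w) = (hecke_el (s i \<circ> w) :: ('n, 'a) hecke)" "pib i (descent_el w) = (descent_el (s i \<circ> w) :: ('n, 'a) laurent)"
        "s i \<circ> w \<in> W UNIV"
      using module_step[OF w, of i] by blast
    then show ?thesis
    proof cases
      case down
      then have e: "hgen C i (hecke_el w) = (hscale (-1) (hecke_el w) :: ('n, 'a) hecke)" by (simp only: hscale_simps)
      show ?thesis unfolding e down(2)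
        by (simp only: phi_hscale[OF hecke_el_alg[OF w]] phi_hecke_el[OF w] alg_closed(2)[OF hecke_el_alg[OF w]]
            smult_minus_left smult_1 simp_thms)
    next
      case kill
      show ?thesis unfolding kill by (intro conjI phi_zero alg_closed(3))
    next
      case up
      show ?thesis unfolding up(1,2) by (intro conjI hecke_el_alg phi_hecke_el up(3))
    qed
  qed
  have "phi (hgen C i h) = (\<Sum>w\<in>W UNIV. smult (c w) (phi (hgen C i (hecke_el w))))"
    using phi_sum[of "W UNIV" "\<lambda>w. hgen C i (hecke_el w)" c] y
    by (simp add: c hecke_comb_def hlin_sum[OF hlin_hgen] hlin_hscale[OF hlin_hgen])
  also have "\<dots> = pib i (\<Sum>w\<in>W UNIV. smult (c w) (descent_el w))"
    using y by (simp add: lin_sum[OF lin_pib] lin_smult[OF lin_pib])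
  finally show ?thesis by (simp add: c phi_hecke_comb) (simp add: descent_comb_def lincomb_def)
qed

section \<open>The basis of the coinvariant algebra\<close>

lemma stab_fund: "w \<in> W UNIV \<Longrightarrow> w (fund_weight i) = fund_weight i \<Longrightarrow> w \<in> W (- {i})"
proof -
  assume "w \<in> W UNIV" "w (fund_weight i) = fund_weight i"
  then have "w \<in> W {j \<in> UNIV. (fund_weight i :: 'n weight) j = 0}"
    using dominant_stab[of w UNIV "fund_weight i"] fund_dominant[of UNIV i] by simp
  moreover have "{j \<in> UNIV. (fund_weight i :: 'n weight) j = 0} = - {i}" by (auto simp: fund_weight_def)
  ultimately show ?thesis by simp
qed

text \<open>The stabilizer of the fundamental weight of \<open>i\<close> is the parabolic subgroup
  omitting \<open>i\<close>. So cosets correspond to the weights of the orbit, and the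
  representative chosen in \<open>a_gen\<close> does not matter.\<close>

lemma a_gen_orbit_sum: "a_gen C i = (orbit_sum UNIV i :: ('n, 'a::field) laurent)"
proof -
  let ?f = "\<lambda>c :: 'n weyl_elt set. (SOME w. w \<in> c) (fund_weight i)"
  let ?c = "\<lambda>w. (\<lambda>v. w \<circ> v) ` W (- {i})"
  have f: "?f (?c w) = w (fund_weight i)" if "w \<in> W UNIV" for w
  proof -
    have "w \<circ> id \<in> ?c w" by (rule imageI) (rule id_in_W)
    then have "(SOME x. x \<in> ?c w) \<in> ?c w" by (rule someI[of "\<lambda>x. x \<in> ?c w" "w \<circ> id"])
    then obtain v where v: "v \<in> W (- {i})" "(SOME x. x \<in> ?c w) = w \<circ> v" by blast
    have "v (fund_weight i) = fund_weight i" by (rule W_fix[OF v(1)]) (simp add: fund_weight_def)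
    then show ?thesis using v(2) by simp
  qed
  have cos: "?c w = ?c w'" if w: "w \<in> W UNIV" "w' \<in> W UNIV" and eq: "w (fund_weight i) = w' (fund_weight i)" for w w'
  proof -
    have sub: "?c u \<subseteq> ?c u'" if u: "u \<in> W UNIV" "u' \<in> W UNIV" and e: "u (fund_weight i) = u' (fund_weight i)" for u u'
    proof
      fix x assume "x \<in> ?c u"
      then obtain v where v: "v \<in> W (- {i})" "x = u \<circ> v" by blast
      have "inv u' \<circ> u \<in> W (- {i})"
        using u e by (intro stab_fund weyl_comp W_inv) simp_all
      then have "inv u' \<circ> u \<circ> v \<in> W (- {i})" using v(1) by (rule weyl_comp)
      moreover have "x = u' \<circ> (inv u' \<circ> u \<circ> v)"
        by (rule ext) (simp add: v(2) W_inv_apply(2)[OF u(2)])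
      ultimately show "x \<in> ?c u'" by blast
    qed
    show ?thesis using sub[OF w eq] sub[OF w(2,1) eq[symmetric]] by blast
  qed
  have lc: "left_cosets_par C (- {i}) = ?c ` W UNIV" by (auto simp: left_cosets_par_def)
  have "inj_on ?f (left_cosets_par C (- {i}))"
  proof (rule inj_onI)
    fix c c' assume "c \<in> left_cosets_par C (- {i})" "c' \<in> left_cosets_par C (- {i})" and e: "?f c = ?f c'"
    then obtain w w' where w: "w \<in> W UNIV" "w' \<in> W UNIV" "c = ?c w" "c' = ?c w'" unfolding lc by blast
    have "w (fund_weight i) = w' (fund_weight i)" using e unfolding w(3,4) f[OF w(1)] f[OF w(2)] .
    then show "c = c'" unfolding w(3,4) by (rule cos[OF w(1,2)])
  qed
  moreover have "?f ` left_cosets_par C (- {i}) = (\<lambda>w. w (fund_weight i)) ` W UNIV"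
  proof -
    from lc have "?f ` left_cosets_par C (- {i}) = (\<lambda>w. ?f (?c w)) ` W UNIV" by (simp only: image_image)
    also have "\<dots> = (\<lambda>w. w (fund_weight i)) ` W UNIV" by (rule image_cong[OF refl f])
    finally show ?thesis .
  qed
  ultimately have "(\<Sum>c\<in>left_cosets_par C (- {i}). expw (?f c))
      = (\<Sum>\<kappa>\<in>(\<lambda>w. w (fund_weight i)) ` W UNIV. expw \<kappa> :: ('n, 'a) laurent)"
    using sum.reindex[of ?f "left_cosets_par C (- {i})" "expw :: _ \<Rightarrow> ('n, 'a) laurent"]
    by (simp only: comp_def)
  then show ?thesis unfolding a_gen_def orbit_sum_def .
qed

abbreviation J :: "('n, 'a::field) laurent set" where "J \<equiv> coinv_ideal C"

lemma J_add: "f \<in> J \<Longrightarrow> g \<in> J \<Longrightarrow> f + g \<in> J"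
proof -
  assume "f \<in> J" "g \<in> J"
  then obtain a b where "f = (\<Sum>i\<in>UNIV. a i * a_gen C i)" "g = (\<Sum>i\<in>UNIV. b i * a_gen C i)"
    by (auto simp: coinv_ideal_def)
  then have "f + g = (\<Sum>i\<in>UNIV. (a i + b i) * a_gen C i)" by (simp add: distrib_right sum.distrib)
  then show ?thesis unfolding coinv_ideal_def by (auto intro!: exI[of _ "\<lambda>i. a i + b i"])
qed

lemma J_mult: "f \<in> J \<Longrightarrow> g * f \<in> J"
proof -
  assume "f \<in> J"
  then obtain a where "f = (\<Sum>i\<in>UNIV. a i * a_gen C i)" by (auto simp: coinv_ideal_def)
  then have "g * f = (\<Sum>i\<in>UNIV. (g * a i) * a_gen C i)" by (simp add: sum_distrib_left mult.assoc)
  then show ?thesis unfolding coinv_ideal_def by (auto intro!: exI[of _ "\<lambda>i. g * a i"])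
qed

lemma J_zero: "0 \<in> J"
  by (auto simp: coinv_ideal_def intro!: exI[of _ "\<lambda>_. 0"])

lemma J_smult: "f \<in> J \<Longrightarrow> smult c f \<in> J"
  unfolding smult_conv by (rule J_mult)

lemma J_minus: "f \<in> J \<Longrightarrow> - f \<in> J"
  using J_mult[of f "-1"] by simp

lemma J_diff: "f \<in> J \<Longrightarrow> g \<in> J \<Longrightarrow> f - g \<in> J"
  using J_add[of f "- g"] J_minus[of g] by simp

lemma J_sum: "(\<And>x. x \<in> A \<Longrightarrow> f x \<in> J) \<Longrightarrow> (\<Sum>x\<in>A. f x) \<in> J"
  by (induction A rule: infinite_finite_induct) (auto intro: J_zero J_add)

lemma J_gen: "orbit_sum UNIV i * g \<in> J"
proof -
  have "(\<Sum>j\<in>UNIV. (if j = i then g else 0) * a_gen C j) = g * a_gen C i"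
    by (simp add: if_distrib[of "\<lambda>x. x * _"] cong: if_cong)
  then show ?thesis unfolding coinv_ideal_def a_gen_orbit_sum[symmetric]
    by (auto intro!: exI[of _ "\<lambda>j. if j = i then g else 0"] simp: mult.commute)
qed

lemma lead_descent_el:
  assumes "w \<in> W UNIV"
  shows "lead UNIV (w (weight_of_set (descent C w))) (descent_el w)"
proof -
  let ?r = "reduced_word_of C w"
  have r: "wd ?r = w" "length ?r = len w" using red_word[OF assms] by blast+
  have "length ?r = len (wd ?r)" using r by simp
  from pib_word_lead'[OF subset_UNIV this] show ?thesis
    unfolding r descent_el_def demazure_bar_w_def .
qed

definition lead_el :: "'n weight \<Rightarrow> ('n, 'a::field) laurent" where "lead_el = lead_family descent_el UNIV"

lemma lead_lead_el: "lead UNIV \<nu> (lead_el \<nu>)"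
  unfolding lead_el_def by (rule lead_lead_family) (rule lead_descent_el)

text \<open>Exponent vector of the monomial in orbit sums that occurs in
  \<open>lead_el \<nu>\<close>. Where it vanishes, \<open>lead_el \<nu>\<close> is one of the
  \<open>descent_el\<close>.\<close>

definition excess :: "'n weight \<Rightarrow> 'n weight" where
  "excess \<nu> = dom_rep UNIV \<nu> - weight_of_set (descent C (min_elt UNIV \<nu>))"

lemma lead_el_eq: "lead_el \<nu> = mon UNIV (excess \<nu>) * descent_el (min_elt UNIV \<nu>)"
  by (simp add: lead_el_def lead_family_def excess_def)

lemma excess_nonneg: "0 \<le> excess \<nu> i"
  using dom_rep_props(1)[of UNIV \<nu>] min_elt_descent[of i UNIV \<nu>]
  by (force simp: excess_def dominant_def weight_of_set_def)

lemma mon_UNIV: "mon UNIV \<mu> = (\<Prod>i\<in>UNIV. orbit_sum UNIV i ^ nat (\<mu> i))"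
  by (simp add: mon_def expw_0[unfolded zero_fun_def])

lemma mon_0: "mon UNIV 0 = 1"
  by (simp add: mon_UNIV)

lemma mon_Suc:
  assumes "\<And>j. 0 \<le> \<mu> j"
  shows "orbit_sum UNIV i * mon UNIV \<mu> = (mon UNIV (\<mu> + fund_weight i) :: ('n, 'a::field) laurent)"
proof -
  have "mon UNIV (\<mu> + fund_weight i)
      = (\<Prod>j\<in>UNIV. (if j = i then orbit_sum UNIV j else 1) * orbit_sum UNIV j ^ nat (\<mu> j) :: ('n, 'a) laurent)"
    unfolding mon_UNIV using assms
    by (intro prod.cong) (auto simp: fund_weight_def nat_add_distrib)
  then show ?thesis by (simp add: prod.distrib mon_UNIV)
qed

text \<open>Multiplication by a generator of the ideal sends each \<open>lead_el\<close> exactly to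
  another one, not just in its leading term: one exponent rises by 1 and the group element stays the
  same.\<close>

lemma orbit_sum_lead_el: "orbit_sum UNIV i * lead_el \<nu> = lead_el (\<nu> + min_elt UNIV \<nu> (fund_weight i))"
  "excess (\<nu> + min_elt UNIV \<nu> (fund_weight i)) = excess \<nu> + fund_weight i"
proof -
  let ?\<nu>' = "\<nu> + min_elt UNIV \<nu> (fund_weight i)"
  note sh = shift_props[OF fund_dominant[of UNIV i], of \<nu>]
  show m: "excess ?\<nu>' = excess \<nu> + fund_weight i" unfolding excess_def sh by (simp only: add_diff_eq diff_add_eq)
  show "orbit_sum UNIV i * lead_el \<nu> = lead_el ?\<nu>'"
    unfolding lead_el_eq m sh mult.assoc[symmetric] mon_Suc[OF excess_nonneg] ..
qed

text \<open>The linear map taking the exponential of \<open>\<nu>\<close> to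
  \<open>lead_el \<nu>\<close>. Linear independence of the infinite family thus becomes injectivity
  of a map.\<close>

definition lead_sum :: "('n, 'a::field) laurent \<Rightarrow> ('n, 'a) laurent" where
  "lead_sum d = (\<Sum>\<nu>\<in>keys d. smult (lookup d \<nu>) (lead_el \<nu>))"

lemma lead_sum_superset:
  assumes "finite S" "keys d \<subseteq> S"
  shows "lead_sum d = (\<Sum>\<nu>\<in>S. smult (lookup d \<nu>) (lead_el \<nu>))"
  unfolding lead_sum_def using assms by (intro sum.mono_neutral_left) (auto simp: in_keys_iff)

lemma lin_lead_sum: "lin lead_sum"
proof (rule linI)
  fix f g :: "('n, 'a::field) laurent" and c :: 'a
  let ?S = "keys f \<union> keys g"
  have "lead_sum (f + g) = (\<Sum>\<mu>\<in>?S. smult (lookup (f + g) \<mu>) (lead_el \<mu>))"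
    by (rule lead_sum_superset) (auto dest: subsetD[OF keys_add])
  then show "lead_sum (f + g) = lead_sum f + lead_sum g"
    using lead_sum_superset[of ?S f] lead_sum_superset[of ?S g] by (simp add: lookup_add smult_add_left sum.distrib)
  have "lead_sum (smult c f) = (\<Sum>\<mu>\<in>keys f. smult (lookup (smult c f) \<mu>) (lead_el \<mu>))"
    by (rule lead_sum_superset) (auto simp: in_keys_iff lookup_smult)
  then show "lead_sum (smult c f) = smult c (lead_sum f)"
    by (simp add: lead_sum_def smult_sum smult_smult lookup_smult)
qed

lemma lead_sum_expw: "lead_sum (expw \<nu>) = lead_el \<nu>"
  by (simp add: lead_sum_def keys_expw lookup_expw)

text \<open>A maximal weight of the support exists because the order restricted to a finite set has
  a well-founded converse. No \<open>lead_el\<close> of another weight in the support contributes at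
  this weight, so its coefficient survives.\<close>

lemma lead_sum_inj:
  assumes "lead_sum d = (0 :: ('n, 'a::field) laurent)"
  shows "d = 0"
proof (rule ccontr)
  assume "d \<noteq> 0"
  then obtain \<nu>0 where "\<nu>0 \<in> keys d" by (metis keys_eq_empty ex_in_conv)
  let ?r = "{(\<kappa>, \<nu>). prec UNIV \<kappa> \<nu>} \<inter> keys d \<times> keys d"
  have "finite ?r" by simp
  moreover have "wf ?r" by (rule wf_subset[OF wf_prec[of UNIV]]) auto
  ultimately have "wf (?r\<inverse>)" by (intro finite_acyclic_wf_converse wf_acyclic)
  then obtain \<nu> where \<nu>: "\<nu> \<in> keys d" "\<And>\<kappa>. (\<kappa>, \<nu>) \<in> ?r\<inverse> \<Longrightarrow> \<kappa> \<notin> keys d"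
    using wfE_min[OF _ \<open>\<nu>0 \<in> keys d\<close>] by metis
  have B\<nu>: "lookup (lead_el \<nu>) \<nu> = (1 :: 'a)"
  proof -
    have "\<nu> \<notin> keys (lead_el \<nu> - expw \<nu> :: ('n, 'a) laurent)"
      using lead_lead_el[of \<nu>] prec_irrefl[of UNIV \<nu>] by (auto simp: lead_def)
    then show ?thesis by (simp add: in_keys_iff lookup_minus lookup_expw)
  qed
  have B\<kappa>: "lookup (lead_el \<kappa>) \<nu> = (0 :: 'a)" if "\<kappa> \<in> keys d" "\<kappa> \<noteq> \<nu>" for \<kappa>
  proof -
    have "\<not> prec UNIV \<nu> \<kappa>" using \<nu> that by blast
    then have "\<nu> \<notin> keys (lead_el \<kappa> - expw \<kappa> :: ('n, 'a) laurent)"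
      using lead_lead_el[of \<kappa>] by (auto simp: lead_def)
    then show ?thesis using that by (simp add: in_keys_iff lookup_minus lookup_expw)
  qed
  have "lookup (lead_sum d) \<nu> = (\<Sum>\<kappa>\<in>keys d. lookup d \<kappa> * lookup (lead_el \<kappa>) \<nu>)"
    by (simp add: lead_sum_def lookup_sum lookup_smult)
  also have "\<dots> = (\<Sum>\<kappa>\<in>keys d. if \<kappa> = \<nu> then lookup d \<kappa> else 0)"
    by (rule sum.cong) (auto simp: B\<nu> B\<kappa>)
  also have "\<dots> = lookup d \<nu>" using \<nu>(1) by (simp add: sum.delta)
  finally show False using assms \<nu>(1) by (simp add: in_keys_iff)
qed

text \<open>Span of the \<open>lead_el\<close> with nonconstant monomial, written through
  \<open>lead_sum\<close> so that the support of \<open>d\<close> records which of them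
  occur.\<close>

definition in_augmentation :: "('n, 'a::field) laurent \<Rightarrow> bool" where
  "in_augmentation f \<longleftrightarrow> (\<exists>d. keys d \<subseteq> {\<nu>. excess \<nu> \<noteq> 0} \<and> f = lead_sum d)"

lemma in_augmentation_add: "in_augmentation f \<Longrightarrow> in_augmentation g \<Longrightarrow> in_augmentation (f + g)"
proof -
  assume "in_augmentation f" "in_augmentation g"
  then obtain d e where "keys d \<subseteq> {\<nu>. excess \<nu> \<noteq> 0}" "f = lead_sum d" "keys e \<subseteq> {\<nu>. excess \<nu> \<noteq> 0}" "g = lead_sum e"
    by (auto simp: in_augmentation_def)
  then show ?thesis unfolding in_augmentation_def
    by (intro exI[of _ "d + e"] conjI order_trans[OF keys_add] Un_least) (simp_all add: lin_add[OF lin_lead_sum])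
qed

lemma in_augmentation_smult: "in_augmentation f \<Longrightarrow> in_augmentation (smult c f)"
proof -
  assume "in_augmentation f"
  then obtain d where "keys d \<subseteq> {\<nu>. excess \<nu> \<noteq> 0}" "f = lead_sum d" by (auto simp: in_augmentation_def)
  then show ?thesis unfolding in_augmentation_def
    by (intro exI[of _ "smult c d"] conjI order_trans[OF keys_smult]) (simp_all add: lin_smult[OF lin_lead_sum])
qed

lemma orbit_sum_in_augmentation: "in_augmentation (orbit_sum UNIV i * g)"
proof (rule lead_span[of UNIV lead_el "\<lambda>g. in_augmentation (orbit_sum UNIV i * g)"])
  show "in_augmentation (orbit_sum UNIV i * lead_el \<nu>)" for \<nu>
  proof -
    have "excess (\<nu> + min_elt UNIV \<nu> (fund_weight i)) i > 0"
      using excess_nonneg[of \<nu> i] unfolding orbit_sum_lead_el by (simp add: fund_weight_def)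
    then have "excess (\<nu> + min_elt UNIV \<nu> (fund_weight i)) \<noteq> 0" by (metis less_irrefl zero_fun_apply)
    then show ?thesis unfolding in_augmentation_def
      by (intro exI[of _ "expw (\<nu> + min_elt UNIV \<nu> (fund_weight i))"]) (simp add: keys_expw lead_sum_expw orbit_sum_lead_el)
  qed
qed (simp_all add: lead_lead_el distrib_left smult_mult in_augmentation_add in_augmentation_smult)

lemma J_in_augmentation: "f \<in> J \<Longrightarrow> in_augmentation f"
proof -
  have zero: "in_augmentation 0" unfolding in_augmentation_def by (rule exI[of _ 0]) (simp add: lin_zero[OF lin_lead_sum])
  have "in_augmentation (\<Sum>i\<in>A. g i * a_gen C i)" for A and g :: "'n \<Rightarrow> ('n, 'a::field) laurent"
    by (induction A rule: infinite_finite_induct)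
      (simp_all add: zero in_augmentation_add a_gen_orbit_sum mult.commute[of _ "orbit_sum UNIV _"] orbit_sum_in_augmentation)
  then show "f \<in> J \<Longrightarrow> in_augmentation f" by (auto simp: coinv_ideal_def)
qed

lemma min_elt_excess_basis:
  assumes "w \<in> W UNIV"
  shows "min_elt UNIV (w (weight_of_set (descent C w))) = w" "excess (w (weight_of_set (descent C w))) = 0"
  unfolding excess_def descent_weight[OF assms] by simp_all

lemma lead_el_basis: "w \<in> W UNIV \<Longrightarrow> lead_el (w (weight_of_set (descent C w))) = descent_el w"
  by (simp add: lead_el_eq min_elt_excess_basis mon_0)

text \<open>An element of the ideal is \<open>lead_sum\<close> of something supported where
  \<open>excess\<close> is nonzero, whereas a combination of the \<open>descent_el\<close> comes
  from weights with zero \<open>excess\<close>. Injectivity makes the two preimages equal, and their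
  supports are disjoint.\<close>

lemma descent_comb_indep:
  assumes "descent_comb c \<in> (J :: ('n, 'a::field) laurent set)" "w \<in> W UNIV"
  shows "c w = 0"
proof -
  let ?n = "\<lambda>w. w (weight_of_set (descent C w)) :: 'n weight"
  obtain d where d: "keys d \<subseteq> {\<nu>. excess \<nu> \<noteq> 0}" "descent_comb c = lead_sum d" using J_in_augmentation[OF assms(1)] by (auto simp: in_augmentation_def)
  define e where "e = (\<Sum>u\<in>W UNIV. smult (c u) (expw (?n u)))"
  have "lead_sum e = descent_comb c"
    by (simp add: e_def lin_sum[OF lin_lead_sum] lin_smult[OF lin_lead_sum] lead_sum_expw lead_el_basis descent_comb_def lincomb_def)
  then have "lead_sum (e - d) = 0" using d by (simp add: lin_diff[OF lin_lead_sum])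
  then have "e = d" using lead_sum_inj by fastforce
  then have "lookup e (?n w) = 0" using d(1) min_elt_excess_basis(2)[OF assms(2)] by (auto simp: in_keys_iff)
  moreover have "lookup e (?n w) = (\<Sum>u\<in>W UNIV. if u = w then c u else 0)"
    unfolding e_def lookup_sum lookup_smult lookup_expw
  proof (rule sum.cong[OF refl])
    fix u assume u: "u \<in> W UNIV"
    have "?n u = ?n w \<longleftrightarrow> u = w" using min_elt_excess_basis(1)[OF u] min_elt_excess_basis(1)[OF assms(2)] by metis
    then show "c u * (if ?n u = ?n w then 1 else 0) = (if u = w then c u else 0)" by simp
  qed
  ultimately show ?thesis using assms(2) finite_W by (simp add: sum.delta)
qed

text \<open>A positive exponent at \<open>i\<close> lets the generator
  \<open>orbit_sum UNIV i\<close> be split off, so modulo the ideal only the \<open>lead_el\<close>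
  with zero exponents survive.\<close>

lemma descent_comb_span: "\<exists>c. f - descent_comb c \<in> (J :: ('n, 'a::field) laurent set)"
proof (rule lead_span[of UNIV lead_el "\<lambda>f. \<exists>c. f - descent_comb c \<in> J"])
  show "lead UNIV \<nu> (lead_el \<nu>)" for \<nu> by (rule lead_lead_el)
  show "\<exists>c. lead_el \<nu> - descent_comb c \<in> (J :: ('n, 'a) laurent set)" for \<nu>
  proof (cases "excess \<nu> = 0")
    case True
    then have "lead_el \<nu> = descent_el (min_elt UNIV \<nu>)" by (simp add: lead_el_eq mon_0)
    also have "\<dots> = descent_comb (\<lambda>w. if w = min_elt UNIV \<nu> then 1 else 0)" using descent_comb_single min_elt_props(1) by metis
    finally show ?thesis using J_zero by (metis diff_self)
  next
    case False
    then obtain i where "excess \<nu> i \<noteq> 0" by (metis ext zero_fun_apply)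
    then have i: "0 < excess \<nu> i" using excess_nonneg[of \<nu> i] by simp
    let ?m = "excess \<nu> - fund_weight i"
    have "0 \<le> ?m j" for j using excess_nonneg[of \<nu> j] i by (auto simp: fund_weight_def)
    then have "orbit_sum UNIV i * mon UNIV ?m = (mon UNIV (?m + fund_weight i) :: ('n, 'a) laurent)" by (rule mon_Suc)
    then have "mon UNIV (excess \<nu>) = orbit_sum UNIV i * (mon UNIV ?m :: ('n, 'a) laurent)" by simp
    then have "lead_el \<nu> = orbit_sum UNIV i * (mon UNIV ?m * descent_el (min_elt UNIV \<nu>) :: ('n, 'a) laurent)" by (simp add: lead_el_eq mult.assoc)
    then have "lead_el \<nu> \<in> (J :: ('n, 'a) laurent set)" using J_gen by metis
    moreover have "descent_comb (\<lambda>_. 0) = (0 :: ('n, 'a) laurent)" by (simp add: descent_comb_def lincomb_def)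
    ultimately show ?thesis by (metis diff_zero)
  qed
next
  fix f g :: "('n, 'a) laurent"
  assume "\<exists>c. f - descent_comb c \<in> J" "\<exists>c. g - descent_comb c \<in> J"
  then obtain c d where "f - descent_comb c \<in> J" "g - descent_comb d \<in> J" by blast
  from J_add[OF this] have "(f - descent_comb c) + (g - descent_comb d) \<in> J" .
  also have "(f - descent_comb c) + (g - descent_comb d) = f + g - descent_comb (\<lambda>w. c w + d w)"
    by (simp add: descent_comb_simps(1))
  finally have "f + g - descent_comb (\<lambda>w. c w + d w) \<in> J" .
  then show "\<exists>c. f + g - descent_comb c \<in> J" by blast
next
  fix a :: 'a and f :: "('n, 'a) laurent"
  assume "\<exists>c. f - descent_comb c \<in> J"
  then obtain c where "f - descent_comb c \<in> J" by blast
  from J_smult[OF this, of a] have "smult a f - descent_comb (\<lambda>w. a * c w) \<in> J" by (simp only: descent_comb_simps(2) smult_diff)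
  then show "\<exists>c. smult a f - descent_comb c \<in> J" by blast
qed

section \<open>The summands\<close>

text \<open>Values outside the group are left free, since neither \<open>hecke_comb\<close> nor
  \<open>descent_comb\<close> sees them.\<close>

definition only_desc :: "'n set \<Rightarrow> ('n weyl_elt \<Rightarrow> 'a::field) \<Rightarrow> bool" where
  "only_desc I c \<longleftrightarrow> (\<forall>w\<in>W UNIV. descent C w \<noteq> I \<longrightarrow> c w = 0)"

abbreviation summand :: "'n set \<Rightarrow> ('n, 'a::field) laurent set" where
  "summand I \<equiv> cyclic_mod C (demazure_bar_w C (longest C I) (expw (weight_of_set I)))"

lemma only_desc_closed: "only_desc I c \<Longrightarrow> only_desc I d \<Longrightarrow> only_desc I (\<lambda>w. c w + d w)"
  "only_desc I c \<Longrightarrow> only_desc I (\<lambda>w. a * c w)"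
  by (simp_all add: only_desc_def)

lemma only_desc_single: "descent C u = I \<Longrightarrow> only_desc I (\<lambda>w. if w = u then 1 else 0)"
  by (simp add: only_desc_def)

lemma lincomb_desc:
  "lincomb {w \<in> W UNIV. descent C w = I} c (\<lambda>w. demazure_bar_w C w (expw (weight_of_set I)))
    = descent_comb (\<lambda>w. if descent C w = I then c w else 0)"
proof -
  have "lincomb {w \<in> W UNIV. descent C w = I} c (\<lambda>w. demazure_bar_w C w (expw (weight_of_set I)))
      = (\<Sum>w\<in>{w \<in> W UNIV. descent C w = I}. smult (c w) (descent_el w))"
    unfolding lincomb_def by (rule sum.cong) (auto simp: descent_el_def)
  also have "\<dots> = (\<Sum>w\<in>W UNIV. if descent C w = I then smult (c w) (descent_el w) else 0)"
    using finite_W by (simp add: sum.inter_filter)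
  also have "\<dots> = descent_comb (\<lambda>w. if descent C w = I then c w else 0)"
    unfolding descent_comb_def lincomb_def by (rule sum.cong) auto
  finally show ?thesis .
qed

lemma descent_comb_only_desc: "only_desc I c \<Longrightarrow> descent_comb c = descent_comb (\<lambda>w. if descent C w = I then c w else 0)"
  by (rule descent_comb_cong) (simp add: only_desc_def)

text \<open>One coefficient function \<open>d\<close> describes the result in both modules, and its
  support stays in the descent class because the only step of \<open>module_step\<close> that
  reaches a new element keeps the descent set.\<close>

lemma only_desc_hgen:
  fixes c :: "'n weyl_elt \<Rightarrow> 'a::field"
  assumes "only_desc I c"
  shows "\<exists>d. only_desc I d \<and> hgen C i (hecke_comb c) = hecke_comb d \<and> pib i (descent_comb c) = descent_comb d"
proof -
  have step: "\<exists>d. only_desc I d \<and> hgen C i (hecke_el w) = (hecke_comb d :: ('n, 'a) hecke) \<and> pib i (descent_el w) = descent_comb d"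
    if w: "w \<in> W UNIV" "descent C w = I" for w
  proof -
    let ?\<delta> = "\<lambda>u w. if w = u then 1 else 0 :: 'a"
    consider (down) "hgen C i (hecke_el w) = (- hecke_el w :: ('n, 'a) hecke)" "pib i (descent_el w) = (- descent_el w :: ('n, 'a) laurent)"
      | (kill) "hgen C i (hecke_el w) = (0 :: ('n, 'a) hecke)" "pib i (descent_el w) = (0 :: ('n, 'a) laurent)"
      | (up) "hgen C i (hecke_el w) = (hecke_el (s i \<circ> w) :: ('n, 'a) hecke)" "pib i (descent_el w) = (descent_el (s i \<circ> w) :: ('n, 'a) laurent)"
        "s i \<circ> w \<in> W UNIV" "descent C (s i \<circ> w) = I"
      using module_step[OF w(1), of i] w(2) by blast
    then show ?thesis
    proof cases
      case down
      have "hscale (-1) (hecke_el w) = (- hecke_el w :: ('n, 'a) hecke)" by (rule hscale_simps)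
      then have "hgen C i (hecke_el w) = hecke_comb (\<lambda>v. -1 * ?\<delta> w v) \<and> pib i (descent_el w) = descent_comb (\<lambda>v. -1 * ?\<delta> w v)"
        unfolding hecke_comb_simps descent_comb_simps hecke_comb_single[OF w(1)] descent_comb_single[OF w(1)] down
        by (simp only: smult_minus_left smult_1 simp_thms)
      then show ?thesis using only_desc_closed(2)[OF only_desc_single[OF w(2)], of "-1"] by blast
    next
      case kill
      have "hecke_comb (\<lambda>v. 0 * ?\<delta> w v) = (0 :: ('n, 'a) hecke)" "descent_comb (\<lambda>v. 0 * ?\<delta> w v) = (0 :: ('n, 'a) laurent)"
        unfolding hecke_comb_simps descent_comb_simps by (simp_all only: hscale_simps smult_0)
      then show ?thesis using only_desc_closed(2)[OF only_desc_single[OF w(2)], of 0] kill by metis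
    next
      case up
      then show ?thesis using only_desc_single[OF up(4)] hecke_comb_single[OF up(3)] descent_comb_single[OF up(3)] by metis
    qed
  qed
  have "\<exists>D. \<forall>w. w \<in> W UNIV \<longrightarrow> descent C w = I \<longrightarrow>
      only_desc I (D w) \<and> hgen C i (hecke_el w) = (hecke_comb (D w) :: ('n, 'a) hecke) \<and> pib i (descent_el w) = descent_comb (D w)"
    by (intro choice allI) (use step in blast)
  then obtain D where D: "\<And>w. w \<in> W UNIV \<Longrightarrow> descent C w = I \<Longrightarrow>
      only_desc I (D w) \<and> hgen C i (hecke_el w) = (hecke_comb (D w) :: ('n, 'a) hecke) \<and> pib i (descent_el w) = descent_comb (D w)"
    by blast
  \<comment> \<open>Outside the class of \<open>I\<close> the family \<open>D\<close> is arbitrary,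
    but there \<open>c w\<close> is 0, so only members with the chosen properties
    contribute.\<close>
  define d where "d v = (\<Sum>w\<in>W UNIV. c w * D w v)" for v
  have cw: "c w = 0" if "w \<in> W UNIV" "descent C w \<noteq> I" for w using assms that by (simp add: only_desc_def)
  have y: "hscale (c w) (hgen C i (hecke_el w)) = hscale (c w) (hecke_comb (D w))"
    and b: "smult (c w) (pib i (descent_el w)) = smult (c w) (descent_comb (D w))" if w: "w \<in> W UNIV" for w
    using D[OF w] cw[OF w] by (cases "descent C w = I"; simp add: hscale_simps)+
  have "only_desc I d"
    unfolding only_desc_def d_def
  proof (intro ballI impI sum.neutral)
    fix v w assume v: "v \<in> W UNIV" "descent C v \<noteq> I" and w: "w \<in> W UNIV"
    show "c w * D w v = 0" using D[OF w] cw[OF w] v by (cases "descent C w = I") (auto simp: only_desc_def)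
  qed
  moreover have "hgen C i (hecke_comb c) = hecke_comb d"
  proof -
    have "hgen C i (hecke_comb c) = (\<Sum>w\<in>W UNIV. hscale (c w) (hgen C i (hecke_el w)))"
      unfolding hecke_comb_def by (simp only: hlin_sum[OF hlin_hgen] hlin_hscale[OF hlin_hgen])
    also have "\<dots> = (\<Sum>w\<in>W UNIV. hscale (c w) (hecke_comb (D w)))" by (rule sum.cong[OF refl y])
    also have "\<dots> = hecke_comb d"
      by (rule ext) (simp add: hecke_comb_def d_def sum_hecke_apply sum_distrib_left sum_distrib_right mult.assoc,
          rule sum.swap)
    finally show ?thesis .
  qed
  moreover have "pib i (descent_comb c) = descent_comb d"
  proof -
    have "pib i (descent_comb c) = (\<Sum>w\<in>W UNIV. smult (c w) (pib i (descent_el w)))"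
      unfolding descent_comb_def lincomb_def by (simp only: lin_sum[OF lin_pib] lin_smult[OF lin_pib])
    also have "\<dots> = (\<Sum>w\<in>W UNIV. smult (c w) (descent_comb (D w)))" by (rule sum.cong[OF refl b])
    also have "\<dots> = descent_comb d"
      by (rule poly_mapping_eqI) (simp add: descent_comb_def lincomb_def d_def lookup_sum lookup_smult
          sum_distrib_left sum_distrib_right mult.assoc, rule sum.swap)
    finally show ?thesis .
  qed
  ultimately show ?thesis by blast
qed

lemma only_desc_word:
  fixes c :: "'n weyl_elt \<Rightarrow> 'a::field"
  assumes "only_desc I c"
  shows "\<exists>d. only_desc I d \<and> op_word (hgen C) is (hecke_comb c) = hecke_comb d \<and> op_word pib is (descent_comb c) = descent_comb d"
proof (induction "is")
  case Nil
  show ?case using assms by auto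
next
  case (Cons i "is")
  then obtain d where d: "only_desc I d" "op_word (hgen C) is (hecke_comb c) = hecke_comb d" "op_word pib is (descent_comb c) = descent_comb d"
    by blast
  then show ?case unfolding op_word_Cons comp_apply d(2,3) by (intro only_desc_hgen d(1))
qed

lemma descent_el_longest: "demazure_bar_w C (longest C I) (expw (weight_of_set I)) = descent_el (longest C I)"
  by (simp add: descent_el_def descent_longest)

lemma hecke_el_longest: "hT C (longest C I) (hT' C (longest C (- I)) (hbasis id)) = hecke_el (longest C I)"
  by (simp add: hecke_el_def Tprime_longest_def descent_longest)

text \<open>An element with descent set \<open>I\<close> is \<open>u\<close> times
  \<open>longest C I\<close> with additive lengths, so one \<open>u\<close> carries the generator of
  either cyclic module to the basis element of \<open>w\<close>.\<close>

lemma descent_el_factor: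
  assumes "w \<in> W UNIV" "descent C w = I"
  obtains u where "u \<in> W UNIV"
    "(descent_el w :: ('n, 'a::field) laurent) = demazure_bar_w C u (descent_el (longest C I))"
    "(hecke_el w :: ('n, 'a) hecke) = hT C u (hecke_el (longest C I))"
proof -
  obtain u where u: "u \<in> W UNIV" "u \<circ> longest C I = w" "len w = len u + len (longest C I)"
    using longest_factor[OF assms(1), of I] assms(2) by blast
  have x: "longest C I \<in> W UNIV" using longest_props(1) W_sub by blast
  have l: "len (u \<circ> longest C I) = len u + len (longest C I)" using u by simp
  note fb = opw_mult[OF word_indep_pib u(1) x l, unfolded u(2)]
    and fy = opw_mult[OF word_indep_hgen u(1) x l, unfolded u(2)]
  have "(descent_el w :: ('n, 'a) laurent) = demazure_bar_w C u (descent_el (longest C I))"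
    by (simp only: descent_el_def descent_longest assms(2) demazure_bar_w_opw fb comp_apply)
  moreover have "(hecke_el w :: ('n, 'a) hecke) = hT C u (hecke_el (longest C I))"
    by (simp only: hecke_el_def descent_longest assms(2) hT_opw fy comp_apply)
  ultimately show ?thesis using that u(1) by blast
qed

lemma smult_sum_left: "(\<Sum>x\<in>A. smult (c x) f) = smult (sum c A) f"
  by (induction A rule: infinite_finite_induct) (simp_all add: smult_add_left)

lemma hscale_sum_left: "(\<Sum>x\<in>A. hscale (c x) h) = hscale (sum c A) h"
  by (rule ext) (simp add: sum_hecke_apply sum_distrib_right)

text \<open>The elements \<open>u w\<close> come from a choice, so coefficients are collected over
  the fibres and no injectivity of \<open>u\<close> has to be shown. The parameter
  \<open>scl\<close> stands for scalar multiplication in the group algebra or in the Hecke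
  algebra.\<close>

lemma sum_regroup:
  assumes "finite S" "finite T" "u ` S \<subseteq> T"
    and scl: "\<And>A f. (\<Sum>x\<in>A. scl (c x) f) = scl (sum c A) f"
  shows "(\<Sum>w\<in>S. scl (c w) (g (u w))) = (\<Sum>x\<in>T. scl (\<Sum>w\<in>{w \<in> S. u w = x}. c w) (g x))"
proof -
  have "(\<Sum>w\<in>{w \<in> S. u w = x}. scl (c w) (g (u w))) = scl (\<Sum>w\<in>{w \<in> S. u w = x}. c w) (g x)" for x
  proof -
    have "(\<Sum>w\<in>{w \<in> S. u w = x}. scl (c w) (g (u w))) = (\<Sum>w\<in>{w \<in> S. u w = x}. scl (c w) (g x))"
      by (rule sum.cong) auto
    also have "\<dots> = scl (\<Sum>w\<in>{w \<in> S. u w = x}. c w) (g x)" by (rule scl)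
    finally show ?thesis .
  qed
  then show ?thesis using sum.group[OF assms(1-3), of "\<lambda>w. scl (c w) (g (u w))"] by simp
qed

text \<open>The generator is the \<open>descent_el\<close> of \<open>longest C I\<close>, whose
  descent set is \<open>I\<close>, and combinations over this class are stable under words in the
  operators. Conversely, \<open>descent_el_factor\<close> reaches every member of the class from the
  generator.\<close>

lemma mem_summand:
  "f \<in> summand I \<longleftrightarrow> (\<exists>c. only_desc I c \<and> f - descent_comb c \<in> (J :: ('n, 'a::field) laurent set))"
proof
  let ?v = "descent_el (longest C I) :: ('n, 'a) laurent"
  have x: "longest C I \<in> W UNIV" using longest_props(1) W_sub by blast
  define b where "b u = (\<lambda>w. if w = u then 1 else 0 :: 'a)" for u :: "'n weyl_elt"
  have bx: "only_desc I (b (longest C I))" "descent_comb (b (longest C I)) = ?v"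
    unfolding b_def by (intro only_desc_single descent_longest descent_comb_single x)+
  assume "f \<in> summand I"
  then obtain c where c: "f - lincomb (W UNIV) c (\<lambda>w. demazure_bar_w C w ?v) \<in> J"
    unfolding cyclic_mod_def descent_el_longest by blast
  have "\<forall>w. \<exists>d. only_desc I d \<and> demazure_bar_w C w ?v = descent_comb d"
    using only_desc_word[OF bx(1)] unfolding bx(2) demazure_bar_w_def by blast
  then obtain D where D: "\<And>w. only_desc I (D w)" "\<And>w. demazure_bar_w C w ?v = descent_comb (D w)"
    by metis
  define d where "d v = (\<Sum>w\<in>W UNIV. c w * D w v)" for v
  have "lincomb (W UNIV) c (\<lambda>w. demazure_bar_w C w ?v) = descent_comb d"
    unfolding lincomb_def D(2)
    by (rule poly_mapping_eqI) (simp add: descent_comb_def lincomb_def d_def lookup_sum lookup_smult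
          sum_distrib_left sum_distrib_right mult.assoc, rule sum.swap)
  moreover have "only_desc I d" using D(1) by (auto simp: only_desc_def d_def)
  ultimately show "\<exists>c. only_desc I c \<and> f - descent_comb c \<in> J" using c by metis
next
  let ?v = "descent_el (longest C I) :: ('n, 'a) laurent"
  assume "\<exists>c. only_desc I c \<and> f - descent_comb c \<in> J"
  then obtain c where c: "only_desc I c" "f - descent_comb c \<in> J" by blast
  have "\<forall>w. \<exists>u. w \<in> W UNIV \<and> descent C w = I \<longrightarrow> u \<in> W UNIV \<and> (descent_el w :: ('n, 'a) laurent) = demazure_bar_w C u ?v"
    using descent_el_factor by metis
  then obtain u where u: "\<And>w. w \<in> W UNIV \<Longrightarrow> descent C w = I \<Longrightarrow> u w \<in> W UNIV"
    "\<And>w. w \<in> W UNIV \<Longrightarrow> descent C w = I \<Longrightarrow> (descent_el w :: ('n, 'a) laurent) = demazure_bar_w C (u w) ?v"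
    by metis
  let ?S = "{w \<in> W UNIV. descent C w = I}"
  define d where "d x = (\<Sum>w\<in>{w \<in> ?S. u w = x}. c w)" for x
  have fin: "finite ?S" using finite_W by simp
  have "descent_comb c = (\<Sum>w\<in>?S. smult (c w) (descent_el w))"
    unfolding descent_comb_def lincomb_def using finite_W c(1)
    by (intro sum.mono_neutral_right) (auto simp: only_desc_def)
  also have "\<dots> = (\<Sum>w\<in>?S. smult (c w) (demazure_bar_w C (u w) ?v))"
    using u by (intro sum.cong) auto
  also have "\<dots> = (\<Sum>x\<in>W UNIV. smult (d x) (demazure_bar_w C x ?v))"
    unfolding d_def using u(1) by (intro sum_regroup[where scl = smult and g = "\<lambda>x. demazure_bar_w C x ?v"] fin finite_W smult_sum_left) auto
  finally have "f - lincomb (W UNIV) d (\<lambda>w. demazure_bar_w C w ?v) \<in> J"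
    using c(2) by (simp only: lincomb_def)
  then show "f \<in> summand I" unfolding cyclic_mod_def descent_el_longest by blast
qed

lemma mem_proj_mod:
  "h \<in> proj_mod C I \<longleftrightarrow> (\<exists>c. only_desc I c \<and> h = (hecke_comb c :: ('n, 'a::field) hecke))"
proof
  let ?v = "hecke_el (longest C I) :: ('n, 'a) hecke"
  have x: "longest C I \<in> W UNIV" using longest_props(1) W_sub by blast
  define b where "b u = (\<lambda>w. if w = u then 1 else 0 :: 'a)" for u :: "'n weyl_elt"
  have bx: "only_desc I (b (longest C I))" "hecke_comb (b (longest C I)) = ?v"
    unfolding b_def by (intro only_desc_single descent_longest hecke_comb_single x)+
  assume "h \<in> proj_mod C I"
  then obtain c where c: "h = (\<Sum>w\<in>W UNIV. hscale (c w) (hT C w ?v))"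
    unfolding proj_mod_def Let_def hecke_el_longest hscale_def by blast
  have "\<forall>w. \<exists>d. only_desc I d \<and> hT C w ?v = hecke_comb d"
    using only_desc_word[OF bx(1)] unfolding bx(2) hT_def by blast
  then obtain D where D: "\<And>w. only_desc I (D w)" "\<And>w. hT C w ?v = hecke_comb (D w)"
    by metis
  define d where "d v = (\<Sum>w\<in>W UNIV. c w * D w v)" for v
  have "h = hecke_comb d"
    unfolding c D(2)
    by (rule ext) (simp add: hecke_comb_def d_def sum_hecke_apply
          sum_distrib_left sum_distrib_right mult.assoc, rule sum.swap)
  moreover have "only_desc I d" using D(1) by (auto simp: only_desc_def d_def)
  ultimately show "\<exists>c. only_desc I c \<and> h = hecke_comb c" by blast
next
  let ?v = "hecke_el (longest C I) :: ('n, 'a) hecke"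
  assume "\<exists>c. only_desc I c \<and> h = hecke_comb c"
  then obtain c where c: "only_desc I c" "h = hecke_comb c" by blast
  have "\<forall>w. \<exists>u. w \<in> W UNIV \<and> descent C w = I \<longrightarrow> u \<in> W UNIV \<and> (hecke_el w :: ('n, 'a) hecke) = hT C u ?v"
    using descent_el_factor by metis
  then obtain u where u: "\<And>w. w \<in> W UNIV \<Longrightarrow> descent C w = I \<Longrightarrow> u w \<in> W UNIV"
    "\<And>w. w \<in> W UNIV \<Longrightarrow> descent C w = I \<Longrightarrow> (hecke_el w :: ('n, 'a) hecke) = hT C (u w) ?v"
    by metis
  let ?S = "{w \<in> W UNIV. descent C w = I}"
  define d where "d x = (\<Sum>w\<in>{w \<in> ?S. u w = x}. c w)" for x
  have fin: "finite ?S" using finite_W by simp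
  have "h = (\<Sum>w\<in>?S. hscale (c w) (hecke_el w))"
    unfolding c(2) hecke_comb_def using finite_W c(1)
    by (intro sum.mono_neutral_right) (auto simp: only_desc_def hscale_simps)
  also have "\<dots> = (\<Sum>w\<in>?S. hscale (c w) (hT C (u w) ?v))"
    using u by (intro sum.cong) auto
  also have "\<dots> = (\<Sum>x\<in>W UNIV. hscale (d x) (hT C x ?v))"
    unfolding d_def using u(1) by (intro sum_regroup[where scl = hscale and g = "\<lambda>x. hT C x ?v"] fin finite_W hscale_sum_left) auto
  finally show "h \<in> proj_mod C I"
    unfolding proj_mod_def Let_def hecke_el_longest hscale_def by blast
qed

section \<open>The isomorphisms and the direct decomposition\<close>

lemma hecke_comb_alg: "hecke_comb c \<in> hecke_alg C"
  unfolding hecke_comb_def by (rule conjunct2[OF phi_sum]) (rule hecke_el_alg)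

lemma descent_comb_group: "(\<Sum>I\<in>UNIV. descent_comb (\<lambda>w. if descent C w = I then c I w else 0)) = descent_comb (\<lambda>w. c (descent C w) w)"
proof (rule poly_mapping_eqI)
  fix k
  have "(\<Sum>I\<in>UNIV. \<Sum>w\<in>W UNIV. (if descent C w = I then c I w else 0) * lookup (descent_el w) k)
      = (\<Sum>w\<in>W UNIV. \<Sum>I\<in>UNIV. (if descent C w = I then c I w * lookup (descent_el w) k else 0))"
    by (subst sum.swap) (intro sum.cong refl, simp)
  then show "lookup (\<Sum>I\<in>UNIV. descent_comb (\<lambda>w. if descent C w = I then c I w else 0)) k
      = lookup (descent_comb (\<lambda>w. c (descent C w) w)) k"
    by (simp add: descent_comb_def lincomb_def lookup_sum lookup_smult sum.delta')
qed

lemma cong_descent_comb_indep: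
  assumes "f - descent_comb c \<in> J" "f \<in> (J :: ('n, 'a::field) laurent set)" "w \<in> W UNIV"
  shows "c w = 0"
  using descent_comb_indep[of c w] J_diff[OF assms(2,1)] assms(3) by simp

text \<open>\<open>phi\<close> is linear and equivariant exactly, and injectivity modulo the ideal
  is the independence of the \<open>descent_el\<close>. Only the match between \<open>P\<close> and
  \<open>M\<close> has to be supplied for each module.\<close>

lemma hmod_iso:
  assumes P: "P \<subseteq> hecke_alg C"
    and MP: "\<And>p. p \<in> P \<Longrightarrow> phi p \<in> M"
    and M: "\<And>m. m \<in> M \<Longrightarrow> \<exists>p\<in>P. m - phi p \<in> (J :: ('n, 'a::field) laurent set)"
  shows "hmod_iso_mod C J P M phi"
  unfolding hmod_iso_mod_def
proof (intro conjI ballI allI impI)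
  show "phi p \<in> M" if "p \<in> P" for p by (rule MP[OF that])
  show "phi (p + r) - (phi p + phi r) \<in> J" if "p \<in> P" "r \<in> P" for p r
    using that P by (simp add: phi_add subset_iff J_zero)
  show "phi (\<lambda>v. a * p v) - smult a (phi p) \<in> J" if "p \<in> P" for p a
    unfolding hscale_def[symmetric] using that P by (simp add: phi_hscale subset_iff J_zero)
  show "phi (hgen C i p) - pib i (phi p) \<in> J" if "p \<in> P" for p i
    using that P by (simp add: phi_hgen subset_iff J_zero)
  show "p = 0" if p: "p \<in> P" "phi p \<in> J" for p
  proof -
    obtain c where c: "p = hecke_comb c" using hecke_comb_surj P p(1) by blast
    then have "descent_comb c \<in> J" using p(2) by (simp only: phi_hecke_comb)
    then have "c w = 0" if "w \<in> W UNIV" for w using descent_comb_indep that by blast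
    then show ?thesis unfolding c hecke_comb_def by (intro sum.neutral) (simp add: hscale_simps)
  qed
  show "\<exists>p\<in>P. m - phi p \<in> J" if "m \<in> M" for m by (rule M[OF that])
qed

lemma proj_iso: "hmod_iso_mod C J (proj_mod C I) (summand I) (phi :: ('n, 'a::field) hecke \<Rightarrow> _)"
proof (rule hmod_iso)
  show "proj_mod C I \<subseteq> (hecke_alg C :: ('n, 'a) hecke set)"
    by (auto simp: mem_proj_mod hecke_comb_alg)
  show "phi p \<in> summand I" if p: "p \<in> proj_mod C I" for p :: "('n, 'a) hecke"
  proof -
    obtain c where c: "only_desc I c" "p = hecke_comb c" using p unfolding mem_proj_mod by blast
    have "phi p - descent_comb c \<in> J" unfolding c(2) phi_hecke_comb by (simp add: J_zero)
    then show ?thesis unfolding mem_summand using c(1) by blast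
  qed
  show "\<exists>p\<in>proj_mod C I. m - phi p \<in> J" if m: "m \<in> summand I" for m :: "('n, 'a) laurent"
  proof -
    obtain c where c: "only_desc I c" "m - descent_comb c \<in> J" using m unfolding mem_summand by blast
    then have "hecke_comb c \<in> proj_mod C I" unfolding mem_proj_mod by blast
    moreover have "m - phi (hecke_comb c) \<in> J" using c(2) by (simp only: phi_hecke_comb)
    ultimately show ?thesis by blast
  qed
qed

lemma regular_iso: "hmod_iso_mod C J (hecke_alg C) UNIV (phi :: ('n, 'a::field) hecke \<Rightarrow> _)"
proof (rule hmod_iso)
  show "\<exists>p\<in>hecke_alg C. m - phi p \<in> J" for m :: "('n, 'a) laurent"
  proof -
    obtain c where "m - descent_comb c \<in> J" using descent_comb_span by blast
    then have "m - phi (hecke_comb c) \<in> J" by (simp only: phi_hecke_comb)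
    then show ?thesis using hecke_comb_alg by blast
  qed
qed simp_all

lemma coinv_basis: "basis_mod J (W UNIV) (descent_el :: _ \<Rightarrow> ('n, 'a::field) laurent) UNIV"
  unfolding basis_mod_def lin_indep_mod_def spans_mod_def
  using descent_comb_indep descent_comb_span by (auto simp: descent_comb_def)

lemma summand_basis:
  "basis_mod J {w \<in> W UNIV. descent C w = I}
    (\<lambda>w. demazure_bar_w C w (expw (weight_of_set I)) :: ('n, 'a::field) laurent) (summand I)"
  unfolding basis_mod_def
proof (intro conjI)
  let ?S = "{w \<in> W UNIV. descent C w = I}"
  let ?b = "\<lambda>w. demazure_bar_w C w (expw (weight_of_set I)) :: ('n, 'a) laurent"
  show "\<forall>w\<in>?S. ?b w \<in> summand I"
  proof
    fix w assume w: "w \<in> ?S"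
    have "descent_el w - descent_comb (\<lambda>v. if v = w then 1 else 0) \<in> (J :: ('n, 'a) laurent set)"
      using w by (simp add: descent_comb_single J_zero)
    then have "descent_el w \<in> (summand I :: ('n, 'a) laurent set)"
      unfolding mem_summand using only_desc_single[of w I] w by blast
    then show "?b w \<in> summand I" using w by (simp add: descent_el_def)
  qed
  show "lin_indep_mod J ?S ?b"
    unfolding lin_indep_mod_def lincomb_desc
  proof (intro allI impI)
    fix c :: "'n weyl_elt \<Rightarrow> 'a"
    assume a: "descent_comb (\<lambda>w. if descent C w = I then c w else 0) \<in> J"
    have "\<forall>w\<in>W UNIV. (if descent C w = I then c w else 0) = 0" using descent_comb_indep[OF a] by (rule ballI)
    then show "\<forall>w\<in>?S. c w = 0" by auto
  qed
  show "spans_mod J ?S ?b (summand I)"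
    unfolding spans_mod_def lincomb_desc
  proof
    fix m :: "('n, 'a) laurent" assume "m \<in> summand I"
    then obtain c where c: "only_desc I c" "m - descent_comb c \<in> J" unfolding mem_summand by blast
    have "m - descent_comb (\<lambda>w. if descent C w = I then c w else 0) \<in> J"
      using c(2) unfolding descent_comb_only_desc[OF c(1)] .
    then show "\<exists>c. m - descent_comb (\<lambda>w. if descent C w = I then c w else 0) \<in> J" by (rule exI[of _ c])
  qed
qed

lemma summands_span: "\<exists>m. (\<forall>I. m I \<in> summand I) \<and> f - (\<Sum>I\<in>UNIV. m I) \<in> (J :: ('n, 'a::field) laurent set)"
proof -
  obtain c where c: "f - descent_comb c \<in> J" using descent_comb_span by blast
  define m where "m I = (descent_comb (\<lambda>w. if descent C w = I then c w else 0) :: ('n, 'a) laurent)" for I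
  have "only_desc I (\<lambda>w. if descent C w = I then c w else 0)" for I by (simp add: only_desc_def)
  then have "m I \<in> summand I" for I
    unfolding mem_summand m_def by (intro exI[of _ "\<lambda>w. if descent C w = I then c w else 0"]) (simp add: J_zero)
  moreover have "(\<Sum>I\<in>UNIV. m I) = descent_comb c" unfolding m_def by (simp only: descent_comb_group)
  ultimately have "(\<forall>I. m I \<in> summand I) \<and> f - (\<Sum>I\<in>UNIV. m I) \<in> J" using c by simp
  then show ?thesis by blast
qed

text \<open>Modulo the ideal each \<open>m I\<close> is a combination over its own descent class.
  The classes are disjoint, so the sum is a single combination with coefficients
  \<open>c (descent C w) w\<close>, and independence makes all of them vanish at once.\<close>

lemma summands_direct:
  assumes "\<And>I. m I \<in> summand I" "(\<Sum>I\<in>UNIV. m I) \<in> (J :: ('n, 'a::field) laurent set)"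
  shows "m I \<in> J"
proof -
  have "\<forall>I. \<exists>c. only_desc I c \<and> m I - descent_comb c \<in> J" using assms(1) unfolding mem_summand by blast
  then obtain c where c: "\<And>I. only_desc I (c I)" "\<And>I. m I - descent_comb (c I) \<in> J" by metis
  have "(\<Sum>I\<in>UNIV. m I - descent_comb (c I)) \<in> J" using c(2) by (intro J_sum) auto
  then have "(\<Sum>I\<in>UNIV. m I) - (\<Sum>I\<in>UNIV. descent_comb (\<lambda>w. if descent C w = I then c I w else 0)) \<in> J"
    using descent_comb_only_desc[OF c(1)] by (simp add: sum_subtractf)
  then have "(\<Sum>I\<in>UNIV. m I) - descent_comb (\<lambda>w. c (descent C w) w) \<in> J" unfolding descent_comb_group .
  from cong_descent_comb_indep[OF this assms(2)] have z: "c (descent C w) w = 0" if "w \<in> W UNIV" for w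
    using that by simp
  have "c I w = 0" if w: "w \<in> W UNIV" for w
    using z[OF w] c(1)[of I] w by (cases "descent C w = I") (auto simp: only_desc_def)
  then have "descent_comb (c I) = 0" by (simp add: descent_comb_def lincomb_def)
  then show ?thesis using c(2)[of I] by simp
qed

end

theorem theorem5p3:
  fixes C :: "'n::finite \<Rightarrow> 'n \<Rightarrow> int"
    and F_type :: "'a::field itself"
  assumes cartan: "gen_cartan C"
    and finite_W: "finite (weyl C UNIV)"
  defines "W \<equiv> weyl C UNIV"
    and "J \<equiv> (coinv_ideal C :: ('n, 'a) laurent set)"
  shows
    \<comment> \<open>basis {pibar_w e^{lambda_{D(w)}} : w in W} of F[Lambda]/J\<close>
    "basis_mod J W (\<lambda>w. demazure_bar_w C w (expw (weight_of_set (descent C w)))) UNIV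
     \<comment> \<open>each summand H_W(0).pibar_{w_0(I)} z_I has basis {pibar_w z_I : D(w) = I}\<close>
     \<and> (\<forall>I. basis_mod J {w \<in> W. descent C w = I}
              (\<lambda>w. demazure_bar_w C w (expw (weight_of_set I)))
              (cyclic_mod C (demazure_bar_w C (longest C I) (expw (weight_of_set I)))))
     \<comment> \<open>the sum of the summands is all of F[Lambda]/J ...\<close>
     \<and> (\<forall>f. \<exists>m. (\<forall>I. m I \<in> cyclic_mod C (demazure_bar_w C (longest C I) (expw (weight_of_set I))))
              \<and> f - (\<Sum>I\<in>UNIV. m I) \<in> J)
     \<comment> \<open>... and it is direct\<close>
     \<and> (\<forall>m. (\<forall>I. m I \<in> cyclic_mod C (demazure_bar_w C (longest C I) (expw (weight_of_set I))))
              \<longrightarrow> (\<Sum>I\<in>UNIV. m I) \<in> J \<longrightarrow> (\<forall>I. m I \<in> J))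
     \<comment> \<open>each summand is isomorphic to P_I\<close>
     \<and> (\<forall>I. \<exists>\<phi>. hmod_iso_mod C J (proj_mod C I)
              (cyclic_mod C (demazure_bar_w C (longest C I) (expw (weight_of_set I)))) \<phi>)
     \<comment> \<open>F[Lambda]/J is isomorphic to the regular representation of H_W(0)\<close>
     \<and> (\<exists>\<phi>. hmod_iso_mod C J (hecke_alg C) UNIV \<phi>)"
proof -
  interpret fin_cartan C by unfold_locales (fact cartan, fact finite_W)
  show ?thesis
    unfolding W_def J_def
  proof (intro conjI)
    show "basis_mod (coinv_ideal C :: ('n, 'a) laurent set) (weyl C UNIV)
        (\<lambda>w. demazure_bar_w C w (expw (weight_of_set (descent C w)))) UNIV"
      using coinv_basis[where 'a = 'a] unfolding descent_el_def .
    show "\<forall>I. basis_mod (coinv_ideal C :: ('n, 'a) laurent set) {w \<in> weyl C UNIV. descent C w = I}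
        (\<lambda>w. demazure_bar_w C w (expw (weight_of_set I))) (summand I)"
      by (rule allI) (rule summand_basis)
    show "\<forall>f. \<exists>m. (\<forall>I. m I \<in> summand I) \<and> f - (\<Sum>I\<in>UNIV. m I) \<in> (coinv_ideal C :: ('n, 'a) laurent set)"
      by (rule allI) (rule summands_span)
    show "\<forall>m. (\<forall>I. m I \<in> summand I) \<longrightarrow> (\<Sum>I\<in>UNIV. m I) \<in> (coinv_ideal C :: ('n, 'a) laurent set) \<longrightarrow>
        (\<forall>I. m I \<in> coinv_ideal C)"
    proof (intro allI impI)
      fix m :: "'n set \<Rightarrow> ('n, 'a) laurent" and I
      assume "\<forall>I. m I \<in> summand I" "(\<Sum>I\<in>UNIV. m I) \<in> coinv_ideal C"
      then show "m I \<in> coinv_ideal C" using summands_direct[of m I] by blast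
    qed
    show "\<forall>I. \<exists>\<phi>. hmod_iso_mod C (coinv_ideal C :: ('n, 'a) laurent set) (proj_mod C I) (summand I) \<phi>"
      using proj_iso by blast
    show "\<exists>\<phi>. hmod_iso_mod C (coinv_ideal C :: ('n, 'a) laurent set) (hecke_alg C) UNIV \<phi>"
      using regular_iso by blast
  qed
qed

end
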